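(* Let $D$ be a measurable subset of $\mathbb{R}^d$ with positive Lebesgue measure and let $\partial\notin D$. Let $(X_n)_{n\in\mathbb{Z}_+}$ be the Markov chain in $D\cup\{\partial\}$ defined by $$X_{n+1}=\begin{cases}f(X_n)+\xi_n&\text{if }X_n\ne\partial\text{ and }f(X_n)+\xi_n\in D,\\ \partial&\text{otherwise,}\end{cases}$$ where $f:\mathbb{R}^d\to\mathbb{R}^d$ is a locally bounded measurable function such that $|x|-|f(x)|\to+\infty$ when $|x|\to+\infty$, and $(\xi_n)$ is an i.i.d. non-degenerate Gaussian sequence in $\mathbb{R}^d$. Set $\varphi_1(x)=e^{|x|}$. Then there exist a positive measurable function $\varphi_2$ on $D$, a quasi-stationary distribution $\nu_{QSD}$ on $D$ and constants $C\in(0,+\infty)$ and $\alpha\in(0,1)$ such that $$\left\|\mathbb{P}_\mu(X_n\in\cdot\mid n<\tau_\partial)-\nu_{QSD}\right\|_{TV(\varphi_1)}\le C\alpha^n\,\frac{\mu(\varphi_1)}{\mu(\varphi_2)},\qquad\forall n\in\mathbb{Z}_+,$$ for all probability measures $\mu$ on $D$ such that $\mu(\varphi_1)<+\infty$ and $\mu(\varphi_2)>0$.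
   Context: $\tau_\partial=\inf\{n\in\mathbb{Z}_+:X_n=\partial\}$; $\mathbb{P}_\mu$ is the law of the chain with initial distribution $\mu$; $\mu(\varphi)=\int\varphi\,\mathrm d\mu$. A Gaussian law is non-degenerate if its covariance matrix is invertible. A quasi-stationary distribution is a probability measure $\nu$ on $D$ such that $\mathbb{P}_\nu(X_n\in\cdot\mid n<\tau_\partial)=\nu$ for all $n\in\mathbb{Z}_+$. For probability measures $\mu_1,\mu_2$ on $D$, $$\|\mu_1-\mu_2\|_{TV(\varphi_1)}=\sup\{|\mu_1(h)-\mu_2(h)|:\ h:D\to\mathbb{R}\text{ measurable},\ |h|\le\varphi_1\}.$$ *)

theory Defs
  imports "HOL-Probability.Probability"
begin

definition std_gaussian :: "(real^'d) measure" where
  "std_gaussian = density lborel (\<lambda>z. ennreal (\<Prod>i\<in>UNIV. std_normal_density (z $ i)))"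

text \<open>Gaussian laws are the affine images of the standard one; degenerate laws are included.\<close>
definition gaussian_law :: "(real^'d) measure \<Rightarrow> bool" where
  "gaussian_law G \<longleftrightarrow>
     (\<exists>(m :: real^'d) (A :: real^'d^'d). G = distr std_gaussian borel (\<lambda>z. m + A *v z))"

definition covariance_matrix :: "(real^'d) measure \<Rightarrow> real^'d^'d" where
  "covariance_matrix G =
     (\<chi> i j. \<integral>x. (x $ i - (\<integral>y. y $ i \<partial>G)) * (x $ j - (\<integral>y. y $ j \<partial>G)) \<partial>G)"

definition nondegenerate :: "(real^'d) measure \<Rightarrow> bool" where
  "nondegenerate G \<longleftrightarrow> invertible (covariance_matrix G)"

definition locally_bounded :: "(real^'d \<Rightarrow> real^'d) \<Rightarrow> bool" where
  "locally_bounded f \<longleftrightarrow> (\<forall>x. \<exists>U. open U \<and> x \<in> U \<and> bounded (f ` U))"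

definition prob_measure_on :: "(real^'d) set \<Rightarrow> (real^'d) measure \<Rightarrow> bool" where
  "prob_measure_on D \<mu> \<longleftrightarrow> prob_space \<mu> \<and> sets \<mu> = sets (restrict_space borel D)"

text \<open>The cemetery state is \<^term>\<open>None\<close>. A sample point is a pair of the initial state and of a sample
  point of the probability space carrying the noise \<open>\<xi>\<close>.\<close>
primrec chain ::
  "(real^'d) set \<Rightarrow> (real^'d \<Rightarrow> real^'d) \<Rightarrow> (nat \<Rightarrow> 'w \<Rightarrow> real^'d)
     \<Rightarrow> nat \<Rightarrow> (real^'d) \<times> 'w \<Rightarrow> (real^'d) option" where
  "chain D f \<xi> 0 p = Some (fst p)"
| "chain D f \<xi> (Suc n) p =
     (case chain D f \<xi> n p of
        None \<Rightarrow> None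
      | Some y \<Rightarrow> if f y + \<xi> n (snd p) \<in> D then Some (f y + \<xi> n (snd p)) else None)"

definition absorption_time ::
  "(real^'d) set \<Rightarrow> (real^'d \<Rightarrow> real^'d) \<Rightarrow> (nat \<Rightarrow> 'w \<Rightarrow> real^'d) \<Rightarrow> (real^'d) \<times> 'w \<Rightarrow> enat" where
  "absorption_time D f \<xi> p = (INF n\<in>{n. chain D f \<xi> n p = None}. enat n)"

text \<open>\<open>P_\<mu>(X_n \<in> \<cdot> | n < \<tau>)\<close> as a measure on \<open>D\<close>. The law \<open>P_\<mu>\<close> is realised on the product of
  \<open>\<mu>\<close> and the noise space \<open>M\<close>, so that \<open>X_0\<close> has law \<open>\<mu>\<close> and is independent of the noise.\<close>
definition conditional_law ::
  "(real^'d) set \<Rightarrow> (real^'d \<Rightarrow> real^'d) \<Rightarrow> 'w measure \<Rightarrow> (nat \<Rightarrow> 'w \<Rightarrow> real^'d)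
     \<Rightarrow> (real^'d) measure \<Rightarrow> nat \<Rightarrow> (real^'d) measure" where
  "conditional_law D f M \<xi> \<mu> n =
     measure_of D (sets (restrict_space borel D))
       (\<lambda>A. ennreal \<P>(p in \<mu> \<Otimes>\<^sub>M M.
          chain D f \<xi> n p \<in> Some ` A \<bar> enat n < absorption_time D f \<xi> p))"

definition quasi_stationary ::
  "(real^'d) set \<Rightarrow> (real^'d \<Rightarrow> real^'d) \<Rightarrow> 'w measure \<Rightarrow> (nat \<Rightarrow> 'w \<Rightarrow> real^'d)
     \<Rightarrow> (real^'d) measure \<Rightarrow> bool" where
  "quasi_stationary D f M \<xi> \<nu> \<longleftrightarrow>
     prob_measure_on D \<nu> \<and> (\<forall>n. conditional_law D f M \<xi> \<nu> n = \<nu>)"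

text \<open>The supremum is taken in \<^typ>\<open>ennreal\<close>, so that it is infinite when unbounded. If \<open>\<phi> \<ge> 0\<close> is
  integrable for exactly one of the two laws, the truncations \<open>min \<phi> k\<close> already give the value
  infinity; if it is integrable for both, so is every \<open>h\<close>. The convention that non-integrable
  functions have integral 0 therefore matters only when \<open>\<phi>\<close> is integrable for neither law.\<close>
definition tv_dist ::
  "(real^'d) set \<Rightarrow> (real^'d \<Rightarrow> real) \<Rightarrow> (real^'d) measure \<Rightarrow> (real^'d) measure \<Rightarrow> ennreal" where
  "tv_dist D \<phi> \<mu>1 \<mu>2 =
     (SUP h\<in>{h \<in> borel_measurable (restrict_space borel D). \<forall>x\<in>D. \<bar>h x\<bar> \<le> \<phi> x}.
        ennreal \<bar>(\<integral>x. h x \<partial>\<mu>1) - (\<integral>x. h x \<partial>\<mu>2)\<bar>)"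

definition phi1 :: "real^'d \<Rightarrow> real" where
  "phi1 x = exp (norm x)"

end

theory Submission
  imports Defs
begin

text \<open>
  Let \<open>P\<close> be the transition operator of the chain killed outside \<open>D\<close>, \<open>V = phi1\<close>, let
  \<open>h_n = P^n 1\<close> be the survival probabilities, and let \<open>c_n\<close> be the integral of \<open>h_n\<close> over a fixed
  bounded piece \<open>B 0\<close> of \<open>D\<close> of positive measure. Given survival, \<open>\<phi>\<close> has mean
  \<open>\<mu>(P^n \<phi>) / \<mu>(h_n)\<close>, so the theorem says that \<open>P^n \<phi>\<close> is close to a multiple of \<open>h_n\<close>, and that the
  factor \<open>\<nu>(\<phi>)\<close> does not depend on the starting point. This is read off from the cross products
  \<open>w_n(x,y) = P^n \<phi>(x) h_n(y) - P^n \<phi>(y) h_n(x)\<close>.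

  The tensor square of \<open>P\<close> maps \<open>w_n\<close> to \<open>w_(n+1)\<close>. Since \<open>w_n\<close> is antisymmetric, the kernel
  \<open>p(x,z) p(y,z')\<close> of the tensor square may be antisymmetrised in \<open>(z,z')\<close>, and the cancellation
  costs a fixed amount as soon as \<open>x\<close> and \<open>y\<close> lie in a bounded set, because there both kernels have
  a common lower bound (\<open>integral_cross_le\<close>). If one of the points is far away, \<open>|x| - |f x| \<rightarrow> \<infinity>\<close> gives
  the gain: \<open>PV / V\<close> becomes arbitrarily small at infinity, so that the term with \<open>V\<close> below decays
  faster than \<open>c_n^2\<close> can. Both gains are combined in the induction hypothesis
  \<open>|w_n| \<le> a \<alpha>^n (h_n h_n + \<beta> c_n^2 V V)\<close> (\<open>cross_contraction\<close>). The induction rests on two growth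
  estimates: \<open>c_n\<close> decays at most geometrically (\<open>mass_Suc_ge\<close>), and \<open>h_n\<close> is at most a constant times
  \<open>c_n V\<close> (\<open>survival_le_mass\<close>).

  The contraction gives everything else without any spectral theory for \<open>P\<close>. The normalised laws
  of the chain started uniformly in \<open>B 0\<close> are Cauchy in the \<open>V\<close>-weighted \<open>L^1\<close> norm and their limit
  is the quasi-stationary law \<open>\<nu>\<close> (\<open>invariant_weight\<close>). Integrating \<open>w_n\<close> in \<open>y\<close> against \<open>\<nu>\<close> yields
  \<open>|P^n \<phi> - \<nu>(\<phi>) h_n| \<le> C \<alpha>^n c_n V\<close> (\<open>geometric_convergence\<close>). Finally \<open>\<phi>2 = inf_n h_n / c_n\<close> is
  positive, and \<open>\<mu>(h_n) \<ge> c_n \<mu>(\<phi>2)\<close> turns the last estimate, divided by \<open>\<mu>(h_n)\<close>, into the claim.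

  For the Gaussian model, the noise is \<open>m + A z\<close> with \<open>z\<close> standard normal, and \<open>A\<close> is invertible
  because the covariance is. Relative to the image of Lebesgue measure under \<open>A\<close>, the transition
  density is the standard normal density at \<open>A^{-1} (y - f x - m)\<close>, so that no determinant enters.
\<close>

section \<open>Antisymmetrised products of integrals\<close>

lemma (in pair_sigma_finite) integrable_mult_pair:
  fixes u :: "'a \<Rightarrow> real" and v :: "'b \<Rightarrow> real"
  assumes u: "integrable M1 u" and v: "integrable M2 v"
  shows "integrable (M1 \<Otimes>\<^sub>M M2) (\<lambda>z. u (fst z) * v (snd z))"
proof -
  note [measurable] = borel_measurable_integrable[OF u] borel_measurable_integrable[OF v]
  have eq: "(\<lambda>z. u (fst z) * v (snd z)) = (\<lambda>(x, y). u x * v y)"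
    by (simp add: split_beta')
  have "integrable M2 (\<lambda>y. u x * v y)" for x using v by simp
  moreover have "integrable M1 (\<lambda>x. \<integral>y. norm (u x * v y) \<partial>M2)"
    using u by (simp add: abs_mult)
  ultimately show ?thesis
    unfolding eq by (intro Fubini_integrable) auto
qed

lemma (in pair_sigma_finite) integral_mult_pair:
  fixes u :: "'a \<Rightarrow> real" and v :: "'b \<Rightarrow> real"
  assumes u: "integrable M1 u" and v: "integrable M2 v"
  shows "(\<integral>z. u (fst z) * v (snd z) \<partial>(M1 \<Otimes>\<^sub>M M2)) = (\<integral>x. u x \<partial>M1) * (\<integral>y. v y \<partial>M2)"
  using integral_fst'[OF integrable_mult_pair[OF u v]] by simp

text \<open>
  The gain in the contraction: \<open>|a b' - a' b|\<close> is the sum of the two products minus twice the smaller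
  one, so that a common lower bound \<open>s\<close> may be subtracted twice.
\<close>
lemma abs_cross_le:
  fixes a a' b b' k h h' V V' \<alpha> \<beta> :: real
  assumes "0 \<le> a" "0 \<le> a'" "0 \<le> b" "0 \<le> b'" "0 \<le> h" "0 \<le> h'" "0 \<le> V" "0 \<le> V'"
    and "0 \<le> \<alpha>" "0 \<le> \<beta>" and s: "s \<le> a * b'" "s \<le> a' * b"
    and w: "\<bar>w\<bar> \<le> \<alpha> * (h * h') + \<beta> * (V * V')"
  shows "\<bar>(a * b' - a' * b) * w\<bar>
    \<le> \<alpha> * ((a * b' + a' * b - 2 * s) * (h * h')) + \<beta> * ((a * b' + a' * b) * (V * V'))"
    (is "?L \<le> ?R")
proof -
  have ab: "0 \<le> a * b'" "0 \<le> a' * b" using assms by auto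
  have 1: "\<bar>a * b' - a' * b\<bar> \<le> a * b' + a' * b - 2 * s" using s by linarith
  have 2: "\<bar>a * b' - a' * b\<bar> \<le> a * b' + a' * b" using ab by linarith
  have "?L \<le> \<bar>a * b' - a' * b\<bar> * (\<alpha> * (h * h') + \<beta> * (V * V'))"
    unfolding abs_mult by (intro mult_left_mono w) auto
  also have "\<dots> = \<bar>a * b' - a' * b\<bar> * (\<alpha> * (h * h')) + \<bar>a * b' - a' * b\<bar> * (\<beta> * (V * V'))"
    by (simp add: algebra_simps)
  also have "\<dots> \<le> (a * b' + a' * b - 2 * s) * (\<alpha> * (h * h')) + (a * b' + a' * b) * (\<beta> * (V * V'))"
    by (intro add_mono mult_right_mono 1 2) (use assms in auto)
  finally show ?thesis by (simp add: algebra_simps)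
qed

text \<open>
  Twice the difference on the left is the double integral of
  \<open>(a y b y' - a y' b y) (F y h y' - F y' h y)\<close> (the identity of Andreief and Cauchy-Binet). The bound
  on the second factor is therefore passed on, improved by the common part \<open>k\<close> of \<open>a\<close> and \<open>b\<close> on \<open>B\<close>.
\<close>
lemma (in sigma_finite_measure) integral_cross_le:
  fixes a b F h V :: "'a \<Rightarrow> real"
  assumes int: "integrable M (\<lambda>y. a y * F y)" "integrable M (\<lambda>y. b y * F y)"
      "integrable M (\<lambda>y. a y * h y)" "integrable M (\<lambda>y. b y * h y)"
      "integrable M (\<lambda>y. a y * V y)" "integrable M (\<lambda>y. b y * V y)"
      "integrable M (\<lambda>y. indicator B y * h y)"
    and nonneg: "\<And>y. y \<in> space M \<Longrightarrow> 0 \<le> a y" "\<And>y. y \<in> space M \<Longrightarrow> 0 \<le> b y"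
      "\<And>y. y \<in> space M \<Longrightarrow> 0 \<le> h y" "\<And>y. y \<in> space M \<Longrightarrow> 0 \<le> V y"
    and k: "0 \<le> k" "\<And>y. y \<in> B \<Longrightarrow> k \<le> a y" "\<And>y. y \<in> B \<Longrightarrow> k \<le> b y"
    and \<alpha>\<beta>: "0 \<le> \<alpha>" "0 \<le> \<beta>"
    and w: "\<And>y y'. y \<in> space M \<Longrightarrow> y' \<in> space M \<Longrightarrow>
              \<bar>F y * h y' - F y' * h y\<bar> \<le> \<alpha> * (h y * h y') + \<beta> * (V y * V y')"
  shows "\<bar>(\<integral>y. a y * F y \<partial>M) * (\<integral>y. b y * h y \<partial>M) - (\<integral>y. b y * F y \<partial>M) * (\<integral>y. a y * h y \<partial>M)\<bar>
      \<le> \<alpha> * ((\<integral>y. a y * h y \<partial>M) * (\<integral>y. b y * h y \<partial>M) - k\<^sup>2 * (\<integral>y. indicator B y * h y \<partial>M)\<^sup>2)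
        + \<beta> * ((\<integral>y. a y * V y \<partial>M) * (\<integral>y. b y * V y \<partial>M))"
proof -
  interpret pair_sigma_finite M M by unfold_locales
  let ?I = "\<lambda>u. \<integral>y. u y \<partial>M"
  let ?P = "\<lambda>u v z. u (fst z) * v (snd z) :: real"
  let ?aF = "\<lambda>y. a y * F y" and ?bF = "\<lambda>y. b y * F y" and ?ah = "\<lambda>y. a y * h y"
    and ?bh = "\<lambda>y. b y * h y" and ?aV = "\<lambda>y. a y * V y" and ?bV = "\<lambda>y. b y * V y"
    and ?Bh = "\<lambda>y. indicator B y * h y"
  note I = integrable_mult_pair
  define L where "L z = ?P ?aF ?bh z - ?P ?ah ?bF z - ?P ?bF ?ah z + ?P ?bh ?aF z" for z
  define R where "R z = \<alpha> * (?P ?ah ?bh z + ?P ?bh ?ah z - 2 * k\<^sup>2 * ?P ?Bh ?Bh z)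
     + \<beta> * (?P ?aV ?bV z + ?P ?bV ?aV z)" for z
  have intL: "integrable (M \<Otimes>\<^sub>M M) L"
    unfolding L_def by (intro Bochner_Integration.integrable_add Bochner_Integration.integrable_diff I int)
  have intR: "integrable (M \<Otimes>\<^sub>M M) R"
    unfolding R_def
    by (intro Bochner_Integration.integrable_add Bochner_Integration.integrable_diff
         integrable_mult_right I int)
  have LL: "integral\<^sup>L (M \<Otimes>\<^sub>M M) L = 2 * (?I ?aF * ?I ?bh - ?I ?bF * ?I ?ah)"
  proof -
    have "integral\<^sup>L (M \<Otimes>\<^sub>M M) L = integral\<^sup>L (M \<Otimes>\<^sub>M M) (?P ?aF ?bh) - integral\<^sup>L (M \<Otimes>\<^sub>M M) (?P ?ah ?bF)
        - integral\<^sup>L (M \<Otimes>\<^sub>M M) (?P ?bF ?ah) + integral\<^sup>L (M \<Otimes>\<^sub>M M) (?P ?bh ?aF)"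
      unfolding L_def
      using I[OF int(1,4)] I[OF int(3,2)] I[OF int(2,3)] I[OF int(4,1)] by simp
    then show ?thesis
      unfolding integral_mult_pair[OF int(1,4)] integral_mult_pair[OF int(3,2)]
        integral_mult_pair[OF int(2,3)] integral_mult_pair[OF int(4,1)]
      by (simp add: algebra_simps)
  qed
  have RR: "integral\<^sup>L (M \<Otimes>\<^sub>M M) R = 2 * (\<alpha> * (?I ?ah * ?I ?bh - k\<^sup>2 * (?I ?Bh)\<^sup>2) + \<beta> * (?I ?aV * ?I ?bV))"
  proof -
    have "integral\<^sup>L (M \<Otimes>\<^sub>M M) R = \<alpha> * (integral\<^sup>L (M \<Otimes>\<^sub>M M) (?P ?ah ?bh) + integral\<^sup>L (M \<Otimes>\<^sub>M M) (?P ?bh ?ah)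
        - 2 * k\<^sup>2 * integral\<^sup>L (M \<Otimes>\<^sub>M M) (?P ?Bh ?Bh)) + \<beta> * (integral\<^sup>L (M \<Otimes>\<^sub>M M) (?P ?aV ?bV) + integral\<^sup>L (M \<Otimes>\<^sub>M M) (?P ?bV ?aV))"
      unfolding R_def
      using I[OF int(3,4)] I[OF int(4,3)] I[OF int(7,7)] I[OF int(5,6)] I[OF int(6,5)] by simp
    then show ?thesis
      unfolding integral_mult_pair[OF int(3,4)] integral_mult_pair[OF int(4,3)]
        integral_mult_pair[OF int(7,7)] integral_mult_pair[OF int(5,6)] integral_mult_pair[OF int(6,5)]
      by (simp add: power2_eq_square algebra_simps)
  qed
  have bound: "\<bar>L z\<bar> \<le> R z" if z: "z \<in> space (M \<Otimes>\<^sub>M M)" for z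
  proof -
    obtain y y' where zz: "z = (y, y')" and y: "y \<in> space M" "y' \<in> space M"
      using z by (auto simp: space_pair_measure)
    define s where "s = k\<^sup>2 * indicator B y * indicator B y'"
    have s: "s \<le> a y * b y'" "s \<le> a y' * b y"
      using nonneg(1,2)[OF y(1)] nonneg(1,2)[OF y(2)] k
      by (auto simp: s_def indicator_def power2_eq_square intro!: mult_mono mult_nonneg_nonneg)
    have "\<bar>(a y * b y' - a y' * b y) * (F y * h y' - F y' * h y)\<bar>
      \<le> \<alpha> * ((a y * b y' + a y' * b y - 2 * s) * (h y * h y')) + \<beta> * ((a y * b y' + a y' * b y) * (V y * V y'))"
      by (rule abs_cross_le) (use y nonneg \<alpha>\<beta> s w in auto)
    also have "\<dots> = R z" by (simp add: R_def zz s_def algebra_simps)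
    also have "(a y * b y' - a y' * b y) * (F y * h y' - F y' * h y) = L z"
      by (simp add: L_def zz algebra_simps)
    finally show ?thesis .
  qed
  have "\<bar>integral\<^sup>L (M \<Otimes>\<^sub>M M) L\<bar> \<le> integral\<^sup>L (M \<Otimes>\<^sub>M M) R"
    using intR intL bound by (intro order_trans[OF integral_abs_bound] integral_mono) auto
  moreover have "\<bar>s\<bar> \<le> t" if "\<bar>2 * s\<bar> \<le> 2 * t" for s t :: real
    using that by linarith
  ultimately show ?thesis unfolding LL RR by blast
qed

section \<open>Kernels with a Lyapunov function\<close>

text \<open>
  The sets \<open>B n\<close> play the role of bounded sets: on them the kernel is bounded below and \<open>V\<close> is bounded
  above. Assumption \<open>drift\<close> says that \<open>P V / V\<close> tends to zero away from them, and \<open>tail\<close> that the part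
  of \<open>P V\<close> which comes from far away is uniformly small relative to \<open>V\<close>.
\<close>
locale lyapunov_kernel =
  fixes \<rho> :: "'a measure" and p :: "'a \<Rightarrow> 'a \<Rightarrow> real" and V :: "'a \<Rightarrow> real"
    and B :: "nat \<Rightarrow> 'a set" and Cp CV :: real
  assumes p_measurable: "case_prod p \<in> borel_measurable (\<rho> \<Otimes>\<^sub>M \<rho>)"
    and p_nonneg: "x \<in> space \<rho> \<Longrightarrow> y \<in> space \<rho> \<Longrightarrow> 0 \<le> p x y"
    and p_le: "x \<in> space \<rho> \<Longrightarrow> y \<in> space \<rho> \<Longrightarrow> p x y \<le> Cp"
    and V_measurable [measurable]: "V \<in> borel_measurable \<rho>"
    and V_ge_1: "x \<in> space \<rho> \<Longrightarrow> 1 \<le> V x"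
    and B_sets [measurable]: "B n \<in> sets \<rho>"
    and B_Un: "(\<Union>n. B n) = space \<rho>"
    and B_finite: "emeasure \<rho> (B n) < \<infinity>"
    and B_pos: "0 < measure \<rho> (B 0)"
    and p_lower: "\<exists>k>0. \<forall>x\<in>B n. \<forall>y\<in>B m. k \<le> p x y"
    and V_bounded: "\<exists>c. \<forall>x\<in>B n. V x \<le> c"
    and pV_integrable: "x \<in> space \<rho> \<Longrightarrow> integrable \<rho> (\<lambda>y. p x y * V y)"
    and pV_le: "x \<in> space \<rho> \<Longrightarrow> (\<integral>y. p x y * V y \<partial>\<rho>) \<le> CV * V x"
    and drift: "0 < e \<Longrightarrow> \<exists>n. \<forall>x\<in>space \<rho> - B n. (\<integral>y. p x y * V y \<partial>\<rho>) \<le> e * V x"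
    and tail: "0 < e \<Longrightarrow> \<exists>n. \<forall>x\<in>space \<rho>. (\<integral>y. indicator (- B n) y * (p x y * V y) \<partial>\<rho>) \<le> e * V x"

sublocale lyapunov_kernel \<subseteq> sigma_finite_measure \<rho>
proof
  show "\<exists>A. countable A \<and> A \<subseteq> sets \<rho> \<and> \<Union> A = space \<rho> \<and> (\<forall>a\<in>A. emeasure \<rho> a \<noteq> \<infinity>)"
    using B_Un B_finite by (intro exI[of _ "range B"]) (auto simp: less_top)
qed

sublocale lyapunov_kernel \<subseteq> pair: pair_sigma_finite \<rho> \<rho> ..

context lyapunov_kernel
begin

text \<open>
  Measurable functions with finite \<open>V\<close>-weighted supremum norm, and the densities of measures that
  integrate \<open>V\<close>; these are the two sides of the duality between \<open>P\<close> and \<open>P_dual\<close>.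
\<close>
definition dominated :: "('a \<Rightarrow> real) \<Rightarrow> real \<Rightarrow> bool" where
  "dominated u c \<longleftrightarrow> u \<in> borel_measurable \<rho> \<and> (\<forall>x\<in>space \<rho>. \<bar>u x\<bar> \<le> c * V x)"

definition weight :: "('a \<Rightarrow> real) \<Rightarrow> bool" where
  "weight a \<longleftrightarrow> a \<in> borel_measurable \<rho> \<and> (\<forall>x\<in>space \<rho>. 0 \<le> a x) \<and> integrable \<rho> (\<lambda>x. a x * V x)"

definition P :: "('a \<Rightarrow> real) \<Rightarrow> 'a \<Rightarrow> real" where
  "P u x = (\<integral>y. p x y * u y \<partial>\<rho>)"

definition P_dual :: "('a \<Rightarrow> real) \<Rightarrow> 'a \<Rightarrow> real" where
  "P_dual a y = (\<integral>x. a x * p x y \<partial>\<rho>)"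

lemma V_pos: "x \<in> space \<rho> \<Longrightarrow> 0 < V x"
  using V_ge_1[of x] by simp

lemma V_nonneg: "x \<in> space \<rho> \<Longrightarrow> 0 \<le> V x"
  using V_ge_1[of x] by simp

lemma B_subset: "B n \<subseteq> space \<rho>"
  using B_Un by auto

lemma p_measurable2 [measurable]: "(\<lambda>z. p (fst z) (snd z)) \<in> borel_measurable (\<rho> \<Otimes>\<^sub>M \<rho>)"
  using p_measurable by (simp add: split_beta')

lemma p_measurable_right [measurable]: "x \<in> space \<rho> \<Longrightarrow> p x \<in> borel_measurable \<rho>"
  using measurable_compose[OF measurable_Pair1' p_measurable, of x] by simp

lemma space_nonempty: "\<exists>x. x \<in> space \<rho>"
proof (rule ccontr)
  assume "\<not> ?thesis"
  then have "B 0 = {}" using B_subset[of 0] by auto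
  then show False using B_pos by simp
qed

lemma dominated_nonneg:
  assumes "dominated u c"
  shows "0 \<le> c"
proof -
  obtain x where x: "x \<in> space \<rho>" using space_nonempty by auto
  have "0 \<le> c * V x" using assms x unfolding dominated_def by (smt (verit) abs_ge_zero)
  then show ?thesis using V_pos[OF x] by (simp add: zero_le_mult_iff)
qed

lemma weight_integrable:
  assumes a: "weight a" and u: "dominated u c"
  shows "integrable \<rho> (\<lambda>x. a x * u x)"
proof (rule Bochner_Integration.integrable_bound)
  show "integrable \<rho> (\<lambda>x. c * (a x * V x))" using a by (simp add: weight_def)
  show "(\<lambda>x. a x * u x) \<in> borel_measurable \<rho>"
    using a u by (auto simp: weight_def dominated_def)
  show "AE x in \<rho>. norm (a x * u x) \<le> norm (c * (a x * V x))"
  proof (rule AE_I2)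
    fix x assume x: "x \<in> space \<rho>"
    have "a x * \<bar>u x\<bar> \<le> a x * (c * V x)"
      using a u x by (intro mult_left_mono) (auto simp: weight_def dominated_def)
    moreover have "0 \<le> c" by (rule dominated_nonneg[OF u])
    ultimately show "norm (a x * u x) \<le> norm (c * (a x * V x))"
      using a x V_pos[OF x] by (simp add: abs_mult weight_def algebra_simps)
  qed
qed

lemma weight_integral_le:
  assumes a: "weight a" and u: "dominated u c"
  shows "\<bar>\<integral>x. a x * u x \<partial>\<rho>\<bar> \<le> c * (\<integral>x. a x * V x \<partial>\<rho>)"
proof -
  have "\<bar>\<integral>x. a x * u x \<partial>\<rho>\<bar> \<le> (\<integral>x. \<bar>a x * u x\<bar> \<partial>\<rho>)" by (rule integral_abs_bound)
  also have "\<dots> \<le> (\<integral>x. c * (a x * V x) \<partial>\<rho>)"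
  proof (rule integral_mono)
    show "integrable \<rho> (\<lambda>x. \<bar>a x * u x\<bar>)" using weight_integrable[OF a u] by simp
    show "integrable \<rho> (\<lambda>x. c * (a x * V x))" using a by (simp add: weight_def)
    fix x assume x: "x \<in> space \<rho>"
    have "a x * \<bar>u x\<bar> \<le> a x * (c * V x)"
      using a u x by (intro mult_left_mono) (auto simp: weight_def dominated_def)
    then show "\<bar>a x * u x\<bar> \<le> c * (a x * V x)"
      using a x by (simp add: abs_mult weight_def algebra_simps)
  qed
  finally show ?thesis by simp
qed

lemma dominated_V: "dominated V 1"
  using V_pos by (auto simp: dominated_def intro: less_imp_le)

lemma dominated_1: "dominated (\<lambda>_. 1) 1"
  using V_ge_1 by (auto simp: dominated_def)

lemma dominated_abs: "dominated u c \<Longrightarrow> dominated (\<lambda>x. \<bar>u x\<bar>) c"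
  by (auto simp: dominated_def)

lemma weight_p: "x \<in> space \<rho> \<Longrightarrow> weight (p x)"
  using pV_integrable p_nonneg by (auto simp: weight_def)

lemma weight_indicator: "weight (indicator (B n))"
proof -
  obtain c where c: "\<And>x. x \<in> B n \<Longrightarrow> V x \<le> c" using V_bounded[of n] by auto
  have "integrable \<rho> (\<lambda>x. indicator (B n) x * V x)"
  proof (rule Bochner_Integration.integrable_bound)
    show "integrable \<rho> (\<lambda>x. indicator (B n) x * c)"
      using B_finite[of n] by (intro integrable_mult_left) (auto simp: less_top)
    show "AE x in \<rho>. norm (indicator (B n) x * V x) \<le> norm (indicator (B n) x * c)"
    proof (rule AE_I2)
      fix x assume "x \<in> space \<rho>"
      then show "norm (indicator (B n) x * V x) \<le> norm (indicator (B n) x * c)"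
        using c[of x] V_pos[of x] by (cases "x \<in> B n") auto
    qed
  qed simp
  then show ?thesis by (auto simp: weight_def)
qed

lemma dominated_P:
  assumes u: "dominated u c"
  shows "dominated (P u) (c * CV)"
  unfolding dominated_def
proof (intro conjI ballI)
  have [measurable]: "u \<in> borel_measurable \<rho>" using u by (simp add: dominated_def)
  have "(\<lambda>x. \<integral>y. p (fst (x, y)) (snd (x, y)) * u y \<partial>\<rho>) \<in> borel_measurable \<rho>"
    by measurable
  then show "P u \<in> borel_measurable \<rho>" unfolding P_def by simp
  fix x assume x: "x \<in> space \<rho>"
  have "\<bar>P u x\<bar> \<le> c * (\<integral>y. p x y * V y \<partial>\<rho>)"
    unfolding P_def by (rule weight_integral_le[OF weight_p[OF x] u])
  also have "\<dots> \<le> c * (CV * V x)"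
    by (intro mult_left_mono pV_le x dominated_nonneg[OF u])
  finally show "\<bar>P u x\<bar> \<le> c * CV * V x" by simp
qed

lemma P_nonneg:
  assumes "\<And>y. y \<in> space \<rho> \<Longrightarrow> 0 \<le> u y" "x \<in> space \<rho>"
  shows "0 \<le> P u x"
  unfolding P_def using assms p_nonneg by (intro Bochner_Integration.integral_nonneg) auto

lemma P_ge:
  assumes u: "dominated u c" "\<And>y. y \<in> space \<rho> \<Longrightarrow> 0 \<le> u y" and x: "x \<in> space \<rho>"
    and k: "\<And>y. y \<in> B n \<Longrightarrow> k \<le> p x y"
  shows "k * (\<integral>y. indicator (B n) y * u y \<partial>\<rho>) \<le> P u x"
proof -
  have "k * (\<integral>y. indicator (B n) y * u y \<partial>\<rho>) = (\<integral>y. k * (indicator (B n) y * u y) \<partial>\<rho>)" by simp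
  also have "\<dots> \<le> P u x"
    unfolding P_def
  proof (rule integral_mono)
    fix y assume y: "y \<in> space \<rho>"
    show "k * (indicator (B n) y * u y) \<le> p x y * u y"
      using k[of y] u(2)[OF y] p_nonneg[OF x y]
      by (auto simp: indicator_def intro: mult_right_mono)
  qed (use weight_integrable[OF weight_indicator u(1)] weight_integrable[OF weight_p[OF x] u(1)] in auto)
  finally show ?thesis .
qed

lemma
  assumes a: "weight a"
  shows weight_P_dual: "weight (P_dual a)"
    and integral_P_dual: "dominated u c \<Longrightarrow> (\<integral>y. P_dual a y * u y \<partial>\<rho>) = (\<integral>x. a x * P u x \<partial>\<rho>)"
proof -
  have [measurable]: "a \<in> borel_measurable \<rho>" using a by (simp add: weight_def)
  have int: "integrable (\<rho> \<Otimes>\<^sub>M \<rho>) (\<lambda>(x, y). a x * p x y * u y)" if u: "dominated u c" for u c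
  proof (rule pair.Fubini_integrable)
    have [measurable]: "u \<in> borel_measurable \<rho>" using u by (simp add: dominated_def)
    have "(\<lambda>z. a (fst z) * p (fst z) (snd z) * u (snd z)) \<in> borel_measurable (\<rho> \<Otimes>\<^sub>M \<rho>)"
      by measurable
    then show "(\<lambda>(x, y). a x * p x y * u y) \<in> borel_measurable (\<rho> \<Otimes>\<^sub>M \<rho>)"
      by (simp add: split_beta')
    have "integrable \<rho> (\<lambda>x. a x * P (\<lambda>y. \<bar>u y\<bar>) x)"
      by (rule weight_integrable[OF a dominated_P[OF dominated_abs[OF u]]])
    moreover have "a x * P (\<lambda>y. \<bar>u y\<bar>) x = (\<integral>y. norm (case (x, y) of (x, y) \<Rightarrow> a x * p x y * u y) \<partial>\<rho>)"
      if x: "x \<in> space \<rho>" for x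
    proof -
      have "(\<integral>y. norm (case (x, y) of (x, y) \<Rightarrow> a x * p x y * u y) \<partial>\<rho>) = (\<integral>y. a x * (p x y * \<bar>u y\<bar>) \<partial>\<rho>)"
        using a x p_nonneg[OF x] by (intro Bochner_Integration.integral_cong) (auto simp: abs_mult weight_def)
      then show ?thesis by (simp add: P_def)
    qed
    ultimately show "integrable \<rho> (\<lambda>x. \<integral>y. norm (case (x, y) of (x, y) \<Rightarrow> a x * p x y * u y) \<partial>\<rho>)"
      by (simp cong: Bochner_Integration.integrable_cong)
    have "integrable \<rho> (\<lambda>y. a x * (p x y * u y))" if "x \<in> space \<rho>" for x
      using weight_integrable[OF weight_p[OF that] u] by simp
    then show "AE x in \<rho>. integrable \<rho> (\<lambda>y. case (x, y) of (x, y) \<Rightarrow> a x * p x y * u y)"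
      by (intro AE_I2) (simp add: mult.assoc)
  qed
  have eq: "P_dual a y * u y = (\<integral>x. a x * p x y * u y \<partial>\<rho>)" for u y
    by (simp add: P_dual_def)
  show "weight (P_dual a)"
    unfolding weight_def
  proof (intro conjI ballI)
    have "(\<lambda>y. \<integral>x. a x * p (fst (x, y)) (snd (x, y)) \<partial>\<rho>) \<in> borel_measurable \<rho>"
      by measurable
    then show "P_dual a \<in> borel_measurable \<rho>" unfolding P_dual_def by simp
    show "0 \<le> P_dual a y" if "y \<in> space \<rho>" for y
      unfolding P_dual_def using a that p_nonneg by (intro Bochner_Integration.integral_nonneg) (auto simp: weight_def)
    show "integrable \<rho> (\<lambda>x. P_dual a x * V x)"
      unfolding eq using pair.integrable_snd[OF int[OF dominated_V]] by simp
  qed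
  show "(\<integral>y. P_dual a y * u y \<partial>\<rho>) = (\<integral>x. a x * P u x \<partial>\<rho>)" if u: "dominated u c"
  proof -
    have "(\<integral>y. P_dual a y * u y \<partial>\<rho>) = (\<integral>y. (\<integral>x. a x * p x y * u y \<partial>\<rho>) \<partial>\<rho>)"
      unfolding eq ..
    also have "\<dots> = (\<integral>x. (\<integral>y. a x * p x y * u y \<partial>\<rho>) \<partial>\<rho>)"
      by (rule pair.Fubini_integral[OF int[OF u]])
    also have "\<dots> = (\<integral>x. a x * P u x \<partial>\<rho>)"
      by (simp add: P_def mult.assoc)
    finally show ?thesis .
  qed
qed

end

section \<open>Growth of the survival probabilities and the contraction\<close>

context lyapunov_kernel
begin

text \<open>
  \<open>survival n x\<close> is the probability that the chain started at \<open>x\<close> is alive at time \<open>n\<close>; \<open>mass\<close> sets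
  the scale on which all functions at time \<open>n\<close> are measured.
\<close>
definition survival :: "nat \<Rightarrow> 'a \<Rightarrow> real" where
  "survival n = (P ^^ n) (\<lambda>_. 1)"

definition mass :: "nat \<Rightarrow> real" where
  "mass n = (\<integral>y. indicator (B 0) y * survival n y \<partial>\<rho>)"

lemma dominated_funpow: "dominated u c \<Longrightarrow> dominated ((P ^^ n) u) (c * CV ^ n)"
proof (induction n)
  case (Suc n)
  then show ?case using dominated_P[of "(P ^^ n) u" "c * CV ^ n"] by (simp add: ac_simps)
qed simp

lemma dominated_survival: "dominated (survival n) (CV ^ n)"
  using dominated_funpow[OF dominated_1] by (simp add: survival_def)

lemma survival_0 [simp]: "survival 0 x = 1"
  and survival_Suc: "survival (Suc n) = P (survival n)"
  by (simp_all add: survival_def)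

lemma survival_nonneg: "x \<in> space \<rho> \<Longrightarrow> 0 \<le> survival n x"
proof (induction n arbitrary: x)
  case (Suc n)
  then show ?case unfolding survival_Suc by (intro P_nonneg) auto
qed simp

lemma mass_0: "mass 0 = measure \<rho> (B 0)"
  by (simp add: mass_def)

lemma integral_B0_ge:
  assumes u: "dominated u d" and le: "\<And>x. x \<in> B 0 \<Longrightarrow> c \<le> u x"
  shows "c * measure \<rho> (B 0) \<le> (\<integral>x. indicator (B 0) x * u x \<partial>\<rho>)"
proof -
  have "c * measure \<rho> (B 0) = (\<integral>x. indicator (B 0) x * c \<partial>\<rho>)" by simp
  also have "\<dots> \<le> (\<integral>x. indicator (B 0) x * u x \<partial>\<rho>)"
  proof (rule integral_mono)
    show "integrable \<rho> (\<lambda>x. indicator (B 0) x * c)"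
      using B_finite[of 0] by (intro integrable_mult_left) (auto simp: less_top)
    show "integrable \<rho> (\<lambda>x. indicator (B 0) x * u x)"
      by (rule weight_integrable[OF weight_indicator u])
    show "indicator (B 0) x * c \<le> indicator (B 0) x * u x" for x
      using le[of x] by (cases "x \<in> B 0") auto
  qed
  finally show ?thesis .
qed

lemma survival_Suc_ge:
  assumes "x \<in> space \<rho>" "\<And>y. y \<in> B 0 \<Longrightarrow> k \<le> p x y"
  shows "k * mass n \<le> survival (Suc n) x"
  unfolding survival_Suc mass_def
  by (rule P_ge[OF dominated_survival]) (use assms survival_nonneg in auto)

lemma mass_nonneg: "0 \<le> mass n"
  unfolding mass_def using survival_nonneg by (intro Bochner_Integration.integral_nonneg) auto

lemma mass_Suc_ge: "\<exists>\<theta>>0. \<forall>n. \<theta> * mass n \<le> mass (Suc n)"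
proof -
  obtain k where k: "k > 0" "\<And>x y. x \<in> B 0 \<Longrightarrow> y \<in> B 0 \<Longrightarrow> k \<le> p x y"
    using p_lower[of 0 0] by auto
  have "k * mass n * measure \<rho> (B 0) \<le> mass (Suc n)" for n
    unfolding mass_def[of "Suc n"]
    by (rule integral_B0_ge[OF dominated_survival], rule survival_Suc_ge) (use k B_subset in auto)
  then show ?thesis using k(1) B_pos by (intro exI[of _ "k * measure \<rho> (B 0)"]) (auto simp: ac_simps)
qed

lemma mass_pos: "0 < mass n"
proof (induction n)
  case 0
  then show ?case using B_pos by (simp add: mass_0)
next
  case (Suc n)
  obtain \<theta> where "\<theta> > 0" "\<theta> * mass n \<le> mass (Suc n)" using mass_Suc_ge by blast
  then show ?case using Suc by (smt (verit) mult_pos_pos)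
qed

text \<open>
  On \<open>B m\<close> the kernel is bounded by \<open>Cp\<close> and an integral of \<open>u\<close> remains, off \<open>B m\<close> only the growth of
  \<open>u\<close> is used: a smoothing estimate of Doeblin-Fortet type.
\<close>
lemma P_split_le:
  assumes u: "dominated u c" "\<And>y. y \<in> space \<rho> \<Longrightarrow> 0 \<le> u y" and x: "x \<in> space \<rho>"
  shows "P u x \<le> Cp * (\<integral>y. indicator (B m) y * u y \<partial>\<rho>)
     + c * (\<integral>y. indicator (- B m) y * (p x y * V y) \<partial>\<rho>)"
proof -
  have i1: "integrable \<rho> (\<lambda>y. indicator (B m) y * u y)"
    by (rule weight_integrable[OF weight_indicator u(1)])
  have i2: "integrable \<rho> (\<lambda>y. indicator (- B m) y * (p x y * V y))"
  proof (rule Bochner_Integration.integrable_bound[OF pV_integrable[OF x]])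
    have "(\<lambda>y. (1 - indicator (B m) y) * (p x y * V y)) \<in> borel_measurable \<rho>"
      using x by measurable
    moreover have "(1 - indicator (B m) y :: real) = indicator (- B m) y" for y
      by (simp add: indicator_def)
    ultimately show "(\<lambda>y. indicator (- B m) y * (p x y * V y)) \<in> borel_measurable \<rho>" by simp
  qed (auto simp: indicator_def)
  have "P u x \<le> (\<integral>y. Cp * (indicator (B m) y * u y) + c * (indicator (- B m) y * (p x y * V y)) \<partial>\<rho>)"
    unfolding P_def
  proof (rule integral_mono)
    show "integrable \<rho> (\<lambda>y. p x y * u y)" by (rule weight_integrable[OF weight_p[OF x] u(1)])
    show "integrable \<rho> (\<lambda>y. Cp * (indicator (B m) y * u y) + c * (indicator (- B m) y * (p x y * V y)))"
      using i1 i2 by simp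
    fix y assume y: "y \<in> space \<rho>"
    have "p x y * u y \<le> Cp * u y" using p_le[OF x y] u(2)[OF y] by (rule mult_right_mono)
    moreover have "p x y * u y \<le> p x y * (c * V y)"
      using p_nonneg[OF x y] u y by (intro mult_left_mono) (auto simp: dominated_def)
    ultimately show "p x y * u y \<le> Cp * (indicator (B m) y * u y) + c * (indicator (- B m) y * (p x y * V y))"
      by (auto simp: indicator_def mult.left_commute)
  qed
  also have "\<dots> = Cp * (\<integral>y. indicator (B m) y * u y \<partial>\<rho>)
     + c * (\<integral>y. indicator (- B m) y * (p x y * V y) \<partial>\<rho>)"
    using i1 i2 by simp
  finally show ?thesis .
qed

text \<open>
  Choose \<open>B m\<close> so large that the tail costs at most half of the decay rate \<open>\<theta>\<close> of the mass. Then the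
  tail part is absorbed by the induction hypothesis, and the integral over \<open>B m\<close> is at most a
  multiple of the next mass, since every point of \<open>B m\<close> is reached from \<open>B 0\<close> with a density bounded
  below.
\<close>
lemma survival_le_mass: "\<exists>H>0. \<forall>n. \<forall>x\<in>space \<rho>. survival n x \<le> H * mass n * V x"
proof -
  obtain \<theta> where \<theta>: "\<theta> > 0" "\<And>n. \<theta> * mass n \<le> mass (Suc n)" using mass_Suc_ge by auto
  obtain m where m: "\<And>x. x \<in> space \<rho> \<Longrightarrow> (\<integral>y. indicator (- B m) y * (p x y * V y) \<partial>\<rho>) \<le> \<theta> / 2 * V x"
    using tail[of "\<theta> / 2"] \<theta>(1) by auto
  obtain k where k: "k > 0" "\<And>x y. x \<in> B 0 \<Longrightarrow> y \<in> B m \<Longrightarrow> k \<le> p x y"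
    using p_lower[of 0 m] by auto
  obtain x0 where x0: "x0 \<in> space \<rho>" using space_nonempty by auto
  have Cp: "0 \<le> Cp" using p_nonneg[OF x0 x0] p_le[OF x0 x0] by simp
  define b where "b = k * measure \<rho> (B 0)"
  have b: "b > 0" using k B_pos by (simp add: b_def)
  define H where "H = max (2 * Cp / b) (1 / mass 0)"
  have H0: "1 / mass 0 \<le> H" and H1: "2 * Cp / b \<le> H" by (auto simp: H_def)
  have H: "H > 0" using H0 mass_pos[of 0] by (smt (verit) divide_pos_pos)
  have inner: "b * (\<integral>y. indicator (B m) y * survival n y \<partial>\<rho>) \<le> mass (Suc n)" (is "b * ?J \<le> _") for n
  proof -
    have "k * ?J * measure \<rho> (B 0) \<le> mass (Suc n)"
      unfolding mass_def[of "Suc n"]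
      by (rule integral_B0_ge[OF dominated_survival], unfold survival_Suc, rule P_ge[OF dominated_survival])
         (use k B_subset survival_nonneg in auto)
    then show ?thesis by (simp add: b_def ac_simps)
  qed
  have "survival n x \<le> H * mass n * V x" if "x \<in> space \<rho>" for n x
    using that
  proof (induction n arbitrary: x)
    case 0
    have "1 \<le> H * mass 0" using H0 mass_pos[of 0] by (simp add: field_simps)
    then have "1 * 1 \<le> H * mass 0 * V x" using V_ge_1[OF 0] by (intro mult_mono) auto
    then show ?case by simp
  next
    case (Suc n)
    let ?J = "\<integral>y. indicator (B m) y * survival n y \<partial>\<rho>"
    have dom: "dominated (survival n) (H * mass n)"
      using dominated_survival[of n] survival_nonneg[of _ n] Suc.IH by (auto simp: dominated_def)
    have "survival (Suc n) x \<le> Cp * ?J + H * mass n * (\<integral>y. indicator (- B m) y * (p x y * V y) \<partial>\<rho>)"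
      unfolding survival_Suc by (rule P_split_le[OF dom survival_nonneg Suc.prems])
    also have "\<dots> \<le> Cp * (mass (Suc n) / b) + H * mass n * (\<theta> / 2 * V x)"
    proof (intro add_mono mult_left_mono Cp m Suc.prems)
      show "?J \<le> mass (Suc n) / b" using inner[of n] b by (simp add: field_simps)
      show "0 \<le> H * mass n" using H mass_pos[of n] by simp
    qed
    also have "\<dots> = (2 * Cp / b) * (mass (Suc n) * 1) / 2 + H * (\<theta> * mass n) * V x / 2"
      by simp
    also have "\<dots> \<le> H * (mass (Suc n) * V x) / 2 + H * mass (Suc n) * V x / 2"
      using H H1 \<theta> mass_pos[of "Suc n"] V_ge_1[OF Suc.prems]
      by (intro add_mono divide_right_mono mult_mono mult_right_mono) (auto simp: mass_nonneg)
    finally show ?case by (simp add: field_simps)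
  qed
  then show ?thesis using H by blast
qed

text \<open>
  The induction hypothesis is \<open>|w_n| \<le> a (1 - \<gamma>)^n (h_n h_n + \<beta> c_n^2 V V)\<close>. If both points lie in
  \<open>B m\<close>, the cancellation gains \<open>\<kappa>^2 c_n^2\<close>, of which one half pays for the term with \<open>V\<close> (this fixes
  \<open>\<beta>\<close>) and the other half for the factor \<open>1 - \<gamma>\<close>. Otherwise the term with \<open>V\<close> shrinks by \<open>\<theta>^2 / 4\<close>,
  whereas \<open>c_n^2\<close> shrinks at most by \<open>\<theta>^2\<close>; the slack pays for replacing \<open>h_n h_n\<close> by \<open>(1 - \<gamma>)\<close> times
  itself.
\<close>
lemma cross_contraction:
  "\<exists>\<alpha> C. 0 < \<alpha> \<and> \<alpha> < 1 \<and> 0 < C \<and>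
     (\<forall>\<phi> n. dominated \<phi> 1 \<longrightarrow> (\<forall>x\<in>space \<rho>. \<forall>y\<in>space \<rho>.
        \<bar>(P ^^ n) \<phi> x * survival n y - (P ^^ n) \<phi> y * survival n x\<bar>
          \<le> C * \<alpha> ^ n * (mass n)\<^sup>2 * (V x * V y)))"
proof -
  obtain \<theta> where \<theta>: "\<theta> > 0" "\<And>n. \<theta> * mass n \<le> mass (Suc n)" using mass_Suc_ge by auto
  obtain H where H: "H > 0" "\<And>n x. x \<in> space \<rho> \<Longrightarrow> survival n x \<le> H * mass n * V x"
    using survival_le_mass by auto
  define L where "L = max CV 1"
  have L: "L \<ge> 1" "CV \<le> L" by (auto simp: L_def)
  have PV_L: "P V x \<le> L * V x" if "x \<in> space \<rho>" for x
    using pV_le[OF that] L(2) V_pos[OF that] unfolding P_def by (smt (verit) mult_right_mono)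
  have PV_nonneg: "0 \<le> P V x" if "x \<in> space \<rho>" for x
    using V_pos that by (intro P_nonneg) (auto intro: less_imp_le)
  \<comment> \<open>Outside \<open>B m \<times> B m\<close> one factor of \<open>P V x * P V y\<close> is small and the other is at most \<open>L V\<close>.\<close>
  obtain m where m: "\<And>x. x \<in> space \<rho> \<Longrightarrow> x \<notin> B m \<Longrightarrow> P V x \<le> \<theta>\<^sup>2 / (4 * L) * V x"
    using drift[of "\<theta>\<^sup>2 / (4 * L)"] \<theta>(1) L(1) unfolding P_def by auto
  obtain \<kappa> where \<kappa>: "\<kappa> > 0" "\<And>x y. x \<in> B m \<Longrightarrow> y \<in> B 0 \<Longrightarrow> \<kappa> \<le> p x y"
    using p_lower[of m 0] by auto
  obtain v0 where "\<And>x. x \<in> B m \<Longrightarrow> V x \<le> v0" using V_bounded[of m] by auto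
  define v where "v = max v0 1"
  have v: "v \<ge> 1" "\<And>x. x \<in> B m \<Longrightarrow> V x \<le> v"
    using \<open>\<And>x. x \<in> B m \<Longrightarrow> V x \<le> v0\<close> by (force simp: v_def)+
  define \<beta> where "\<beta> = \<kappa>\<^sup>2 / (2 * (L * v)\<^sup>2)"
  have \<beta>: "\<beta> > 0" "\<beta> * (L * v)\<^sup>2 = \<kappa>\<^sup>2 / 2" using \<kappa>(1) L(1) v(1) by (auto simp: \<beta>_def)
  define \<gamma> where "\<gamma> = min (1/2) (min (\<beta> * \<theta>\<^sup>2 / (4 * (H * L)\<^sup>2)) (\<kappa>\<^sup>2 / (2 * (H * L * v)\<^sup>2)))"
  have \<gamma>: "0 < \<gamma>" "\<gamma> \<le> 1/2"
    using \<beta>(1) \<theta>(1) H(1) L(1) v(1) \<kappa>(1) by (auto simp: \<gamma>_def)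
  have \<gamma>1: "\<gamma> * (H * L)\<^sup>2 \<le> \<beta> * \<theta>\<^sup>2 / 4"
  proof -
    have "\<gamma> \<le> \<beta> * \<theta>\<^sup>2 / (4 * (H * L)\<^sup>2)" by (simp add: \<gamma>_def)
    then show ?thesis using H(1) L(1) by (simp add: field_simps)
  qed
  have \<gamma>2: "\<gamma> * (H * L * v)\<^sup>2 \<le> \<kappa>\<^sup>2 / 2"
  proof -
    have "\<gamma> \<le> \<kappa>\<^sup>2 / (2 * (H * L * v)\<^sup>2)" by (simp add: \<gamma>_def)
    then show ?thesis using H(1) L(1) v(1) by (simp add: field_simps)
  qed
  define G where "G n x y = survival n x * survival n y + \<beta> * (mass n)\<^sup>2 * (V x * V y)" for n x y
  define a where "a = 2 / (\<beta> * (mass 0)\<^sup>2)"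
  have a: "a > 0" using \<beta> mass_pos[of 0] by (simp add: a_def)
  have surv_L: "survival (Suc n) x \<le> H * L * mass n * V x" if x: "x \<in> space \<rho>" for n x
  proof -
    have "dominated (survival n) (H * mass n)"
      using dominated_survival[of n] survival_nonneg[of _ n] H(2) by (auto simp: dominated_def)
    then have "\<bar>P (survival n) x\<bar> \<le> H * mass n * P V x"
      unfolding P_def by (rule weight_integral_le[OF weight_p[OF x]])
    also have "\<dots> \<le> H * mass n * (L * V x)"
      using H(1) mass_nonneg by (intro mult_left_mono PV_L x) auto
    finally show ?thesis unfolding survival_Suc by (simp add: ac_simps)
  qed
  have main: "\<bar>(P ^^ n) \<phi> x * survival n y - (P ^^ n) \<phi> y * survival n x\<bar> \<le> a * (1 - \<gamma>) ^ n * G n x y"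
    if \<phi>: "dominated \<phi> 1" and xy: "x \<in> space \<rho>" "y \<in> space \<rho>" for \<phi> n x y
    using xy
  proof (induction n arbitrary: x y)
    case 0
    have "\<bar>\<phi> x - \<phi> y\<bar> \<le> V x + V y" 
      using \<phi> 0 unfolding dominated_def by (smt (verit) mult_1)
    also have "\<dots> \<le> 2 * (V x * V y)"
    proof -
      have "V x * 1 \<le> V x * V y" "1 * V y \<le> V x * V y"
        using V_ge_1[OF 0(1)] V_ge_1[OF 0(2)] by (intro mult_mono; simp)+
      then show ?thesis by linarith
    qed
    also have "\<dots> = a * (\<beta> * (mass 0)\<^sup>2 * (V x * V y))"
      using \<beta>(1) mass_pos[of 0] by (simp add: a_def)
    also have "\<dots> \<le> a * G 0 x y" using a by (simp add: G_def)
    finally show ?case by simp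
  next
    case (Suc n)
    define A where "A = a * (1 - \<gamma>) ^ n"
    have A: "A > 0" using a \<gamma> by (simp add: A_def)
    define S where "S = survival (Suc n) x * survival (Suc n) y"
    define W where "W = P V x * P V y"
    have W0: "0 \<le> W" unfolding W_def using PV_nonneg Suc.prems by simp
    have step: "\<bar>P ((P ^^ n) \<phi>) x * P (survival n) y - P ((P ^^ n) \<phi>) y * P (survival n) x\<bar>
        \<le> A * (S - k\<^sup>2 * (mass n)\<^sup>2) + A * (\<beta> * (mass n)\<^sup>2) * W"
      if k: "0 \<le> k" "\<And>z. z \<in> B 0 \<Longrightarrow> k \<le> p x z" "\<And>z. z \<in> B 0 \<Longrightarrow> k \<le> p y z" for k
      unfolding S_def W_def survival_Suc mass_def
        P_def[of "(P ^^ n) \<phi>"] P_def[of "survival n"] P_def[of V]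
    proof (rule integral_cross_le[where a = "p x" and b = "p y" and F = "(P ^^ n) \<phi>"
          and h = "survival n" and V = V])
      note wx = weight_integrable[OF weight_p[OF Suc.prems(1)]]
      note wy = weight_integrable[OF weight_p[OF Suc.prems(2)]]
      note dF = dominated_funpow[OF \<phi>, of n]
      show "integrable \<rho> (\<lambda>z. p x z * (P ^^ n) \<phi> z)" "integrable \<rho> (\<lambda>z. p y z * (P ^^ n) \<phi> z)"
        by (rule wx[OF dF] wy[OF dF])+
      show "integrable \<rho> (\<lambda>z. p x z * survival n z)" "integrable \<rho> (\<lambda>z. p y z * survival n z)"
        by (rule wx[OF dominated_survival] wy[OF dominated_survival])+
      show "integrable \<rho> (\<lambda>z. p x z * V z)" "integrable \<rho> (\<lambda>z. p y z * V z)"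
        by (rule wx[OF dominated_V] wy[OF dominated_V])+
      show "integrable \<rho> (\<lambda>z. indicator (B 0) z * survival n z)"
        by (rule weight_integrable[OF weight_indicator dominated_survival])
      show "\<bar>(P ^^ n) \<phi> z * survival n z' - (P ^^ n) \<phi> z' * survival n z\<bar>
         \<le> A * (survival n z * survival n z') + A * (\<beta> * (\<integral>y. indicat_real (B 0) y * survival n y \<partial>\<rho>)\<^sup>2) * (V z * V z')"
        if "z \<in> space \<rho>" "z' \<in> space \<rho>" for z z'
        using Suc.IH[OF that] unfolding mass_def[symmetric] by (simp add: A_def G_def algebra_simps)
      show "0 \<le> A * (\<beta> * (\<integral>y. indicat_real (B 0) y * survival n y \<partial>\<rho>)\<^sup>2)" using A \<beta>(1) by simp
    qed (use k A Suc.prems p_nonneg survival_nonneg V_pos in \<open>auto intro: less_imp_le\<close>)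
    \<comment> \<open>With \<open>k = 0\<close> the cross product bound carries no gain, so that one estimate serves both cases.\<close>
    have "S + \<beta> * (mass n)\<^sup>2 * W - k\<^sup>2 * (mass n)\<^sup>2 \<le> (1 - \<gamma>) * G (Suc n) x y"
      if "k = (if x \<in> B m \<and> y \<in> B m then \<kappa> else 0)" for k
    proof (cases "x \<in> B m \<and> y \<in> B m")
      case True
      have Vv: "V x * V y \<le> v\<^sup>2"
        using v True V_pos[OF Suc.prems(1)] V_pos[OF Suc.prems(2)]
        by (auto simp: power2_eq_square intro!: mult_mono)
      have "W \<le> (L * V x) * (L * V y)"
        unfolding W_def using PV_L PV_nonneg Suc.prems L(1) V_nonneg
        by (intro mult_mono) (auto intro!: mult_nonneg_nonneg simp: less_imp_le)
      also have "\<dots> \<le> (L * v)\<^sup>2"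
        using mult_left_mono[OF Vv zero_le_power2[of L]] by (simp add: power2_eq_square ac_simps)
      finally have "\<beta> * W \<le> \<kappa>\<^sup>2 / 2"
        using \<beta> by (metis mult_left_mono less_imp_le)
      then have 1: "\<beta> * (mass n)\<^sup>2 * W \<le> \<kappa>\<^sup>2 / 2 * (mass n)\<^sup>2"
        using mult_right_mono[of "\<beta> * W" "\<kappa>\<^sup>2 / 2" "(mass n)\<^sup>2"] by (simp add: ac_simps)
      have "S \<le> (H * L * mass n * V x) * (H * L * mass n * V y)"
        unfolding S_def using surv_L survival_nonneg Suc.prems H(1) L(1) mass_nonneg V_nonneg
        by (intro mult_mono) (auto intro!: mult_nonneg_nonneg simp: less_imp_le)
      also have "\<dots> \<le> (H * L * v)\<^sup>2 * (mass n)\<^sup>2"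
        using mult_left_mono[OF Vv zero_le_power2[of "H * L * mass n"]] by (simp add: power2_eq_square ac_simps)
      finally have "\<gamma> * S \<le> \<gamma> * (H * L * v)\<^sup>2 * (mass n)\<^sup>2"
        using \<gamma> by (simp add: mult.assoc)
      also have "\<dots> \<le> \<kappa>\<^sup>2 / 2 * (mass n)\<^sup>2" using \<gamma>2 by (rule mult_right_mono) simp
      finally have 2: "\<gamma> * S \<le> \<kappa>\<^sup>2 / 2 * (mass n)\<^sup>2" .
      have "0 \<le> (1 - \<gamma>) * (\<beta> * (mass (Suc n))\<^sup>2 * (V x * V y))"
        using \<gamma> \<beta> V_pos[OF Suc.prems(1)] V_pos[OF Suc.prems(2)] by simp
      then show ?thesis using 1 2 True that by (simp add: G_def S_def[symmetric] algebra_simps)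
    next
      case False
      have VV: "0 < V x * V y" using V_pos[OF Suc.prems(1)] V_pos[OF Suc.prems(2)] by simp
      have Wle: "W \<le> \<theta>\<^sup>2 / 4 * (V x * V y)"
      proof (cases "x \<in> B m")
        case True
        then have "W \<le> (L * V x) * (\<theta>\<^sup>2 / (4 * L) * V y)"
          unfolding W_def using False m PV_L PV_nonneg Suc.prems L(1) V_nonneg
          by (intro mult_mono) (auto intro!: mult_nonneg_nonneg simp: less_imp_le)
        also have "\<dots> = \<theta>\<^sup>2 / 4 * (V x * V y)" using L(1) by (simp add: field_simps)
        finally show ?thesis .
      next
        case False
        then have "W \<le> (\<theta>\<^sup>2 / (4 * L) * V x) * (L * V y)"
          unfolding W_def using m PV_L PV_nonneg Suc.prems L(1) V_nonneg
          by (intro mult_mono) (auto intro!: mult_nonneg_nonneg simp: less_imp_le)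
        also have "\<dots> = \<theta>\<^sup>2 / 4 * (V x * V y)" using L(1) by (simp add: field_simps)
        finally show ?thesis .
      qed
      have 1: "\<beta> * (mass n)\<^sup>2 * W \<le> \<beta> * (mass n)\<^sup>2 * (\<theta>\<^sup>2 / 4 * (V x * V y))"
        using Wle \<beta> by (intro mult_left_mono) auto
      have "S \<le> (H * L * mass n * V x) * (H * L * mass n * V y)"
        unfolding S_def using surv_L survival_nonneg Suc.prems H(1) L(1) mass_nonneg V_nonneg
        by (intro mult_mono) (auto intro!: mult_nonneg_nonneg simp: less_imp_le)
      then have "\<gamma> * S \<le> \<gamma> * (H * L)\<^sup>2 * ((mass n)\<^sup>2 * (V x * V y))"
        using \<gamma> mult_left_mono[of S _ \<gamma>] by (simp add: power2_eq_square ac_simps)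
      also have "\<dots> \<le> \<beta> * \<theta>\<^sup>2 / 4 * ((mass n)\<^sup>2 * (V x * V y))"
        using \<gamma>1 VV by (intro mult_right_mono) auto
      finally have 2: "\<gamma> * S \<le> \<beta> * \<theta>\<^sup>2 / 4 * ((mass n)\<^sup>2 * (V x * V y))" .
      have "(\<theta> * mass n)\<^sup>2 \<le> (mass (Suc n))\<^sup>2"
        using \<theta>(1) \<theta>(2)[of n] mass_nonneg[of n] by (intro power_mono) auto
      then have "(1/2) * (\<beta> * (\<theta> * mass n)\<^sup>2 * (V x * V y)) \<le> (1 - \<gamma>) * (\<beta> * (mass (Suc n))\<^sup>2 * (V x * V y))"
        using \<gamma> \<beta> VV by (intro mult_mono mult_right_mono mult_left_mono) auto
      moreover have "(1/2) * (\<beta> * (\<theta> * mass n)\<^sup>2 * (V x * V y))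
          = \<beta> * (mass n)\<^sup>2 * (\<theta>\<^sup>2 / 4 * (V x * V y)) + \<beta> * \<theta>\<^sup>2 / 4 * ((mass n)\<^sup>2 * (V x * V y))"
        by (simp add: power_mult_distrib algebra_simps)
      ultimately have "\<beta> * (mass n)\<^sup>2 * W + \<gamma> * S \<le> (1 - \<gamma>) * (\<beta> * (mass (Suc n))\<^sup>2 * (V x * V y))"
        using 1 2 by linarith
      then show ?thesis using False that by (auto simp: G_def S_def[symmetric] algebra_simps)
    qed
    then have fin: "A * (S + \<beta> * (mass n)\<^sup>2 * W - k\<^sup>2 * (mass n)\<^sup>2) \<le> A * ((1 - \<gamma>) * G (Suc n) x y)"
      if "k = (if x \<in> B m \<and> y \<in> B m then \<kappa> else 0)" for k
      using that A by (intro mult_left_mono) auto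
    define k where "k = (if x \<in> B m \<and> y \<in> B m then \<kappa> else 0)"
    have "\<bar>(P ^^ Suc n) \<phi> x * survival (Suc n) y - (P ^^ Suc n) \<phi> y * survival (Suc n) x\<bar>
       \<le> A * (S - k\<^sup>2 * (mass n)\<^sup>2) + A * (\<beta> * (mass n)\<^sup>2) * W"
    proof -
      have "k \<le> p x z" "k \<le> p y z" if "z \<in> B 0" for z
        using \<kappa>(2) p_nonneg Suc.prems B_subset[of 0] that by (auto simp: k_def)
      moreover have "0 \<le> k" using \<kappa>(1) by (simp add: k_def)
      ultimately show ?thesis using step[of k] by (simp add: survival_Suc)
    qed
    also have "\<dots> = A * (S + \<beta> * (mass n)\<^sup>2 * W - k\<^sup>2 * (mass n)\<^sup>2)" by (simp add: algebra_simps)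
    also have "\<dots> \<le> A * ((1 - \<gamma>) * G (Suc n) x y)" using fin k_def by blast
    also have "\<dots> = a * (1 - \<gamma>) ^ Suc n * G (Suc n) x y" by (simp add: A_def)
    finally show ?case .
  qed
  have G_le: "G n x y \<le> (H\<^sup>2 + \<beta>) * (mass n)\<^sup>2 * (V x * V y)" if "x \<in> space \<rho>" "y \<in> space \<rho>" for n x y
  proof -
    have "survival n x * survival n y \<le> (H * mass n * V x) * (H * mass n * V y)"
      using that H mass_nonneg survival_nonneg V_nonneg
      by (intro mult_mono) (auto intro!: mult_nonneg_nonneg simp: less_imp_le)
    then show ?thesis by (simp add: G_def power2_eq_square algebra_simps)
  qed
  show ?thesis
  proof (intro exI conjI allI impI ballI)
    show "0 < 1 - \<gamma>" "1 - \<gamma> < 1" using \<gamma> by auto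
    show "0 < a * (H\<^sup>2 + \<beta>)" using a \<beta> by (simp add: add_nonneg_pos)
    fix \<phi> n x y assume *: "dominated \<phi> 1" "x \<in> space \<rho>" "y \<in> space \<rho>"
    have "\<bar>(P ^^ n) \<phi> x * survival n y - (P ^^ n) \<phi> y * survival n x\<bar> \<le> a * (1 - \<gamma>) ^ n * G n x y"
      by (rule main[OF *])
    also have "\<dots> \<le> a * (1 - \<gamma>) ^ n * ((H\<^sup>2 + \<beta>) * (mass n)\<^sup>2 * (V x * V y))"
      using a \<gamma> by (intro mult_left_mono G_le *) auto
    finally show "\<bar>(P ^^ n) \<phi> x * survival n y - (P ^^ n) \<phi> y * survival n x\<bar>
          \<le> a * (H\<^sup>2 + \<beta>) * (1 - \<gamma>) ^ n * (mass n)\<^sup>2 * (V x * V y)"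
      by (simp add: mult.assoc mult.left_commute)
  qed
qed

end

section \<open>The invariant density and geometric convergence\<close>

text \<open>
  Completeness of \<open>L^1\<close> for sequences with summable increments: the limit is the sum of the telescoping
  series, which converges almost everywhere and may be integrated termwise.
\<close>
lemma L1_limit:
  fixes g :: "nat \<Rightarrow> 'a \<Rightarrow> real"
  assumes int: "\<And>n. integrable M (g n)"
    and nonneg: "\<And>n x. x \<in> space M \<Longrightarrow> 0 \<le> g n x"
    and sm: "summable (\<lambda>n. \<integral>x. \<bar>g (Suc n) x - g n x\<bar> \<partial>M)"
  shows "\<exists>G. integrable M G \<and> (\<forall>x. 0 \<le> G x) \<and>
    (\<forall>\<psi> c. \<psi> \<in> borel_measurable M \<longrightarrow> (\<forall>x\<in>space M. \<bar>\<psi> x\<bar> \<le> c) \<longrightarrow>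
       (\<lambda>n. \<integral>x. g n x * \<psi> x \<partial>M) \<longlonglongrightarrow> (\<integral>x. G x * \<psi> x \<partial>M))"
proof -
  define d where "d n x = g (Suc n) x - g n x" for n x
  have intd: "integrable M (d n)" for n using int unfolding d_def by simp
  note [measurable] = borel_measurable_integrable[OF int] borel_measurable_integrable[OF intd]
  have "(\<integral>\<^sup>+x. (\<Sum>n. ennreal \<bar>d n x\<bar>) \<partial>M) = (\<Sum>n. \<integral>\<^sup>+x. ennreal \<bar>d n x\<bar> \<partial>M)"
    by (rule nn_integral_suminf) measurable
  also have "\<dots> = (\<Sum>n. ennreal (\<integral>x. \<bar>d n x\<bar> \<partial>M))"
    using intd by (simp add: nn_integral_eq_integral)
  also have "\<dots> = ennreal (\<Sum>n. \<integral>x. \<bar>d n x\<bar> \<partial>M)"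
    using sm unfolding d_def by (intro suminf_ennreal2) auto
  finally have "(\<integral>\<^sup>+x. (\<Sum>n. ennreal \<bar>d n x\<bar>) \<partial>M) \<noteq> \<infinity>" by simp
  then have "AE x in M. (\<Sum>n. ennreal \<bar>d n x\<bar>) \<noteq> \<infinity>"
    by (intro nn_integral_noteq_infinite) auto
  then have AE_sm: "AE x in M. summable (\<lambda>n. \<bar>d n x\<bar>)"
    by (rule AE_mp) (auto intro!: AE_I2 summable_suminf_not_top)
  define D where "D x = (\<Sum>n. d n x)" for x
  have telescope: "g 0 x + (\<Sum>i<n. d i x) = g n x" for n x
    by (induction n) (auto simp: d_def)
  have intD: "integrable M D"
    unfolding D_def
    using intd AE_sm sm[folded d_def] by (intro integrable_suminf) auto
  \<comment> \<open>The absolute value makes the limit nonnegative everywhere; it changes nothing almost everywhere.\<close>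
  have lim: "(\<lambda>n. \<integral>x. g n x * \<psi> x \<partial>M) \<longlonglongrightarrow> (\<integral>x. \<bar>g 0 x + D x\<bar> * \<psi> x \<partial>M)"
    if [measurable]: "\<psi> \<in> borel_measurable M" and \<psi>: "\<And>x. x \<in> space M \<Longrightarrow> \<bar>\<psi> x\<bar> \<le> c" for \<psi> c
  proof -
    have int\<psi>: "integrable M (\<lambda>x. u x * \<psi> x)" if u: "integrable M u" for u
    proof (rule Bochner_Integration.integrable_bound)
      show "integrable M (\<lambda>x. c * u x)" using u by simp
      show "(\<lambda>x. u x * \<psi> x) \<in> borel_measurable M" using u by measurable
      show "AE x in M. norm (u x * \<psi> x) \<le> norm (c * u x)"
      proof (rule AE_I2)
        fix x assume "x \<in> space M"
        then have "\<bar>u x\<bar> * \<bar>\<psi> x\<bar> \<le> \<bar>u x\<bar> * \<bar>c\<bar>" using \<psi>[of x] by (intro mult_left_mono) auto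
        then show "norm (u x * \<psi> x) \<le> norm (c * u x)" by (simp add: abs_mult mult.commute)
      qed
    qed
    have "summable (\<lambda>n. \<integral>x. norm (d n x * \<psi> x) \<partial>M)"
    proof (rule summable_comparison_test')
      show "summable (\<lambda>n. \<bar>c\<bar> * (\<integral>x. \<bar>d n x\<bar> \<partial>M))"
        using sm unfolding d_def by (rule summable_mult)
      fix n
      have "(\<integral>x. norm (d n x * \<psi> x) \<partial>M) \<le> (\<integral>x. \<bar>c\<bar> * \<bar>d n x\<bar> \<partial>M)"
      proof (rule integral_mono)
        show "integrable M (\<lambda>x. norm (d n x * \<psi> x))" using int\<psi>[OF intd] by simp
        fix x assume "x \<in> space M"
        then have "\<bar>d n x\<bar> * \<bar>\<psi> x\<bar> \<le> \<bar>d n x\<bar> * \<bar>c\<bar>" using \<psi>[of x] by (intro mult_left_mono) auto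
        then show "norm (d n x * \<psi> x) \<le> \<bar>c\<bar> * \<bar>d n x\<bar>" by (simp add: abs_mult mult.commute)
      qed (use intd in auto)
      then show "norm (\<integral>x. norm (d n x * \<psi> x) \<partial>M) \<le> \<bar>c\<bar> * (\<integral>x. \<bar>d n x\<bar> \<partial>M)"
        by simp
    qed
    then have sums: "(\<lambda>n. \<integral>x. d n x * \<psi> x \<partial>M) sums (\<integral>x. (\<Sum>n. d n x * \<psi> x) \<partial>M)"
    proof (intro sums_integral int\<psi> intd)
      show "AE x in M. summable (\<lambda>n. norm (d n x * \<psi> x))"
        using AE_sm by eventually_elim (simp add: abs_mult summable_mult2)
    qed
    have "(\<integral>x. (\<Sum>n. d n x * \<psi> x) \<partial>M) = (\<integral>x. D x * \<psi> x \<partial>M)"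
      unfolding D_def
    proof (rule integral_cong_AE)
      show "AE x in M. (\<Sum>n. d n x * \<psi> x) = (\<Sum>n. d n x) * \<psi> x"
        using AE_sm by eventually_elim (simp add: suminf_mult2 summable_rabs_cancel)
    qed measurable
    with sums have "(\<lambda>n. \<Sum>i<n. \<integral>x. d i x * \<psi> x \<partial>M) \<longlonglongrightarrow> (\<integral>x. D x * \<psi> x \<partial>M)"
      by (simp add: sums_def)
    then have "(\<lambda>n. (\<integral>x. g 0 x * \<psi> x \<partial>M) + (\<Sum>i<n. \<integral>x. d i x * \<psi> x \<partial>M))
        \<longlonglongrightarrow> (\<integral>x. g 0 x * \<psi> x \<partial>M) + (\<integral>x. D x * \<psi> x \<partial>M)"
      by (intro tendsto_intros)
    also have "(\<lambda>n. (\<integral>x. g 0 x * \<psi> x \<partial>M) + (\<Sum>i<n. \<integral>x. d i x * \<psi> x \<partial>M)) = (\<lambda>n. \<integral>x. g n x * \<psi> x \<partial>M)"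
    proof
      fix n
      have "(\<integral>x. g n x * \<psi> x \<partial>M) = (\<integral>x. g 0 x * \<psi> x + (\<Sum>i<n. d i x * \<psi> x) \<partial>M)"
        by (subst telescope[symmetric]) (simp add: distrib_right sum_distrib_right)
      also have "\<dots> = (\<integral>x. g 0 x * \<psi> x \<partial>M) + (\<Sum>i<n. \<integral>x. d i x * \<psi> x \<partial>M)"
        using int\<psi>[OF int] int\<psi>[OF intd] by simp
      finally show "(\<integral>x. g 0 x * \<psi> x \<partial>M) + (\<Sum>i<n. \<integral>x. d i x * \<psi> x \<partial>M) = (\<integral>x. g n x * \<psi> x \<partial>M)" ..
    qed
    also have "(\<integral>x. g 0 x * \<psi> x \<partial>M) + (\<integral>x. D x * \<psi> x \<partial>M) = (\<integral>x. (g 0 x + D x) * \<psi> x \<partial>M)"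
      using int\<psi>[OF int] int\<psi>[OF intD] by (simp add: distrib_right)
    also have "\<dots> = (\<integral>x. \<bar>g 0 x + D x\<bar> * \<psi> x \<partial>M)"
    proof (rule integral_cong_AE)
      have "AE x in M. 0 \<le> g 0 x + D x"
        using AE_sm AE_space
      proof eventually_elim
        case (elim x)
        have "(\<lambda>n. \<Sum>i<n. d i x) \<longlonglongrightarrow> D x"
          using summable_LIMSEQ[OF summable_rabs_cancel[OF elim(1)]] by (simp add: D_def)
        then have "(\<lambda>n. g 0 x + (\<Sum>i<n. d i x)) \<longlonglongrightarrow> g 0 x + D x" by (intro tendsto_intros)
        then show ?case using nonneg elim(2) unfolding telescope by (intro LIMSEQ_le_const) auto
      qed
      then show "AE x in M. (g 0 x + D x) * \<psi> x = \<bar>g 0 x + D x\<bar> * \<psi> x" by auto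
    qed (use intD in measurable)
    finally show ?thesis .
  qed
  show ?thesis
    using int[of 0] intD lim by (intro exI[of _ "\<lambda>x. \<bar>g 0 x + D x\<bar>"]) auto
qed

context lyapunov_kernel
begin

text \<open>Density at time \<open>n\<close> of the killed chain started from \<open>\<rho>\<close> restricted to \<open>B 0\<close>.\<close>
definition occupation :: "nat \<Rightarrow> 'a \<Rightarrow> real" where
  "occupation n = (P_dual ^^ n) (indicator (B 0))"

lemma weight_occupation: "weight (occupation n)"
  unfolding occupation_def by (induction n) (auto intro: weight_indicator weight_P_dual)

lemma integral_occupation:
  "dominated u c \<Longrightarrow> (\<integral>y. occupation n y * u y \<partial>\<rho>) = (\<integral>x. indicator (B 0) x * (P ^^ n) u x \<partial>\<rho>)"
proof (induction n arbitrary: u c)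
  case (Suc n)
  have "(\<integral>y. occupation (Suc n) y * u y \<partial>\<rho>) = (\<integral>y. occupation n y * P u y \<partial>\<rho>)"
    using integral_P_dual[OF weight_occupation[of n] Suc.prems] by (simp add: occupation_def)
  also have "\<dots> = (\<integral>x. indicator (B 0) x * (P ^^ Suc n) u x \<partial>\<rho>)"
    using Suc.IH[OF dominated_P[OF Suc.prems]] by (simp add: funpow_swap1)
  finally show ?case .
qed (simp add: occupation_def)

lemma mass_eq_integral_occupation: "mass n = (\<integral>y. occupation n y \<partial>\<rho>)"
  using integral_occupation[OF dominated_1, of n] by (simp add: mass_def survival_def)

lemma mass_Suc_le: "\<exists>E>0. \<forall>n. mass (Suc n) \<le> E * mass n"
proof -
  obtain H where H: "H > 0" "\<And>n x. x \<in> space \<rho> \<Longrightarrow> survival n x \<le> H * mass n * V x"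
    using survival_le_mass by auto
  define J where "J = (\<integral>x. indicator (B 0) x * V x \<partial>\<rho>)"
  have "mass (Suc n) \<le> (H * CV * J) * mass n" for n
  proof -
    have "dominated (survival n) (H * mass n)"
      using dominated_survival[of n] survival_nonneg[of _ n] H(2) by (auto simp: dominated_def)
    then have "dominated (survival (Suc n)) (H * mass n * CV)"
      unfolding survival_Suc by (rule dominated_P)
    from weight_integral_le[OF weight_indicator this, of 0] show ?thesis
      by (simp add: mass_def J_def ac_simps)
  qed
  then have "mass (Suc n) \<le> max 1 (H * CV * J) * mass n" for n
    using mass_nonneg[of n] by (meson max.cobounded2 mult_right_mono order_trans)
  then show ?thesis by (intro exI[of _ "max 1 (H * CV * J)"]) auto
qed

text \<open>
  One step leads from \<open>x\<close> to \<open>B 0\<close> with a density bounded below, and losing one time step costs only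
  a constant factor in the mass. This makes the infimum of \<open>survival n x / mass n\<close> over \<open>n\<close> positive.
\<close>
lemma survival_ge_mass:
  assumes x: "x \<in> space \<rho>"
  shows "\<exists>k>0. \<forall>n. k * mass n \<le> survival n x"
proof -
  obtain m where m: "x \<in> B m" using x B_Un by auto
  obtain k where k: "k > 0" "\<And>y. y \<in> B 0 \<Longrightarrow> k \<le> p x y" using p_lower[of m 0] m by auto
  obtain E where E: "E > 0" "\<And>n. mass (Suc n) \<le> E * mass n" using mass_Suc_le by auto
  define l where "l = min (k / E) (1 / mass 0)"
  have l: "l > 0" "l \<le> k / E" "l \<le> 1 / mass 0"
    using k(1) E(1) mass_pos[of 0] by (auto simp: l_def)
  have "l * mass n \<le> survival n x" for n
  proof (cases n)
    case 0
    then show ?thesis using l(3) mass_pos[of 0] by (simp add: field_simps)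
  next
    case (Suc i)
    have "l * mass (Suc i) \<le> k / E * (E * mass i)"
      using l E k mass_nonneg by (intro mult_mono) auto
    also have "\<dots> \<le> survival (Suc i) x"
      using survival_Suc_ge[OF x k(2), of i] E(1) by simp
    finally show ?thesis by (simp add: Suc)
  qed
  then show ?thesis using l(1) by auto
qed

text \<open>
  The normalised densities \<open>r n\<close> of the chain started in \<open>B 0\<close> at times \<open>n\<close> and \<open>n + 1\<close> are compared by
  integrating the cross product against the initial density and its image under one step. Testing
  with \<open>\<phi> = \<plusminus> V\<close>, with the sign of \<open>r (Suc n) - r n\<close>, bounds the increments in weighted \<open>L^1\<close>. The limit
  is invariant up to the factor \<open>\<eta>\<close>, the limit of the ratios of consecutive masses.
\<close>
lemma invariant_weight:
  "\<exists>r \<eta>. weight r \<and> (\<integral>x. r x \<partial>\<rho>) = 1 \<and> 0 < \<eta> \<and>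
     (\<forall>u c. dominated u c \<longrightarrow> (\<integral>x. r x * P u x \<partial>\<rho>) = \<eta> * (\<integral>x. r x * u x \<partial>\<rho>))"
proof -
  obtain \<alpha> C where \<alpha>: "0 < \<alpha>" "\<alpha> < 1" and C: "0 < C"
    and contr: "\<And>\<phi> n x y. dominated \<phi> 1 \<Longrightarrow> x \<in> space \<rho> \<Longrightarrow> y \<in> space \<rho> \<Longrightarrow>
        \<bar>(P ^^ n) \<phi> x * survival n y - (P ^^ n) \<phi> y * survival n x\<bar>
          \<le> C * \<alpha> ^ n * (mass n)\<^sup>2 * (V x * V y)"
    using cross_contraction by metis
  obtain \<theta> where \<theta>: "\<theta> > 0" "\<And>n. \<theta> * mass n \<le> mass (Suc n)" using mass_Suc_ge by auto
  define b :: "'a \<Rightarrow> real" where "b = indicator (B 0)"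
  have b: "weight b" unfolding b_def by (rule weight_indicator)
  have Pb: "weight (P_dual b)" by (rule weight_P_dual[OF b])
  define J where "J = (\<integral>x. P_dual b x * V x \<partial>\<rho>) * (\<integral>x. b x * V x \<partial>\<rho>)"
  define r where "r n x = occupation n x / mass n" for n x
  have occ: "(\<integral>x. occupation n x * u x \<partial>\<rho>) = mass n * (\<integral>x. r n x * u x \<partial>\<rho>)" for n u
    using mass_pos[of n] by (simp add: r_def)
  have r_weight: "weight (r n)" for n
    using weight_occupation[of n] mass_nonneg[of n] unfolding weight_def r_def by auto
  have diff: "\<bar>(\<integral>x. r (Suc n) x * \<phi> x \<partial>\<rho>) - (\<integral>x. r n x * \<phi> x \<partial>\<rho>)\<bar> \<le> C * J / \<theta> * \<alpha> ^ n"
    if \<phi>: "dominated \<phi> 1" for \<phi> n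
  proof -
    note d1 = dominated_funpow[OF \<phi>, of n] and d2 = dominated_survival[of n]
    have "\<bar>(\<integral>x. P_dual b x * (P ^^ n) \<phi> x \<partial>\<rho>) * (\<integral>x. b x * survival n x \<partial>\<rho>)
        - (\<integral>x. b x * (P ^^ n) \<phi> x \<partial>\<rho>) * (\<integral>x. P_dual b x * survival n x \<partial>\<rho>)\<bar>
      \<le> 0 * ((\<integral>x. P_dual b x * survival n x \<partial>\<rho>) * (\<integral>x. b x * survival n x \<partial>\<rho>)
            - 0\<^sup>2 * (\<integral>x. indicator (B 0) x * survival n x \<partial>\<rho>)\<^sup>2)
         + C * \<alpha> ^ n * (mass n)\<^sup>2 * ((\<integral>x. P_dual b x * V x \<partial>\<rho>) * (\<integral>x. b x * V x \<partial>\<rho>))"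
      by (rule integral_cross_le[where h = "survival n" and V = V])
         (use b Pb contr[OF \<phi>] C \<alpha> B_subset[of 0] survival_nonneg V_nonneg in
          \<open>auto simp: weight_def intro!: weight_integrable[OF b d1] weight_integrable[OF Pb d1]
           weight_integrable[OF b d2] weight_integrable[OF Pb d2] weight_integrable[OF weight_indicator d2]\<close>)
    also have "(\<integral>x. P_dual b x * (P ^^ n) \<phi> x \<partial>\<rho>) = mass (Suc n) * (\<integral>x. r (Suc n) x * \<phi> x \<partial>\<rho>)"
      using integral_P_dual[OF b d1] integral_occupation[OF \<phi>, of "Suc n"] occ[of "Suc n" \<phi>] by (simp add: b_def)
    also have "(\<integral>x. b x * (P ^^ n) \<phi> x \<partial>\<rho>) = mass n * (\<integral>x. r n x * \<phi> x \<partial>\<rho>)"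
      using integral_occupation[OF \<phi>, of n] occ[of n \<phi>] by (simp add: b_def)
    also have "(\<integral>x. b x * survival n x \<partial>\<rho>) = mass n" by (simp add: b_def mass_def)
    also have "(\<integral>x. P_dual b x * survival n x \<partial>\<rho>) = mass (Suc n)"
      using integral_P_dual[OF b d2] by (simp add: b_def mass_def survival_Suc)
    finally have "\<bar>mass (Suc n) * (\<integral>x. r (Suc n) x * \<phi> x \<partial>\<rho>) * mass n
         - mass n * (\<integral>x. r n x * \<phi> x \<partial>\<rho>) * mass (Suc n)\<bar> \<le> C * \<alpha> ^ n * (mass n)\<^sup>2 * J"
      by (simp add: J_def)
    moreover have "\<bar>mass (Suc n) * s * mass n - mass n * t * mass (Suc n)\<bar> = mass (Suc n) * mass n * \<bar>s - t\<bar>" for s t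
    proof -
      have "mass (Suc n) * s * mass n - mass n * t * mass (Suc n) = mass (Suc n) * mass n * (s - t)"
        by (simp add: algebra_simps)
      then show ?thesis using mass_nonneg[of n] mass_nonneg[of "Suc n"] by (simp add: abs_mult)
    qed
    ultimately have "mass (Suc n) * mass n * \<bar>(\<integral>x. r (Suc n) x * \<phi> x \<partial>\<rho>) - (\<integral>x. r n x * \<phi> x \<partial>\<rho>)\<bar>
        \<le> C * \<alpha> ^ n * (mass n)\<^sup>2 * J" (is "_ * _ * ?d \<le> _")
      by simp
    moreover have "(\<theta> * mass n) * mass n * ?d \<le> mass (Suc n) * mass n * ?d"
      using \<theta>(2) mass_nonneg by (intro mult_right_mono) auto
    ultimately have "(mass n)\<^sup>2 * (\<theta> * ?d) \<le> (mass n)\<^sup>2 * (C * \<alpha> ^ n * J)"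
      by (simp add: power2_eq_square ac_simps)
    then have "\<theta> * ?d \<le> C * \<alpha> ^ n * J"
      using mass_pos[of n] by (simp add: mult_le_cancel_left)
    then show ?thesis using \<theta>(1) by (simp add: field_simps)
  qed
  have intr: "integrable \<rho> (\<lambda>x. r n x * V x)" and r_meas [measurable]: "r n \<in> borel_measurable \<rho>"
    and r_nonneg: "\<And>x. x \<in> space \<rho> \<Longrightarrow> 0 \<le> r n x" for n
    using r_weight[of n] by (auto simp: weight_def)
  have "summable (\<lambda>n. \<integral>x. \<bar>r (Suc n) x * V x - r n x * V x\<bar> \<partial>\<rho>)"
  proof (rule summable_comparison_test')
    show "summable (\<lambda>n. C * J / \<theta> * \<alpha> ^ n)" using \<alpha> by (intro summable_mult summable_geometric) auto
    fix n
    define \<phi> where "\<phi> x = sgn (r (Suc n) x - r n x) * V x" for x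
    have "\<phi> \<in> borel_measurable \<rho>" unfolding \<phi>_def sgn_if by measurable
    then have \<phi>: "dominated \<phi> 1"
      using V_nonneg by (auto simp: dominated_def \<phi>_def abs_mult sgn_if)
    have "(\<integral>x. \<bar>r (Suc n) x * V x - r n x * V x\<bar> \<partial>\<rho>) = (\<integral>x. r (Suc n) x * \<phi> x - r n x * \<phi> x \<partial>\<rho>)"
    proof (intro Bochner_Integration.integral_cong refl)
      fix x assume x: "x \<in> space \<rho>"
      have "\<bar>r (Suc n) x * V x - r n x * V x\<bar> = \<bar>r (Suc n) x - r n x\<bar> * V x"
        using V_nonneg[OF x] by (simp add: left_diff_distrib[symmetric] abs_mult)
      also have "\<bar>r (Suc n) x - r n x\<bar> = (r (Suc n) x - r n x) * sgn (r (Suc n) x - r n x)"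
        by (simp add: abs_sgn)
      finally show "\<bar>r (Suc n) x * V x - r n x * V x\<bar> = r (Suc n) x * \<phi> x - r n x * \<phi> x"
        by (simp add: \<phi>_def algebra_simps)
    qed
    also have "\<dots> = (\<integral>x. r (Suc n) x * \<phi> x \<partial>\<rho>) - (\<integral>x. r n x * \<phi> x \<partial>\<rho>)"
      by (intro Bochner_Integration.integral_diff weight_integrable[OF r_weight \<phi>])
    also have "\<dots> \<le> C * J / \<theta> * \<alpha> ^ n" using diff[OF \<phi>, of n] by linarith
    finally show "norm (\<integral>x. \<bar>r (Suc n) x * V x - r n x * V x\<bar> \<partial>\<rho>) \<le> C * J / \<theta> * \<alpha> ^ n" by simp
  qed
  from L1_limit[OF intr _ this] V_nonneg r_nonneg obtain G where G: "integrable \<rho> G" "\<forall>x. 0 \<le> G x"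
    and Glim: "\<forall>\<psi> c. \<psi> \<in> borel_measurable \<rho> \<longrightarrow> (\<forall>x\<in>space \<rho>. \<bar>\<psi> x\<bar> \<le> c) \<longrightarrow>
       (\<lambda>n. \<integral>x. r n x * V x * \<psi> x \<partial>\<rho>) \<longlonglongrightarrow> (\<integral>x. G x * \<psi> x \<partial>\<rho>)"
    by (auto 0 3)
  note [measurable] = borel_measurable_integrable[OF G(1)]
  define R where "R x = G x / V x" for x
  have R: "weight R"
    unfolding weight_def
  proof (intro conjI ballI)
    show "R \<in> borel_measurable \<rho>" unfolding R_def by measurable
    show "0 \<le> R x" if "x \<in> space \<rho>" for x using G(2) V_nonneg[OF that] by (simp add: R_def)
    have "integrable \<rho> (\<lambda>x. R x * V x) \<longleftrightarrow> integrable \<rho> G"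
      using V_pos by (intro Bochner_Integration.integrable_cong) (auto simp: R_def less_imp_neq[symmetric])
    then show "integrable \<rho> (\<lambda>x. R x * V x)" using G(1) by simp
  qed
  have lim: "(\<lambda>n. \<integral>x. r n x * u x \<partial>\<rho>) \<longlonglongrightarrow> (\<integral>x. R x * u x \<partial>\<rho>)" if u: "dominated u c" for u c
  proof -
    have [measurable]: "u \<in> borel_measurable \<rho>" using u by (simp add: dominated_def)
    have "(\<lambda>n. \<integral>x. r n x * V x * (u x / V x) \<partial>\<rho>) \<longlonglongrightarrow> (\<integral>x. G x * (u x / V x) \<partial>\<rho>)"
      using u V_pos by (intro Glim[rule_format, of _ c]) (auto simp: dominated_def abs_of_pos pos_divide_le_eq)
    also have "(\<lambda>n. \<integral>x. r n x * V x * (u x / V x) \<partial>\<rho>) = (\<lambda>n. \<integral>x. r n x * u x \<partial>\<rho>)"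
      using V_pos by (intro ext Bochner_Integration.integral_cong) (auto simp: less_imp_neq[symmetric])
    finally show ?thesis by (simp add: R_def)
  qed
  have P_r: "(\<integral>x. r n x * P u x \<partial>\<rho>) = mass (Suc n) / mass n * (\<integral>x. r (Suc n) x * u x \<partial>\<rho>)"
    if u: "dominated u c" for n u c
  proof -
    have "mass n * (\<integral>x. r n x * P u x \<partial>\<rho>) = mass (Suc n) * (\<integral>x. r (Suc n) x * u x \<partial>\<rho>)"
      unfolding occ[symmetric]
      using integral_occupation[OF dominated_P[OF u], of n] integral_occupation[OF u, of "Suc n"]
      by (simp add: funpow_swap1)
    then show ?thesis using mass_pos[of n] by (simp add: field_simps)
  qed
  have r1: "(\<integral>x. r n x * 1 \<partial>\<rho>) = 1" for n
    using mass_pos[of n] by (simp add: r_def mass_eq_integral_occupation)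
  define \<eta> where "\<eta> = (\<integral>x. R x * P (\<lambda>_. 1) x \<partial>\<rho>)"
  have ratio: "(\<lambda>n. mass (Suc n) / mass n) \<longlonglongrightarrow> \<eta>"
    using lim[OF dominated_P[OF dominated_1]] unfolding P_r[OF dominated_1] r1 \<eta>_def by simp
  show ?thesis
  proof (intro exI conjI allI impI)
    show "weight R" by (rule R)
    have "(\<lambda>n. 1 :: real) \<longlonglongrightarrow> (\<integral>x. R x * 1 \<partial>\<rho>)"
      using lim[OF dominated_1] unfolding r1 .
    then show "(\<integral>x. R x \<partial>\<rho>) = 1" by (simp add: LIMSEQ_const_iff)
    have "\<theta> \<le> \<eta>"
      using \<theta> mass_pos by (intro LIMSEQ_le_const[OF ratio] exI[of _ 0]) (auto simp: field_simps)
    then show "0 < \<eta>" using \<theta>(1) by simp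
    fix u c assume u: "dominated u c"
    have "(\<lambda>n. mass (Suc n) / mass n * (\<integral>x. r (Suc n) x * u x \<partial>\<rho>)) \<longlonglongrightarrow> \<eta> * (\<integral>x. R x * u x \<partial>\<rho>)"
      by (intro tendsto_mult ratio LIMSEQ_Suc[OF lim[OF u]])
    then have "(\<lambda>n. \<integral>x. r n x * P u x \<partial>\<rho>) \<longlonglongrightarrow> \<eta> * (\<integral>x. R x * u x \<partial>\<rho>)"
      unfolding P_r[OF u] .
    with lim[OF dominated_P[OF u]] show "(\<integral>x. R x * P u x \<partial>\<rho>) = \<eta> * (\<integral>x. R x * u x \<partial>\<rho>)"
      by (rule LIMSEQ_unique)
  qed
qed

text \<open>
  Integrating the cross product in its second variable against \<open>r\<close> gives the factor \<open>\<eta> ^ n\<close> on the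
  left and \<open>(mass n)\<^sup>2\<close> on the right. One factor \<open>mass n\<close> is at most a multiple of \<open>\<eta> ^ n\<close>: the latter is
  the probability of survival under \<open>r\<close>, and \<open>r\<close> charges some \<open>B m\<close>, from which \<open>B 0\<close> is reached at
  once.
\<close>
lemma geometric_convergence:
  "\<exists>r \<eta> C \<alpha>. weight r \<and> (\<integral>x. r x \<partial>\<rho>) = 1 \<and> 0 < \<eta> \<and>
     (\<forall>u c. dominated u c \<longrightarrow> (\<integral>x. r x * P u x \<partial>\<rho>) = \<eta> * (\<integral>x. r x * u x \<partial>\<rho>)) \<and>
     0 < C \<and> 0 < \<alpha> \<and> \<alpha> < 1 \<and>
     (\<forall>\<phi> n. dominated \<phi> 1 \<longrightarrow> (\<forall>x\<in>space \<rho>.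
        \<bar>(P ^^ n) \<phi> x - (\<integral>y. r y * \<phi> y \<partial>\<rho>) * survival n x\<bar> \<le> C * \<alpha> ^ n * mass n * V x))"
proof -
  obtain \<alpha> C where \<alpha>: "0 < \<alpha>" "\<alpha> < 1" and C: "0 < C"
    and contr: "\<And>\<phi> n x y. dominated \<phi> 1 \<Longrightarrow> x \<in> space \<rho> \<Longrightarrow> y \<in> space \<rho> \<Longrightarrow>
        \<bar>(P ^^ n) \<phi> x * survival n y - (P ^^ n) \<phi> y * survival n x\<bar>
          \<le> C * \<alpha> ^ n * (mass n)\<^sup>2 * (V x * V y)"
    using cross_contraction by metis
  obtain r \<eta> where r: "weight r" "(\<integral>x. r x \<partial>\<rho>) = 1" and \<eta>: "0 < \<eta>"
    and inv: "\<And>u c. dominated u c \<Longrightarrow> (\<integral>x. r x * P u x \<partial>\<rho>) = \<eta> * (\<integral>x. r x * u x \<partial>\<rho>)"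
    using invariant_weight by metis
  have pow: "(\<integral>x. r x * (P ^^ n) u x \<partial>\<rho>) = \<eta> ^ n * (\<integral>x. r x * u x \<partial>\<rho>)" if "dominated u c" for u c n
    using inv[OF dominated_funpow[OF that]] by (induction n) auto
  have r_meas [measurable]: "r \<in> borel_measurable \<rho>" and r_nonneg: "\<And>x. x \<in> space \<rho> \<Longrightarrow> 0 \<le> r x"
    using r(1) by (auto simp: weight_def)
  have int_r: "integrable \<rho> r" using weight_integrable[OF r(1) dominated_1] by simp
  have int_rB: "integrable \<rho> (\<lambda>x. r x * indicator (B m) x)" for m
    using int_r by (intro integrable_real_mult_indicator) auto
  have "\<exists>m. 0 < (\<integral>x. r x * indicator (B m) x \<partial>\<rho>)"
  proof (rule ccontr)
    assume "\<not> ?thesis"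
    then have "(\<integral>x. r x * indicator (B m) x \<partial>\<rho>) = 0" for m
      using r_nonneg by (intro antisym Bochner_Integration.integral_nonneg) (auto simp: not_less)
    then have "AE x in \<rho>. r x * indicator (B m) x = 0" for m
      using integral_nonneg_eq_0_iff_AE[OF int_rB, of m] r_nonneg by auto
    then have "AE x in \<rho>. \<forall>m. r x * indicator (B m) x = 0" by (subst AE_all_countable) blast
    with AE_space have "AE x in \<rho>. r x = 0"
    proof eventually_elim
      case (elim x)
      then obtain m where "x \<in> B m" using B_Un by auto
      then show ?case using elim(2) by (metis indicator_simps(1) mult.right_neutral)
    qed
    then have "(\<integral>x. r x \<partial>\<rho>) = (\<integral>x. 0 \<partial>\<rho>)" by (intro integral_cong_AE) auto
    then show False using r(2) by simp
  qed
  then obtain m where m: "0 < (\<integral>x. r x * indicator (B m) x \<partial>\<rho>)" (is "0 < ?J") ..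
  obtain k where k: "k > 0" "\<And>x y. x \<in> B m \<Longrightarrow> y \<in> B 0 \<Longrightarrow> k \<le> p x y" using p_lower[of m 0] by auto
  obtain E where E: "E > 0" "\<And>n. mass (Suc n) \<le> E * mass n" using mass_Suc_le by auto
  define D where "D = max (mass 0) (E / (k * ?J))"
  have D: "D > 0" using mass_pos[of 0] by (simp add: D_def)
  have mass_le: "mass n \<le> D * \<eta> ^ n" for n
  proof (cases n)
    case (Suc i)
    have "k * mass i * ?J = (\<integral>x. (k * mass i) * (r x * indicator (B m) x) \<partial>\<rho>)" by simp
    also have "\<dots> \<le> (\<integral>x. r x * survival (Suc i) x \<partial>\<rho>)"
    proof (rule integral_mono)
      fix x assume x: "x \<in> space \<rho>"
      show "k * mass i * (r x * indicator (B m) x) \<le> r x * survival (Suc i) x"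
      proof (cases "x \<in> B m")
        case True
        then show ?thesis
          using mult_left_mono[OF survival_Suc_ge[OF x k(2), of i] r_nonneg[OF x]] by (simp add: ac_simps)
      qed (use x r_nonneg survival_nonneg in simp)
    qed (use int_rB weight_integrable[OF r(1) dominated_survival] in auto)
    also have "\<dots> = \<eta> ^ Suc i"
      using pow[OF dominated_1, of "Suc i"] r(2) by (simp add: survival_def)
    finally have "k * ?J * mass i \<le> \<eta> ^ Suc i" by (simp add: ac_simps)
    then have "mass i \<le> \<eta> ^ Suc i / (k * ?J)" using k(1) m by (simp add: field_simps)
    then have "mass (Suc i) \<le> E * (\<eta> ^ Suc i / (k * ?J))"
      using E by (meson mult_left_mono less_imp_le order_trans)
    also have "\<dots> = E / (k * ?J) * \<eta> ^ Suc i" by simp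
    also have "\<dots> \<le> D * \<eta> ^ Suc i" using \<eta> by (intro mult_right_mono) (auto simp: D_def)
    finally show ?thesis by (simp add: Suc)
  qed (simp add: D_def)
  define I where "I = (\<integral>x. r x * V x \<partial>\<rho>)"
  have I: "1 \<le> I"
  proof -
    have "(\<integral>x. r x \<partial>\<rho>) \<le> I" unfolding I_def
      using int_r r r_nonneg V_ge_1 mult_left_mono[of 1 "V _" "r _"]
      by (intro integral_mono) (auto simp: weight_def)
    then show ?thesis using r(2) by simp
  qed
  have conv: "\<bar>(P ^^ n) \<phi> x - (\<integral>y. r y * \<phi> y \<partial>\<rho>) * survival n x\<bar> \<le> C * I * D * \<alpha> ^ n * mass n * V x"
    if \<phi>: "dominated \<phi> 1" and x: "x \<in> space \<rho>" for \<phi> n x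
  proof -
    let ?w = "\<lambda>y. (P ^^ n) \<phi> x * survival n y - (P ^^ n) \<phi> y * survival n x"
    note d = dominated_funpow[OF \<phi>, of n] dominated_survival[of n]
    have [measurable]: "(P ^^ n) \<phi> \<in> borel_measurable \<rho>" "survival n \<in> borel_measurable \<rho>"
      using d by (auto simp: dominated_def)
    have "dominated ?w (C * \<alpha> ^ n * (mass n)\<^sup>2 * V x)"
      using contr[OF \<phi> x] by (auto simp: dominated_def mult.assoc)
    from weight_integral_le[OF r(1) this]
    have "\<bar>\<integral>y. r y * ?w y \<partial>\<rho>\<bar> \<le> C * \<alpha> ^ n * (mass n)\<^sup>2 * V x * I" by (simp add: I_def)
    also have "(\<integral>y. r y * ?w y \<partial>\<rho>)
       = (\<integral>y. (P ^^ n) \<phi> x * (r y * survival n y) - (r y * (P ^^ n) \<phi> y) * survival n x \<partial>\<rho>)"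
      by (simp add: algebra_simps)
    also have "\<dots> = (P ^^ n) \<phi> x * (\<integral>y. r y * survival n y \<partial>\<rho>) - (\<integral>y. r y * (P ^^ n) \<phi> y \<partial>\<rho>) * survival n x"
      using weight_integrable[OF r(1) d(1)] weight_integrable[OF r(1) d(2)] by simp
    also have "\<dots> = \<eta> ^ n * ((P ^^ n) \<phi> x - (\<integral>y. r y * \<phi> y \<partial>\<rho>) * survival n x)"
      using pow[OF \<phi>, of n] pow[OF dominated_1, of n] r(2) by (simp add: survival_def algebra_simps)
    also have "\<bar>\<dots>\<bar> = \<eta> ^ n * \<bar>(P ^^ n) \<phi> x - (\<integral>y. r y * \<phi> y \<partial>\<rho>) * survival n x\<bar>" (is "_ = _ * ?e")
      using \<eta> by (simp add: abs_mult)
    finally have "\<eta> ^ n * ?e \<le> C * \<alpha> ^ n * V x * I * mass n * mass n"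
      by (simp add: power2_eq_square ac_simps)
    also have "\<dots> \<le> C * \<alpha> ^ n * V x * I * mass n * (D * \<eta> ^ n)"
      using C \<alpha> V_nonneg[OF x] I mass_nonneg[of n] by (intro mult_left_mono mass_le) auto
    also have "\<dots> = \<eta> ^ n * (C * I * D * \<alpha> ^ n * mass n * V x)" by (simp add: ac_simps)
    finally show ?thesis using \<eta> by (simp add: mult_le_cancel_left)
  qed
  have "0 < C * I * D" using C I D by simp
  with r \<eta> inv \<alpha> conv show ?thesis
    by (intro exI[of _ r] exI[of _ \<eta>] exI[of _ "C * I * D"] exI[of _ \<alpha>]) auto
qed

end

section \<open>Gaussian laws\<close>

definition std_density :: "real^'d \<Rightarrow> real" where
  "std_density z = (\<Prod>i\<in>UNIV. std_normal_density (z $ i))"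

lemma std_density_measurable [measurable]: "std_density \<in> borel_measurable borel"
  unfolding std_density_def by measurable

lemma std_density_nonneg: "0 \<le> std_density z"
  unfolding std_density_def by (intro prod_nonneg) auto

lemma std_density_le_1: "std_density z \<le> 1"
  unfolding std_density_def
proof (intro prod_le_1 conjI)
  fix i
  have "1 \<le> sqrt (2 * pi)" using pi_gt3 by simp
  then have "1 / sqrt (2 * pi) * exp (- (z $ i)\<^sup>2 / 2) \<le> 1 * 1"
    by (intro mult_mono) auto
  then show "std_normal_density (z $ i) \<le> 1" by (simp add: std_normal_density_def)
qed auto

text \<open>Componentwise, since the one-dimensional density decreases in the absolute value.\<close>
lemma std_density_lower:
  assumes "norm z \<le> r"
  shows "std_normal_density r ^ CARD('d) \<le> std_density (z :: real^'d)"
proof -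
  have "(\<Prod>i\<in>(UNIV :: 'd set). std_normal_density r) \<le> std_density z"
    unfolding std_density_def
  proof (intro prod_mono conjI)
    fix i
    have "\<bar>z $ i\<bar> \<le> \<bar>r\<bar>" using component_le_norm_cart[of z i] assms by linarith
    then have "(z $ i)\<^sup>2 \<le> r\<^sup>2" by (simp add: abs_le_square_iff)
    then show "std_normal_density r \<le> std_normal_density (z $ i)"
      by (simp add: std_normal_density_def divide_right_mono)
  qed auto
  then show ?thesis by simp
qed

lemma exp_abs_std_normal_finite:
  "(\<integral>\<^sup>+t. ennreal (exp (c * \<bar>t\<bar>) * std_normal_density t) \<partial>lborel) < \<infinity>"
proof -
  have shift: "exp (a * t) * std_normal_density t = exp (a\<^sup>2 / 2) * normal_density a 1 t" for a t :: real
    by (simp add: normal_density_def exp_add[symmetric] power2_eq_square field_simps)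
  have "(\<integral>\<^sup>+t. ennreal (exp (c * \<bar>t\<bar>) * std_normal_density t) \<partial>lborel)
      \<le> (\<integral>\<^sup>+t. ennreal (exp (c\<^sup>2 / 2) * (normal_density c 1 t + normal_density (- c) 1 t)) \<partial>lborel)"
  proof (intro nn_integral_mono ennreal_leI)
    fix t :: real
    have "exp (c * \<bar>t\<bar>) \<le> exp (c * t) + exp ((- c) * t)" by (cases "t \<ge> 0") auto
    then have "exp (c * \<bar>t\<bar>) * std_normal_density t \<le> (exp (c * t) + exp ((- c) * t)) * std_normal_density t"
      by (intro mult_right_mono) auto
    also have "\<dots> = exp (c\<^sup>2 / 2) * (normal_density c 1 t + normal_density (- c) 1 t)"
      using shift[of c t] shift[of "- c" t] by (simp add: algebra_simps)
    finally show "exp (c * \<bar>t\<bar>) * std_normal_density t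
       \<le> exp (c\<^sup>2 / 2) * (normal_density c 1 t + normal_density (- c) 1 t)" .
  qed
  also have "\<dots> < \<infinity>"
  proof -
    have "integrable lborel (\<lambda>t. exp (c\<^sup>2 / 2) * (normal_density c 1 t + normal_density (- c) 1 t))"
      by simp
    then show ?thesis by (subst nn_integral_eq_integral) (auto intro!: AE_I2)
  qed
  finally show ?thesis .
qed

lemma Basis_cart: "Basis = range (\<lambda>i. axis i (1 :: real))"
  by (auto simp: Basis_vec_def)

lemma prod_Basis_cart: "(\<Prod>b\<in>Basis. g ((z :: real^'d) \<bullet> b)) = (\<Prod>i\<in>UNIV. g (z $ i))"
  unfolding Basis_cart by (subst prod.reindex) (auto simp: inj_on_def axis_eq_axis inner_axis)

text \<open>The norm is at most the sum of the absolute components, and this turns the integral into a product.\<close>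
lemma exp_norm_std_density_finite:
  assumes c: "0 \<le> c"
  shows "(\<integral>\<^sup>+z. ennreal (exp (c * norm z) * std_density (z :: real^'d)) \<partial>lborel) < \<infinity>"
proof -
  let ?g = "\<lambda>t. ennreal (exp (c * \<bar>t\<bar>) * std_normal_density t)"
  have "(\<integral>\<^sup>+z. ennreal (exp (c * norm z) * std_density (z :: real^'d)) \<partial>lborel)
      \<le> (\<integral>\<^sup>+z. (\<Prod>b\<in>Basis. ?g ((z :: real^'d) \<bullet> b)) \<partial>lborel)"
  proof (rule nn_integral_mono)
    fix z :: "real^'d"
    have "c * norm z \<le> (\<Sum>i\<in>UNIV. c * \<bar>z $ i\<bar>)"
      using norm_le_l1_cart[of z] c by (simp add: sum_distrib_left[symmetric] mult_left_mono)
    then have "exp (c * norm z) \<le> (\<Prod>i\<in>UNIV. exp (c * \<bar>z $ i\<bar>))"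
      by (simp add: exp_sum[symmetric])
    then have "exp (c * norm z) * std_density z \<le> (\<Prod>i\<in>UNIV. exp (c * \<bar>z $ i\<bar>)) * std_density z"
      by (intro mult_right_mono std_density_nonneg)
    also have "\<dots> = (\<Prod>i\<in>UNIV. exp (c * \<bar>z $ i\<bar>) * std_normal_density (z $ i))"
      by (simp add: std_density_def prod.distrib)
    finally have "ennreal (exp (c * norm z) * std_density z)
       \<le> ennreal (\<Prod>i\<in>UNIV. exp (c * \<bar>z $ i\<bar>) * std_normal_density (z $ i))"
      by (rule ennreal_leI)
    also have "\<dots> = (\<Prod>i\<in>UNIV. ?g (z $ i))" by (subst prod_ennreal) auto
    also have "\<dots> = (\<Prod>b\<in>Basis. ?g (z \<bullet> b))" by (rule prod_Basis_cart[symmetric])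
    finally show "ennreal (exp (c * norm z) * std_density z) \<le> (\<Prod>b\<in>Basis. ?g (z \<bullet> b))" .
  qed
  also have "\<dots> = (\<Prod>b\<in>(Basis :: (real^'d) set). \<integral>\<^sup>+t. ?g t \<partial>lborel)"
    by (rule nn_integral_lborel_prod) auto
  also have "\<dots> < \<infinity>" using exp_abs_std_normal_finite[of c] by (simp add: power_less_top_ennreal)
  finally show ?thesis .
qed

lemma matrix_vector_norm_bound: "\<exists>k>0. \<forall>z. norm ((A :: real^'n^'m) *v z) \<le> k * norm z"
  using bounded_linear.pos_bounded[OF matrix_vector_mul_bounded_linear[of A]] by (auto simp: mult.commute)

lemma affine_exp_moment_finite:
  fixes A :: "real^'d^'d"
  assumes c: "0 \<le> c"
  shows "(\<integral>\<^sup>+z. ennreal (exp (c * norm (m + A *v z)) * std_density z) \<partial>lborel) < \<infinity>"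
proof -
  obtain k where k: "k > 0" "\<And>z. norm (A *v z) \<le> k * norm z" using matrix_vector_norm_bound[of A] by auto
  have "(\<integral>\<^sup>+z. ennreal (exp (c * norm (m + A *v z)) * std_density z) \<partial>lborel)
     \<le> (\<integral>\<^sup>+z. ennreal (exp (c * norm m)) * ennreal (exp (c * k * norm z) * std_density (z :: real^'d)) \<partial>lborel)"
  proof (rule nn_integral_mono)
    fix z :: "real^'d"
    have "norm (m + A *v z) \<le> norm m + k * norm z"
      using norm_triangle_ineq[of m "A *v z"] k(2)[of z] by linarith
    then have "c * norm (m + A *v z) \<le> c * norm m + c * k * norm z"
      using c mult_left_mono by (fastforce simp: algebra_simps)
    then have "exp (c * norm (m + A *v z)) \<le> exp (c * norm m) * exp (c * k * norm z)"
      by (simp add: exp_add[symmetric])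
    then have "exp (c * norm (m + A *v z)) * std_density z \<le> exp (c * norm m) * exp (c * k * norm z) * std_density z"
      by (intro mult_right_mono std_density_nonneg)
    then show "ennreal (exp (c * norm (m + A *v z)) * std_density z)
       \<le> ennreal (exp (c * norm m)) * ennreal (exp (c * k * norm z) * std_density z)"
      by (simp add: ennreal_mult'[symmetric] mult.assoc ennreal_leI)
  qed
  also have "\<dots> = ennreal (exp (c * norm m)) * (\<integral>\<^sup>+z. ennreal (exp (c * k * norm z) * std_density (z :: real^'d)) \<partial>lborel)"
    by (rule nn_integral_cmult) measurable
  also have "\<dots> < \<infinity>"
    using exp_norm_std_density_finite[of "c * k", where 'd = 'd] c k by (simp add: ennreal_mult_less_top)
  finally show ?thesis .
qed

lemma matrix_vector_measurable [measurable]: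
  "(\<lambda>z. (A :: real^'n^'m) *v z) \<in> borel_measurable borel"
  by (intro borel_measurable_continuous_onI linear_continuous_on matrix_vector_mul_bounded_linear)

lemma nn_integral_affine_gaussian:
  fixes A :: "real^'d^'d"
  assumes [measurable]: "F \<in> borel_measurable borel"
  shows "(\<integral>\<^sup>+y. F y \<partial>distr std_gaussian borel (\<lambda>z. m + A *v z))
     = (\<integral>\<^sup>+z. F (m + A *v z) * ennreal (std_density z) \<partial>lborel)"
proof -
  have *: "std_gaussian = density lborel (\<lambda>z :: real^'d. ennreal (std_density z))"
    by (simp add: std_gaussian_def std_density_def)
  have "(\<lambda>z. m + A *v z) \<in> borel_measurable borel" by measurable
  then show ?thesis
    unfolding * by (simp add: nn_integral_distr nn_integral_density mult.commute)
qed

text \<open>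
  If \<open>A\<close> is singular, some \<open>v \<noteq> 0\<close> is orthogonal to its range. Then \<open>v \<bullet> x\<close> is almost surely constant
  under \<open>G\<close>, so that \<open>v\<close> lies in the kernel of the covariance matrix. The exponential moments supply the
  integrability needed to exchange sum and integral.
\<close>
lemma nondegenerate_imp_invertible:
  fixes A :: "real^'d^'d"
  assumes G: "G = distr std_gaussian borel (\<lambda>z. m + A *v z)" and prob: "prob_space G"
    and nd: "nondegenerate G"
  shows "invertible A"
proof (rule ccontr)
  assume "\<not> invertible A"
  then obtain v where v: "v \<noteq> 0" "transpose A *v v = 0"
    using matrix_left_invertible_ker[of "transpose A"] left_invertible_transpose[of A]
    by (metis invertible_def matrix_left_right_inverse)
  interpret prob_space G by (rule prob)
  have sets_G [measurable_cong, simp]: "sets G = sets borel" and [simp]: "space G = UNIV" by (simp_all add: G)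
  have "v \<bullet> (A *v z) = 0" for z
    using v(2) by (metis dot_lmul_matrix inner_zero_left vector_transpose_matrix transpose_transpose)
  then have vx: "AE x in G. v \<bullet> x = v \<bullet> m"
    unfolding G by (subst AE_distr_iff) (auto simp: std_gaussian_def inner_add_right)
  have exp_int: "integrable G (\<lambda>x. exp (2 * norm x))"
  proof (rule integrableI_nonneg)
    have "(\<integral>\<^sup>+x. ennreal (exp (2 * norm x)) \<partial>G)
        = (\<integral>\<^sup>+z. ennreal (exp (2 * norm (m + A *v z)) * std_density z) \<partial>lborel)"
      unfolding G by (subst nn_integral_affine_gaussian) (auto simp: ennreal_mult' std_density_nonneg)
    then show "(\<integral>\<^sup>+x. ennreal (exp (2 * norm x)) \<partial>G) < \<infinity>"
      using affine_exp_moment_finite[of 2 m A] by simp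
  qed auto
  have comp: "\<bar>x $ i\<bar> \<le> exp (norm x)" for x :: "real^'d" and i
    using component_le_norm_cart[of x i] exp_ge_add_one_self[of "norm x"] by linarith
  have int1: "integrable G (\<lambda>x. x $ i)" for i
  proof (rule Bochner_Integration.integrable_bound[OF exp_int])
    show "AE x in G. norm (x $ i) \<le> norm (exp (2 * norm x))"
    proof (rule AE_I2)
      fix x :: "real^'d"
      show "norm (x $ i) \<le> norm (exp (2 * norm x))" using order_trans[OF comp[of x i]] by simp
    qed
  qed simp
  define a where "a i = (\<integral>y. y $ i \<partial>G)" for i
  have va: "(\<Sum>j\<in>UNIV. v $ j * a j) = v \<bullet> m"
  proof -
    have "(\<Sum>j\<in>UNIV. v $ j * a j) = (\<integral>x. (\<Sum>j\<in>UNIV. v $ j * x $ j) \<partial>G)"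
      using int1 by (simp add: a_def)
    also have "\<dots> = (\<integral>x. v \<bullet> m \<partial>G)"
      using vx by (intro integral_cong_AE) (auto simp: inner_vec_def)
    finally show ?thesis using prob_space by simp
  qed
  have int2: "integrable G (\<lambda>x. (x $ i - a i) * (x $ j - a j))" for i j
  proof (rule Bochner_Integration.integrable_bound)
    let ?k = "(1 + \<bar>a i\<bar>) * (1 + \<bar>a j\<bar>)"
    show "integrable G (\<lambda>x. ?k * exp (2 * norm x))" using exp_int by simp
    show "AE x in G. norm ((x $ i - a i) * (x $ j - a j)) \<le> norm (?k * exp (2 * norm x))"
    proof (rule AE_I2)
      fix x :: "real^'d"
      have 1: "\<bar>x $ i - a i\<bar> \<le> (1 + \<bar>a i\<bar>) * exp (norm x)" for i
      proof -
        have "\<bar>a i\<bar> * 1 \<le> \<bar>a i\<bar> * exp (norm x)" by (intro mult_left_mono) auto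
        then show ?thesis using comp[of x i] by (simp add: algebra_simps abs_le_iff)
      qed
      have "\<bar>x $ i - a i\<bar> * \<bar>x $ j - a j\<bar> \<le> ((1 + \<bar>a i\<bar>) * exp (norm x)) * ((1 + \<bar>a j\<bar>) * exp (norm x))"
        by (intro mult_mono 1) auto
      also have "\<dots> = ?k * exp (2 * norm x)" by (simp add: mult_exp_exp ac_simps)
      finally show "norm ((x $ i - a i) * (x $ j - a j)) \<le> norm (?k * exp (2 * norm x))"
        by (simp add: abs_mult)
    qed
  qed simp
  have "covariance_matrix G *v v = 0"
  proof (subst vec_eq_iff, rule allI)
    fix i
    have "(covariance_matrix G *v v) $ i = (\<Sum>j\<in>UNIV. (\<integral>x. (x $ i - a i) * (x $ j - a j) \<partial>G) * v $ j)"
      by (simp add: matrix_vector_mult_def covariance_matrix_def a_def)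
    also have "\<dots> = (\<integral>x. (\<Sum>j\<in>UNIV. (x $ i - a i) * (x $ j - a j) * v $ j) \<partial>G)"
      using int2 by simp
    also have "\<dots> = (\<integral>x. 0 \<partial>G)"
    proof (rule integral_cong_AE)
      show "AE x in G. (\<Sum>j\<in>UNIV. (x $ i - a i) * (x $ j - a j) * v $ j) = 0"
        using vx
      proof eventually_elim
        case (elim x)
        have "(\<Sum>j\<in>UNIV. (x $ i - a i) * (x $ j - a j) * v $ j)
           = (x $ i - a i) * (v \<bullet> x - (\<Sum>j\<in>UNIV. v $ j * a j))"
          by (simp add: inner_vec_def sum_distrib_left sum_subtractf sum.distrib algebra_simps)
        then show ?case using elim va by simp
      qed
    qed auto
    finally show "(covariance_matrix G *v v) $ i = 0 $ i" by simp
  qed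
  then show False
    using nd v(1) unfolding nondegenerate_def
    by (metis invertible_def matrix_left_invertible_ker)
qed

lemma locally_bounded_on_cball:
  fixes f :: "real^'d \<Rightarrow> real^'d"
  assumes "locally_bounded f"
  shows "\<exists>b\<ge>0. \<forall>x. norm x \<le> R \<longrightarrow> norm (f x) \<le> b"
proof -
  obtain U where U: "\<And>x. open (U x)" "\<And>x. x \<in> U x" "\<And>x. bounded (f ` U x)"
    using assms unfolding locally_bounded_def by metis
  obtain X where X: "finite X" "cball 0 R \<subseteq> (\<Union>x\<in>X. U x)"
    using compactE_image[OF compact_cball[of 0 R], of "cball 0 R" U] U(1,2) by (metis UN_I subsetI)
  have "bounded (\<Union>x\<in>X. f ` U x)" using X(1) U(3) by (intro bounded_UN) auto
  then obtain b where b: "\<And>y. y \<in> (\<Union>x\<in>X. f ` U x) \<Longrightarrow> norm y \<le> b" unfolding bounded_iff by blast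
  have "norm (f x) \<le> max b 0" if "norm x \<le> R" for x
  proof -
    have "x \<in> cball 0 R" using that by simp
    then obtain y where "y \<in> X" "x \<in> U y" using X(2) by blast
    then have "f x \<in> (\<Union>x\<in>X. f ` U x)" by blast
    from b[OF this] show ?thesis by simp
  qed
  then show ?thesis by (intro exI[of _ "max b 0"]) auto
qed

section \<open>The Gaussian transition kernel\<close>

locale gaussian_kernel =
  fixes D :: "(real^'d) set" and f :: "real^'d \<Rightarrow> real^'d" and m :: "real^'d" and A A' :: "real^'d^'d"
  assumes D_borel [measurable]: "D \<in> sets borel"
    and D_positive: "0 < emeasure lborel D"
    and f_measurable [measurable]: "f \<in> borel_measurable borel"
    and f_locally_bounded: "locally_bounded f"
    and f_limit: "filterlim (\<lambda>x. norm x - norm (f x)) at_top at_infinity"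
    and A_inv: "A ** A' = mat 1" "A' ** A = mat 1"
begin

text \<open>
  The image of Lebesgue measure under \<open>A\<close>, that is, Lebesgue measure up to the factor \<open>1 / |det A|\<close>.
  With respect to it the noise has the density of a shifted standard normal vector in the coordinate
  \<open>A' y\<close>.
\<close>
definition \<Lambda> :: "(real^'d) measure" where
  "\<Lambda> = distr lborel borel (\<lambda>z. A *v z)"

definition \<rho> :: "(real^'d) measure" where
  "\<rho> = restrict_space \<Lambda> D"

definition p :: "real^'d \<Rightarrow> real^'d \<Rightarrow> real" where
  "p x y = std_density (A' *v (y - f x - m))"

lemma inv_mult [simp]: "A *v (A' *v z) = z" "A' *v (A *v z) = z"
  by (simp_all add: matrix_vector_mul_assoc A_inv)

lemma sets_\<Lambda> [measurable_cong, simp]: "sets \<Lambda> = sets borel" and space_\<Lambda> [simp]: "space \<Lambda> = UNIV"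
  by (simp_all add: \<Lambda>_def)

lemma sets_\<rho> [measurable_cong]: "sets \<rho> = sets (restrict_space borel D)"
  by (simp add: \<rho>_def sets_restrict_space)

lemma space_\<rho> [simp]: "space \<rho> = D"
  by (simp add: \<rho>_def space_restrict_space)

lemma p_measurable: "(\<lambda>(x, y). p x y) \<in> borel_measurable (borel \<Otimes>\<^sub>M borel)"
  unfolding p_def split_beta' by measurable

text \<open>Translation invariance of Lebesgue measure in the coordinate \<open>z\<close> moves \<open>f x + m\<close> into the density.\<close>
lemma nn_integral_step:
  assumes [measurable]: "F \<in> borel_measurable borel"
  shows "(\<integral>\<^sup>+z. F (f x + (m + A *v z)) * ennreal (std_density z) \<partial>lborel)
     = (\<integral>\<^sup>+y. F y * ennreal (p x y) \<partial>\<Lambda>)"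
proof -
  define w where "w = - (A' *v (f x + m))"
  have "(\<integral>\<^sup>+z. F (f x + (m + A *v z)) * ennreal (std_density z) \<partial>lborel)
     = (\<integral>\<^sup>+z. F (f x + (m + A *v z)) * ennreal (std_density z) \<partial>distr lborel borel ((+) w))"
    by (simp add: lborel_distr_plus)
  also have "\<dots> = (\<integral>\<^sup>+z. F (f x + (m + A *v (w + z))) * ennreal (std_density (w + z)) \<partial>lborel)"
    by (rule nn_integral_distr) measurable
  also have "\<dots> = (\<integral>\<^sup>+z. F (A *v z) * ennreal (p x (A *v z)) \<partial>lborel)"
  proof (intro nn_integral_cong)
    fix z
    have "A *v w = - (A *v (A' *v (f x + m)))"
      unfolding w_def by (rule linear_neg[OF matrix_vector_mul_linear])
    then have 1: "f x + (m + A *v (w + z)) = A *v z"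
      by (simp only: inv_mult matrix_vector_right_distrib) simp
    have "A' *v (A *v z - f x - m) = A' *v (A *v z) - A' *v (f x + m)"
      by (simp only: diff_diff_eq matrix_vector_mult_diff_distrib)
    then have "A' *v (A *v z - f x - m) = w + z"
      by (simp add: w_def)
    with 1 show "F (f x + (m + A *v (w + z))) * ennreal (std_density (w + z)) = F (A *v z) * ennreal (p x (A *v z))"
      by (simp add: p_def)
  qed
  also have "\<dots> = (\<integral>\<^sup>+y. F y * ennreal (p x y) \<partial>\<Lambda>)"
    unfolding \<Lambda>_def p_def by (rule nn_integral_distr[symmetric]) measurable
  finally show ?thesis .
qed

lemma nn_integral_\<rho>:
  "(\<integral>\<^sup>+y. F y \<partial>\<rho>) = (\<integral>\<^sup>+y. F y * indicator D y \<partial>\<Lambda>)"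
  unfolding \<rho>_def by (rule nn_integral_restrict_space) simp

lemma nn_integral_step_D:
  assumes [measurable]: "F \<in> borel_measurable borel"
  shows "(\<integral>\<^sup>+y. ennreal (p x y) * F y \<partial>\<rho>)
    = (\<integral>\<^sup>+z. F (f x + (m + A *v z)) * indicator D (f x + (m + A *v z)) * ennreal (std_density z) \<partial>lborel)"
  unfolding nn_integral_\<rho> by (subst nn_integral_step) (auto intro!: nn_integral_cong simp: ac_simps)

lemma norm_A'_le: "\<exists>k>0. \<forall>z. norm (A' *v z) \<le> k * norm z"
  by (rule matrix_vector_norm_bound)

lemma \<Lambda>_bounded_finite:
  assumes S: "S \<in> sets borel" "bounded S"
  shows "emeasure \<Lambda> S < \<infinity>"
proof -
  obtain k where k: "k > 0" "\<And>z. norm (A' *v z) \<le> k * norm z" using norm_A'_le by auto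
  obtain b where b: "\<And>y. y \<in> S \<Longrightarrow> norm y \<le> b" using S(2) by (auto simp: bounded_iff)
  have "norm z \<le> k * b" if "A *v z \<in> S" for z
  proof -
    have "norm z \<le> k * norm (A *v z)" using k(2)[of "A *v z"] by simp
    also have "\<dots> \<le> k * b" using k(1) by (intro mult_left_mono b that) simp
    finally show ?thesis .
  qed
  then have "bounded ((\<lambda>z. A *v z) -` S)" by (auto simp: bounded_iff)
  then have "emeasure lborel ((\<lambda>z. A *v z) -` S) < \<infinity>" by (rule emeasure_bounded_finite)
  then show ?thesis unfolding \<Lambda>_def using S(1) by (simp add: emeasure_distr)
qed

lemma \<Lambda>_D_pos: "0 < emeasure \<Lambda> D"
proof (rule ccontr)
  let ?S = "(\<lambda>z. A *v z) -` D"
  have S: "?S \<in> sets borel"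
    using measurable_sets[OF matrix_vector_measurable D_borel, of A] by simp
  assume "\<not> ?thesis"
  then have "emeasure lborel ?S = 0" by (simp add: \<Lambda>_def emeasure_distr)
  then have "negligible ?S"
    using S by (simp add: negligible_iff_emeasure0 emeasure_completion)
  then have "negligible ((\<lambda>z. A *v z) ` ?S)"
    by (intro negligible_differentiable_image_negligible linear_imp_differentiable_on) auto
  also have "(\<lambda>z. A *v z) ` ?S = D"
    by (intro surj_image_vimage_eq surjI[of _ "\<lambda>z. A' *v z"]) simp
  finally have "emeasure lborel D = 0"
    by (simp add: negligible_iff_emeasure0 emeasure_completion)
  then show False using D_positive by simp
qed

definition r0 :: nat where
  "r0 = (SOME n. 0 < emeasure \<Lambda> (D \<inter> cball 0 (real n)))"

lemma r0: "0 < emeasure \<Lambda> (D \<inter> cball 0 (real r0))"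
  unfolding r0_def
proof (rule someI_ex, rule ccontr)
  assume "\<nexists>n. 0 < emeasure \<Lambda> (D \<inter> cball 0 (real n))"
  then have "D \<inter> cball 0 (real n) \<in> null_sets \<Lambda>" for n by (auto intro!: null_setsI)
  then have "(\<Union>n. D \<inter> cball 0 (real n)) \<in> null_sets \<Lambda>" by (rule null_sets_UN)
  also have "(\<Union>n. D \<inter> cball 0 (real n)) = D"
    by (auto simp: real_arch_simple)
  finally show False using \<Lambda>_D_pos by auto
qed

definition B :: "nat \<Rightarrow> (real^'d) set" where
  "B n = D \<inter> cball 0 (real (r0 + n))"

lemma exp_moment_tail:
  assumes "0 < e"
  shows "\<exists>N. (\<integral>\<^sup>+z. indicator {z. real N < norm (m + A *v z)} z *
            ennreal (exp (norm (m + A *v z)) * std_density z) \<partial>lborel) \<le> ennreal e"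
proof -
  let ?g = "\<lambda>z. ennreal (exp (norm (m + A *v z)) * std_density z)"
  let ?T = "\<lambda>N z. indicator {z. real N < norm (m + A *v z)} z * ?g z"
  have "(\<lambda>N. \<integral>\<^sup>+z. ?T N z \<partial>lborel) \<longlonglongrightarrow> (\<integral>\<^sup>+z. 0 \<partial>(lborel :: (real^'d) measure))"
  proof (rule nn_integral_dominated_convergence[where w = ?g])
    show "(\<integral>\<^sup>+z. ?g z \<partial>lborel) < \<infinity>" using affine_exp_moment_finite[of 1 m A] by simp
    show "AE z in lborel. (\<lambda>N. ?T N z) \<longlonglongrightarrow> 0"
    proof (rule AE_I2)
      fix z :: "real^'d"
      obtain k :: nat where k: "norm (m + A *v z) \<le> real k" using real_arch_simple by blast
      have "\<forall>\<^sub>F N in sequentially. ?T N z = 0"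
        using eventually_ge_at_top[of k] by eventually_elim (use k in \<open>auto simp: indicator_def\<close>)
      then show "(\<lambda>N. ?T N z) \<longlonglongrightarrow> 0" by (rule tendsto_eventually)
    qed
    show "AE z in lborel. ?T N z \<le> ?g z" for N by (auto simp: indicator_def)
  qed measurable
  then have "\<forall>\<^sub>F N in sequentially. (\<integral>\<^sup>+z. ?T N z \<partial>lborel) < ennreal e"
    using assms by (intro order_tendstoD(2)) auto
  then show ?thesis by (auto simp: eventually_sequentially intro: less_imp_le)
qed

lemma phi1_measurable [measurable]: "phi1 \<in> borel_measurable borel"
  unfolding phi1_def by measurable

lemma step_phi1_le:
  assumes [measurable]: "S \<in> sets borel" "S' \<in> sets borel"
    and S': "\<And>z. f x + (m + A *v z) \<in> S \<Longrightarrow> z \<in> S'"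
  shows "(\<integral>\<^sup>+y. ennreal (p x y) * (ennreal (phi1 y) * indicator S y) \<partial>\<rho>)
    \<le> ennreal (exp (norm (f x))) * (\<integral>\<^sup>+z. indicator S' z * ennreal (exp (norm (m + A *v z)) * std_density z) \<partial>lborel)"
proof -
  have phi1_indicator: "(\<lambda>y. ennreal (phi1 y) * indicator S y) \<in> borel_measurable borel" by measurable
  have "(\<integral>\<^sup>+y. ennreal (p x y) * (ennreal (phi1 y) * indicator S y) \<partial>\<rho>)
    \<le> (\<integral>\<^sup>+z. ennreal (exp (norm (f x))) * (indicator S' z * ennreal (exp (norm (m + A *v z)) * std_density z)) \<partial>lborel)"
    unfolding nn_integral_step_D[OF phi1_indicator]
  proof (rule nn_integral_mono)
    fix z :: "real^'d"
    let ?y = "f x + (m + A *v z)"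
    have "phi1 ?y \<le> exp (norm (f x)) * exp (norm (m + A *v z))"
      unfolding phi1_def mult_exp_exp using norm_triangle_ineq[of "f x"] by simp
    then have "phi1 ?y * std_density z \<le> exp (norm (f x)) * exp (norm (m + A *v z)) * std_density z"
      by (intro mult_right_mono std_density_nonneg)
    then have "ennreal (phi1 ?y * std_density z) \<le> ennreal (exp (norm (f x)) * (exp (norm (m + A *v z)) * std_density z))"
      by (intro ennreal_leI) (simp only: mult.assoc)
    then have 1: "ennreal (phi1 ?y) * ennreal (std_density z)
        \<le> ennreal (exp (norm (f x))) * ennreal (exp (norm (m + A *v z)) * std_density z)"
      by (subst (1 2) ennreal_mult[symmetric]) (auto simp: phi1_def std_density_nonneg)
    have "ennreal (phi1 ?y) * indicator S ?y * indicator D ?y * ennreal (std_density z)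
       \<le> indicator S' z * (ennreal (phi1 ?y) * ennreal (std_density z))"
      using S'[of z] by (auto simp: indicator_def)
    also have "\<dots> \<le> indicator S' z * (ennreal (exp (norm (f x))) * ennreal (exp (norm (m + A *v z)) * std_density z))"
      by (intro mult_left_mono 1) auto
    also have "\<dots> = ennreal (exp (norm (f x))) * (indicator S' z * ennreal (exp (norm (m + A *v z)) * std_density z))"
      by (rule mult.left_commute)
    finally show "ennreal (phi1 ?y) * indicator S ?y * indicator D ?y * ennreal (std_density z)
      \<le> ennreal (exp (norm (f x))) * (indicator S' z * ennreal (exp (norm (m + A *v z)) * std_density z))" .
  qed
  also have "\<dots> = ennreal (exp (norm (f x))) * (\<integral>\<^sup>+z. indicator S' z * ennreal (exp (norm (m + A *v z)) * std_density z) \<partial>lborel)"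
    by (rule nn_integral_cmult) measurable
  finally show ?thesis .
qed

lemma p_nonneg: "0 \<le> p x y" and p_le_1: "p x y \<le> 1"
  by (simp_all add: p_def std_density_nonneg std_density_le_1)

lemma p_measurable_\<rho> [measurable]: "p x \<in> borel_measurable \<rho>"
proof -
  have "p x \<in> borel_measurable borel" unfolding p_def by measurable
  then show ?thesis unfolding \<rho>_def by (intro measurable_restrict_space1) simp
qed

lemma phi1_measurable_\<rho> [measurable]: "phi1 \<in> borel_measurable \<rho>"
  unfolding \<rho>_def by (intro measurable_restrict_space1) simp

lemma B_sets [measurable]: "B n \<in> sets borel"
  unfolding B_def by simp

lemma B_sets_\<rho> [measurable]: "B n \<in> sets \<rho>"
  unfolding \<rho>_def by (subst sets_restrict_space_iff) (auto simp: B_def)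

lemma emeasure_\<rho>: "S \<in> sets borel \<Longrightarrow> S \<subseteq> D \<Longrightarrow> emeasure \<rho> S = emeasure \<Lambda> S"
  unfolding \<rho>_def by (subst emeasure_restrict_space) auto

definition moment :: real where
  "moment = enn2real (\<integral>\<^sup>+z. ennreal (exp (norm (m + A *v z)) * std_density z) \<partial>lborel)"

lemma moment: "(\<integral>\<^sup>+z. ennreal (exp (norm (m + A *v z)) * std_density z) \<partial>lborel) = ennreal moment"
  and moment_nonneg: "0 \<le> moment"
  using affine_exp_moment_finite[of 1 m A] by (simp_all add: moment_def)

lemma step_phi1: "(\<integral>\<^sup>+y. ennreal (p x y * phi1 y) \<partial>\<rho>) \<le> ennreal (exp (norm (f x)) * moment)"
proof -
  have "(\<integral>\<^sup>+y. ennreal (p x y * phi1 y) \<partial>\<rho>) = (\<integral>\<^sup>+y. ennreal (p x y) * (ennreal (phi1 y) * indicator UNIV y) \<partial>\<rho>)"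
    by (simp add: ennreal_mult' p_nonneg)
  also have "\<dots> \<le> ennreal (exp (norm (f x))) * (\<integral>\<^sup>+z. indicator UNIV z *
      ennreal (exp (norm (m + A *v z)) * std_density z) \<partial>lborel)"
    by (rule step_phi1_le) auto
  also have "\<dots> = ennreal (exp (norm (f x)) * moment)"
    using moment by (simp only: indicator_UNIV mult_1 ennreal_mult[OF exp_ge_zero moment_nonneg])
  finally show ?thesis .
qed

text \<open>
  Everything rests on \<open>P V x \<le> e^|f x| E e^|\<xi>|\<close>. Relative to \<open>V x = e^|x|\<close> this is small where
  \<open>|x| - |f x|\<close> is large, which gives the drift and also the tail for large \<open>|x|\<close>. For bounded \<open>|x|\<close> the
  map \<open>f\<close> is bounded, hence only large noise leads far away, and its exponential moment is small.
\<close>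
lemma lyapunov_kernel_gaussian: "\<exists>CV. lyapunov_kernel \<rho> p phi1 B 1 CV"
proof -
  have f_far: "\<exists>R. \<forall>x. R \<le> norm x \<longrightarrow> c \<le> norm x - norm (f x)" for c
  proof -
    have "\<forall>\<^sub>F x in at_infinity. c \<le> norm x - norm (f x)"
      using f_limit by (simp add: filterlim_at_top)
    then show ?thesis by (simp add: eventually_at_infinity)
  qed
  note f_near = locally_bounded_on_cball[OF f_locally_bounded]
  obtain R where R: "\<And>x. R \<le> norm x \<Longrightarrow> 0 \<le> norm x - norm (f x)" using f_far[of 0] by auto
  obtain b where b: "b \<ge> 0" "\<And>x. norm x \<le> R \<Longrightarrow> norm (f x) \<le> b" using f_near[of R] by auto
  have fb: "norm (f x) \<le> norm x + b" for x
    using R[of x] b(1) b(2)[of x] norm_ge_zero[of x] by linarith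
  have "lyapunov_kernel \<rho> p phi1 B 1 (exp b * moment)"
  proof
    show "case_prod p \<in> borel_measurable (\<rho> \<Otimes>\<^sub>M \<rho>)"
    proof -
      have "(\<lambda>x. x) \<in> measurable \<rho> borel"
        unfolding \<rho>_def by (intro measurable_restrict_space1) simp
      then have "(\<lambda>z. (fst z, snd z)) \<in> measurable (\<rho> \<Otimes>\<^sub>M \<rho>) (borel \<Otimes>\<^sub>M borel)"
        by (intro measurable_Pair measurable_compose[OF measurable_fst] measurable_compose[OF measurable_snd])
      from measurable_compose[OF this p_measurable] show ?thesis by (simp add: split_beta')
    qed
    show "0 \<le> p x y" "p x y \<le> 1" for x y by (rule p_nonneg p_le_1)+
    show "1 \<le> phi1 x" for x :: "real^'d" by (simp add: phi1_def)
    show "B n \<in> sets \<rho>" for n by measurable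
    show "(\<Union>n. B n) = space \<rho>"
    proof -
      have "x \<in> (\<Union>n. B n)" if "x \<in> D" for x
      proof -
        obtain k :: nat where "norm x \<le> real k" using real_arch_simple by blast
        then have "x \<in> B k" using that by (simp add: B_def)
        then show ?thesis by blast
      qed
      then show ?thesis by (auto simp: B_def)
    qed
    show fin: "emeasure \<rho> (B n) < \<infinity>" for n
      by (subst emeasure_\<rho>) (auto simp: B_def intro!: \<Lambda>_bounded_finite[simplified] bounded_subset[OF bounded_cball])
    have "0 < emeasure \<rho> (B 0)" using r0 by (subst emeasure_\<rho>) (auto simp: B_def)
    then show "0 < measure \<rho> (B 0)"
      using fin[of 0] by (simp add: measure_def enn2real_positive_iff)
    show "\<exists>k>0. \<forall>x\<in>B n. \<forall>y\<in>B j. k \<le> p x y" for n j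
    proof -
      obtain k where k: "k > 0" "\<And>z. norm (A' *v z) \<le> k * norm z" using norm_A'_le by auto
      define r where "r = k * (real (r0 + j) + (real (r0 + n) + b) + norm m)"
      have "std_normal_density r ^ CARD('d) \<le> p x y" if "x \<in> B n" "y \<in> B j" for x y
        unfolding p_def
      proof (rule std_density_lower)
        have "norm (y - f x - m) \<le> norm y + norm (f x) + norm m"
          using norm_triangle_ineq4[of y "f x"] norm_triangle_ineq4[of "y - f x" m] by linarith
        also have "\<dots> \<le> real (r0 + j) + (real (r0 + n) + b) + norm m"
          using that fb[of x] by (auto simp: B_def)
        finally have "k * norm (y - f x - m) \<le> r"
          unfolding r_def using k(1) by (intro mult_left_mono) auto
        then show "norm (A' *v (y - f x - m)) \<le> r" using k(2)[of "y - f x - m"] by linarith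
      qed
      moreover have "0 < std_normal_density r ^ CARD('d)"
        by (intro zero_less_power normal_density_pos) simp
      ultimately show ?thesis by blast
    qed
    show "\<exists>c. \<forall>x\<in>B n. phi1 x \<le> c" for n
      by (intro exI[of _ "exp (real (r0 + n))"]) (auto simp: B_def phi1_def)
    show "phi1 \<in> borel_measurable \<rho>" by measurable
    show pint: "integrable \<rho> (\<lambda>y. p x y * phi1 y)" for x
    proof (rule integrableI_nonneg)
      show "(\<integral>\<^sup>+y. ennreal (p x y * phi1 y) \<partial>\<rho>) < \<infinity>"
        using step_phi1[of x] by (simp add: order.strict_trans1)
      show "(\<lambda>y. p x y * phi1 y) \<in> borel_measurable \<rho>" by measurable
      show "AE y in \<rho>. 0 \<le> p x y * phi1 y" by (simp add: p_nonneg phi1_def)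
    qed
    have step: "(\<integral>y. p x y * phi1 y \<partial>\<rho>) \<le> exp (norm (f x)) * moment" for x
      by (rule integral_real_bounded[OF _ step_phi1]) (simp add: moment_nonneg)
    show "(\<integral>y. p x y * phi1 y \<partial>\<rho>) \<le> exp b * moment * phi1 x" for x
    proof -
      have "exp (norm (f x)) \<le> exp b * exp (norm x)"
        using fb[of x] by (simp add: mult_exp_exp)
      then have "exp (norm (f x)) * moment \<le> exp b * exp (norm x) * moment"
        by (intro mult_right_mono moment_nonneg)
      then show ?thesis using step[of x] by (simp add: phi1_def ac_simps)
    qed
    fix e :: real assume e: "0 < e"
    obtain L where L: "\<And>x. L \<le> norm x \<Longrightarrow> ln ((moment + 1) / e) \<le> norm x - norm (f x)"
      \<comment> \<open>The added \<open>1\<close> keeps the logarithm meaningful without knowing that the moment is positive.\<close>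
      using f_far by metis
    have far: "(\<integral>y. p x y * phi1 y \<partial>\<rho>) \<le> e * phi1 x" if "L \<le> norm x" for x
    proof -
      have "(moment + 1) / e = exp (ln ((moment + 1) / e))"
        using moment_nonneg e by simp
      also have "\<dots> \<le> exp (norm x - norm (f x))" using L[OF that] by simp
      finally have "exp (norm (f x)) * (moment + 1) \<le> e * exp (norm x)"
        using e by (simp add: exp_diff field_simps)
      moreover have "exp (norm (f x)) * moment \<le> exp (norm (f x)) * (moment + 1)" by simp
      ultimately show ?thesis using step[of x] unfolding phi1_def by linarith
    qed
    obtain n :: nat where n: "L \<le> real n" using real_arch_simple by blast
    show "\<exists>n. \<forall>x\<in>space \<rho> - B n. (\<integral>y. p x y * phi1 y \<partial>\<rho>) \<le> e * phi1 x"
    proof (intro exI[of _ n] ballI far)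
      fix x assume "x \<in> space \<rho> - B n"
      then show "L \<le> norm x" using n by (auto simp: B_def)
    qed
    obtain c where c: "c \<ge> 0" "\<And>x. norm x \<le> L \<Longrightarrow> norm (f x) \<le> c" using f_near[of L] by auto
    obtain N where N: "(\<integral>\<^sup>+z. indicator {z. real N < norm (m + A *v z)} z *
            ennreal (exp (norm (m + A *v z)) * std_density z) \<partial>lborel) \<le> ennreal (e / exp c)"
      using exp_moment_tail[of "e / exp c"] e by auto
    obtain k :: nat where k: "real N + c \<le> real k" using real_arch_simple by blast
    show "\<exists>n. \<forall>x\<in>space \<rho>. (\<integral>y. indicator (- B n) y * (p x y * phi1 y) \<partial>\<rho>) \<le> e * phi1 x"
    proof (intro exI[of _ k] ballI)
      fix x assume "x \<in> space \<rho>"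
      show "(\<integral>y. indicator (- B k) y * (p x y * phi1 y) \<partial>\<rho>) \<le> e * phi1 x"
      proof (cases "L \<le> norm x")
        case True
        have "(\<integral>y. indicator (- B k) y * (p x y * phi1 y) \<partial>\<rho>) \<le> (\<integral>y. p x y * phi1 y \<partial>\<rho>)"
        proof (rule integral_mono_AE'[OF pint])
          show "AE y in \<rho>. indicator (- B k) y * (p x y * phi1 y) \<le> p x y * phi1 y"
            "AE y in \<rho>. 0 \<le> p x y * phi1 y"
            by (simp_all add: indicator_def phi1_def p_nonneg)
        qed
        with far[OF True] show ?thesis by linarith
      next
        case False
        then have fc: "norm (f x) \<le> c" using c(2)[of x] by simp
        let ?S = "{y :: real^'d. real k < norm y}"
        let ?S' = "{z. real N < norm (m + A *v z)}"
        have S': "z \<in> ?S'" if "f x + (m + A *v z) \<in> ?S" for z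
          using that fc k norm_triangle_ineq[of "f x" "m + A *v z"] by simp
        have "(\<integral>\<^sup>+y. ennreal (indicator (- B k) y * (p x y * phi1 y)) \<partial>\<rho>)
          \<le> (\<integral>\<^sup>+y. ennreal (p x y) * (ennreal (phi1 y) * indicator ?S y) \<partial>\<rho>)"
        proof (rule nn_integral_mono)
          fix y assume "y \<in> space \<rho>"
          then have "y \<in> ?S" if "y \<notin> B k" using that by (auto simp: B_def)
          then show "ennreal (indicator (- B k) y * (p x y * phi1 y)) \<le> ennreal (p x y) * (ennreal (phi1 y) * indicator ?S y)"
            by (cases "y \<in> B k") (simp_all add: ennreal_mult' p_nonneg)
        qed
        also have "\<dots> \<le> ennreal (exp (norm (f x))) * (\<integral>\<^sup>+z. indicator ?S' z *
            ennreal (exp (norm (m + A *v z)) * std_density z) \<partial>lborel)"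
        proof (rule step_phi1_le)
          show "?S \<in> sets borel" "?S' \<in> sets borel" by measurable
        qed (rule S')
        also have "\<dots> \<le> ennreal (exp (norm (f x))) * ennreal (e / exp c)"
          by (intro mult_left_mono N) simp
        also have "\<dots> = ennreal (exp (norm (f x)) * (e / exp c))"
          using e by (intro ennreal_mult[symmetric]) auto
        also have "exp (norm (f x)) * (e / exp c) \<le> exp c * (e / exp c)"
          using e fc by (intro mult_right_mono) auto
        then have "ennreal (exp (norm (f x)) * (e / exp c)) \<le> ennreal e"
          by (intro ennreal_leI) simp
        finally have "(\<integral>y. indicator (- B k) y * (p x y * phi1 y) \<partial>\<rho>) \<le> e"
          by (intro integral_real_bounded less_imp_le[OF e])
        also have "e * 1 \<le> e * phi1 x" using e by (intro mult_left_mono) (auto simp: phi1_def)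
        finally show ?thesis by simp
      qed
    qed
  qed
  then show ?thesis ..
qed

end

section \<open>The law of the killed chain\<close>

text \<open>Independence in the form of Fubini: the two variables may be driven by separate copies of \<open>\<omega>\<close>.\<close>
lemma (in prob_space) nn_integral_indep_var:
  assumes indep: "indep_var S X T Z" and [measurable]: "g \<in> borel_measurable (S \<Otimes>\<^sub>M T)"
  shows "(\<integral>\<^sup>+\<omega>. g (X \<omega>, Z \<omega>) \<partial>M) = (\<integral>\<^sup>+\<omega>. (\<integral>\<^sup>+\<omega>'. g (X \<omega>, Z \<omega>') \<partial>M) \<partial>M)"
proof -
  have [measurable]: "random_variable S X" "random_variable T Z"
    using indep indep_var_distribution_eq by blast+
  have eq: "distr M S X \<Otimes>\<^sub>M distr M T Z = distr M (S \<Otimes>\<^sub>M T) (\<lambda>\<omega>. (X \<omega>, Z \<omega>))"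
    using indep indep_var_distribution_eq by blast
  interpret Z: prob_space "distr M T Z" by (rule prob_space_distr) measurable
  have "(\<integral>\<^sup>+\<omega>. g (X \<omega>, Z \<omega>) \<partial>M) = (\<integral>\<^sup>+q. g q \<partial>(distr M S X \<Otimes>\<^sub>M distr M T Z))"
    unfolding eq by (simp add: nn_integral_distr)
  also have "\<dots> = (\<integral>\<^sup>+s. (\<integral>\<^sup>+z. g (s, z) \<partial>distr M T Z) \<partial>distr M S X)"
    by (rule Z.nn_integral_fst[symmetric]) (simp cong: measurable_cong_sets)
  also have "\<dots> = (\<integral>\<^sup>+\<omega>. (\<integral>\<^sup>+z. g (X \<omega>, z) \<partial>distr M T Z) \<partial>M)"
    by (rule nn_integral_distr) measurable
  also have "\<dots> = (\<integral>\<^sup>+\<omega>. (\<integral>\<^sup>+\<omega>'. g (X \<omega>, Z \<omega>') \<partial>M) \<partial>M)"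
    by (intro nn_integral_cong nn_integral_distr) (auto intro: measurable_compose[OF measurable_Pair1'] dest: measurable_space[of X M S])
  finally show ?thesis .
qed

text \<open>
  The recursion without killing, which takes values in a vector space and is measurable for simple
  reasons. The chain is recovered by recording whether the path has stayed in \<open>D\<close>; the initial point
  is not tested.
\<close>
primrec free_chain ::
  "(real^'d \<Rightarrow> real^'d) \<Rightarrow> (nat \<Rightarrow> 'w \<Rightarrow> real^'d) \<Rightarrow> nat \<Rightarrow> (real^'d) \<times> 'w \<Rightarrow> real^'d" where
  "free_chain f \<xi> 0 q = fst q"
| "free_chain f \<xi> (Suc n) q = f (free_chain f \<xi> n q) + \<xi> n (snd q)"

definition alive ::
  "(real^'d) set \<Rightarrow> (real^'d \<Rightarrow> real^'d) \<Rightarrow> (nat \<Rightarrow> 'w \<Rightarrow> real^'d) \<Rightarrow> nat \<Rightarrow> (real^'d) \<times> 'w \<Rightarrow> bool" where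
  "alive D f \<xi> n q \<longleftrightarrow> (\<forall>k<n. free_chain f \<xi> (Suc k) q \<in> D)"

lemma alive_Suc: "alive D f \<xi> (Suc n) q \<longleftrightarrow> alive D f \<xi> n q \<and> free_chain f \<xi> (Suc n) q \<in> D"
  by (auto simp: alive_def less_Suc_eq)

lemma chain_eq_free_chain:
  "chain D f \<xi> n q = (if alive D f \<xi> n q then Some (free_chain f \<xi> n q) else None)"
proof (induction n)
  case 0
  then show ?case by (simp add: alive_def)
next
  case (Suc n)
  then show ?case by (auto simp: alive_Suc)
qed

lemma less_absorption_time_iff: "enat n < absorption_time D f \<xi> q \<longleftrightarrow> alive D f \<xi> n q"
proof
  assume "enat n < absorption_time D f \<xi> q"
  then have "n \<notin> {n. chain D f \<xi> n q = None}"
    unfolding absorption_time_def by (metis INF_lower linorder_not_less)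
  then show "alive D f \<xi> n q" by (auto simp: chain_eq_free_chain split: if_splits)
next
  assume *: "alive D f \<xi> n q"
  have "enat (Suc n) \<le> absorption_time D f \<xi> q"
    unfolding absorption_time_def
  proof (rule INF_greatest)
    fix k assume "k \<in> {n. chain D f \<xi> n q = None}"
    then have "\<not> alive D f \<xi> k q" by (auto simp: chain_eq_free_chain split: if_splits)
    then have "n < k" using * by (metis alive_def less_le_trans not_le)
    then show "enat (Suc n) \<le> enat k" by simp
  qed
  then show "enat n < absorption_time D f \<xi> q" by (simp add: Suc_ile_eq)
qed

definition killed_step ::
  "(real^'d) set \<Rightarrow> (real^'d \<Rightarrow> real^'d) \<Rightarrow> (real^'d) measure \<Rightarrow> (real^'d \<Rightarrow> ennreal) \<Rightarrow> real^'d \<Rightarrow> ennreal" where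
  "killed_step D f G F x = (\<integral>\<^sup>+z. F (f x + z) * indicator D (f x + z) \<partial>G)"

locale killed_chain = prob_space M for M :: "'w measure" +
  fixes D :: "(real^'d) set" and f :: "real^'d \<Rightarrow> real^'d" and \<xi> :: "nat \<Rightarrow> 'w \<Rightarrow> real^'d"
    and G :: "(real^'d) measure"
  assumes D_borel [measurable]: "D \<in> sets borel"
    and D_nonempty: "D \<noteq> {}"
    and f_borel [measurable]: "f \<in> borel_measurable borel"
    and indep: "indep_vars (\<lambda>_. borel) \<xi> UNIV"
    and law: "\<And>n. distr M borel (\<xi> n) = G"
begin

abbreviation "step \<equiv> killed_step D f G"

lemma \<xi>_measurable [measurable]: "\<xi> n \<in> borel_measurable M"
  using indep by (auto simp: indep_vars_def)

lemma prob_space_G: "prob_space G"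
  using prob_space_distr[OF \<xi>_measurable[of 0]] by (simp add: law)

lemma sets_G [measurable_cong, simp]: "sets G = sets borel"
  using law[of 0] by (metis sets_distr)

lemma step_measurable:
  assumes [measurable]: "F \<in> borel_measurable borel"
  shows "step F \<in> borel_measurable borel"
proof -
  interpret G: prob_space G by (rule prob_space_G)
  show ?thesis unfolding killed_step_def by measurable
qed

lemma funpow_step_measurable: "F \<in> borel_measurable borel \<Longrightarrow> (step ^^ n) F \<in> borel_measurable borel"
  by (induction n) (auto intro: step_measurable)

lemma free_chain_measurable:
  assumes "(\<lambda>x. x) \<in> measurable N borel"
  shows "free_chain f \<xi> n \<in> borel_measurable (N \<Otimes>\<^sub>M M)"
proof (induction n)
  case 0
  show ?case using measurable_compose[OF measurable_fst assms] by simp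
next
  case (Suc n)
  note [measurable] = Suc
  show ?case by simp measurable
qed

lemma alive_measurable:
  assumes "(\<lambda>x. x) \<in> measurable N borel"
  shows "Measurable.pred (N \<Otimes>\<^sub>M M) (alive D f \<xi> n)"
proof -
  note [measurable] = free_chain_measurable[OF assms]
  show ?thesis unfolding alive_def by measurable
qed

text \<open>
  The path up to time \<open>n\<close> is a function of \<open>\<xi> 0, \<dots>, \<xi> (n - 1)\<close> and hence independent of \<open>\<xi> n\<close>.
  Averaging over \<open>\<xi> n\<close> first replaces \<open>F\<close> at time \<open>n + 1\<close> by \<open>step F\<close> at time \<open>n\<close>.
\<close>
lemma nn_integral_free_chain:
  assumes "F \<in> borel_measurable borel"
  shows "(\<integral>\<^sup>+\<omega>. F (free_chain f \<xi> n (x, \<omega>)) * indicator {q. alive D f \<xi> n q} (x, \<omega>) \<partial>M) = (step ^^ n) F x"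
  using assms
proof (induction n arbitrary: F)
  case 0
  then show ?case by (simp add: alive_def emeasure_space_1)
next
  case (Suc n)
  note [measurable] = Suc.prems
  interpret G: prob_space G by (rule prob_space_G)
  let ?S = "PiM {..<n} (\<lambda>_. borel :: (real^'d) measure)"
  let ?X = "\<lambda>\<omega>. restrict (\<lambda>i. \<xi> i \<omega>) {..<n}"
  let ?Y = "\<lambda>k s. free_chain f (\<lambda>i s. s i) k (x, s)"
  have Y: "free_chain f \<xi> k (x, \<omega>) = ?Y k (?X \<omega>)" if "k \<le> n" for k \<omega>
    using that by (induction k) auto
  have Y_meas: "?Y k \<in> borel_measurable ?S" if "k \<le> n" for k
    using that
  proof (induction k)
    case (Suc k)
    then have [measurable]: "?Y k \<in> borel_measurable ?S" by simp
    have [measurable]: "(\<lambda>s. s k) \<in> borel_measurable ?S"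
      using Suc.prems by (intro measurable_component_singleton) auto
    show ?case by simp measurable
  qed simp
  let ?T = "PiM {n} (\<lambda>_. borel :: (real^'d) measure)"
  let ?Z = "\<lambda>\<omega>. restrict (\<lambda>i. \<xi> i \<omega>) {n}"
  have indep_n: "indep_var ?S ?X ?T ?Z"
    by (rule indep_var_restrict[OF indep]) auto
  have [measurable]: "(\<lambda>s. s n) \<in> borel_measurable ?T"
    by (rule measurable_component_singleton) simp
  define A where "A s \<longleftrightarrow> (\<forall>k<n. ?Y (Suc k) s \<in> D)" for s
  have A: "alive D f \<xi> n (x, \<omega>) \<longleftrightarrow> A (?X \<omega>)" for \<omega>
    unfolding alive_def A_def using Y by (metis Suc_leI)
  have A_meas [measurable]: "Measurable.pred ?S A"
  proof -
    have "Measurable.pred ?S (\<lambda>s. k < n \<longrightarrow> ?Y (Suc k) s \<in> D)" for k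
    proof (cases "k < n")
      case True
      then have [measurable]: "?Y (Suc k) \<in> borel_measurable ?S" by (intro Y_meas) simp
      show ?thesis by measurable
    qed simp
    then show ?thesis unfolding A_def by measurable
  qed
  note [measurable] = Y_meas[OF order_refl]
  define g where "g = (\<lambda>(s, s'). F (f (?Y n s) + s' n) * indicator D (f (?Y n s) + s' n) * indicator {s. A s} s)"
  have g_meas: "g \<in> borel_measurable (?S \<Otimes>\<^sub>M ?T)"
    unfolding g_def split_beta' by measurable
  have "(\<integral>\<^sup>+\<omega>. F (free_chain f \<xi> (Suc n) (x, \<omega>)) * indicator {q. alive D f \<xi> (Suc n) q} (x, \<omega>) \<partial>M)
      = (\<integral>\<^sup>+\<omega>. g (?X \<omega>, ?Z \<omega>) \<partial>M)"
    by (intro nn_integral_cong) (simp add: g_def alive_Suc A Y[symmetric] indicator_def)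
  also have "\<dots> = (\<integral>\<^sup>+\<omega>. (\<integral>\<^sup>+\<omega>'. g (?X \<omega>, ?Z \<omega>') \<partial>M) \<partial>M)"
    by (rule nn_integral_indep_var[OF indep_n g_meas])
  also have "\<dots> = (\<integral>\<^sup>+\<omega>. step F (free_chain f \<xi> n (x, \<omega>)) * indicator {q. alive D f \<xi> n q} (x, \<omega>) \<partial>M)"
  proof (intro nn_integral_cong)
    fix \<omega>
    let ?y = "free_chain f \<xi> n (x, \<omega>)"
    have "(\<integral>\<^sup>+\<omega>'. g (?X \<omega>, ?Z \<omega>') \<partial>M)
       = (\<integral>\<^sup>+\<omega>'. F (f ?y + \<xi> n \<omega>') * indicator D (f ?y + \<xi> n \<omega>') * indicator {q. alive D f \<xi> n q} (x, \<omega>) \<partial>M)"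
      by (intro nn_integral_cong) (simp add: g_def Y[OF order_refl, symmetric] A[symmetric] indicator_def)
    also have "\<dots> = (\<integral>\<^sup>+\<omega>'. F (f ?y + \<xi> n \<omega>') * indicator D (f ?y + \<xi> n \<omega>') \<partial>M) * indicator {q. alive D f \<xi> n q} (x, \<omega>)"
      by (rule nn_integral_multc) measurable
    also have "(\<integral>\<^sup>+\<omega>'. F (f ?y + \<xi> n \<omega>') * indicator D (f ?y + \<xi> n \<omega>') \<partial>M) = step F ?y"
    proof -
      have "(\<lambda>z. F (f ?y + z) * indicator D (f ?y + z)) \<in> borel_measurable borel" by measurable
      then have "(\<lambda>z. F (f ?y + z) * indicator D (f ?y + z)) \<in> borel_measurable (distr M borel (\<xi> n))"
        by simp
      from nn_integral_distr[OF \<xi>_measurable this] show ?thesis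
        by (simp add: killed_step_def law)
    qed
    finally show "(\<integral>\<^sup>+\<omega>'. g (?X \<omega>, ?Z \<omega>') \<partial>M) = step F ?y * indicator {q. alive D f \<xi> n q} (x, \<omega>)" .
  qed
  also have "\<dots> = (step ^^ Suc n) F x"
    using Suc.IH[OF step_measurable[OF Suc.prems]] by (simp add: funpow_swap1)
  finally show ?case .
qed

lemma step_mono: "(\<And>y. F y \<le> F' y) \<Longrightarrow> step F x \<le> step F' x"
  unfolding killed_step_def by (intro nn_integral_mono mult_right_mono) auto

lemma funpow_step_1_le: "(step ^^ n) (\<lambda>_. 1) x \<le> 1"
proof (induction n arbitrary: x)
  case (Suc n)
  interpret G: prob_space G by (rule prob_space_G)
  have "step ((step ^^ n) (\<lambda>_. 1)) x \<le> step (\<lambda>_. 1) x" by (rule step_mono) (rule Suc)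
  also have "\<dots> \<le> (\<integral>\<^sup>+z. 1 \<partial>G)"
    unfolding killed_step_def by (intro nn_integral_mono) (auto simp: indicator_def)
  finally show ?case by (simp add: G.emeasure_space_1)
qed simp

lemma prob_measure_on_id:
  "prob_measure_on D \<mu> \<Longrightarrow> (\<lambda>x. x) \<in> measurable \<mu> borel"
  unfolding prob_measure_on_def
  by (simp cong: measurable_cong_sets) (rule measurable_restrict_space1, simp)

lemma
  assumes \<mu>: "prob_measure_on D \<mu>" and Z: "(\<integral>\<^sup>+x. (step ^^ n) (\<lambda>_. 1) x \<partial>\<mu>) > 0" (is "?Z > 0")
  shows sets_conditional_law: "sets (conditional_law D f M \<xi> \<mu> n) = sets (restrict_space borel D)"
    and nn_integral_conditional_law: "F \<in> borel_measurable borel \<Longrightarrow>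
      (\<integral>\<^sup>+x. F x \<partial>conditional_law D f M \<xi> \<mu> n) = (\<integral>\<^sup>+x. (step ^^ n) F x \<partial>\<mu>) / ?Z"
proof -
  interpret \<mu>: prob_space \<mu> using \<mu> by (simp add: prob_measure_on_def)
  have sets_\<mu> [measurable_cong]: "sets \<mu> = sets (restrict_space borel D)"
    using \<mu> by (simp add: prob_measure_on_def)
  then have space_\<mu>: "space \<mu> = D"
    using sets_eq_imp_space_eq[of \<mu> "restrict_space borel D"] by (simp add: space_restrict_space)
  interpret pair: pair_prob_space \<mu> M ..
  note id = prob_measure_on_id[OF \<mu>]
  note [measurable] = free_chain_measurable[OF id] alive_measurable[OF id]
  obtain d where d: "d \<in> D" using D_nonempty by auto
  \<comment> \<open>The value \<open>d\<close> off the event of survival only serves to have a map into \<open>D\<close>; it gets weight zero.\<close>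
  define Y where "Y q = (if alive D f \<xi> n q then free_chain f \<xi> n q else d)" for q
  have Y_D: "Y q \<in> D" if "q \<in> space (\<mu> \<Otimes>\<^sub>M M)" for q
  proof -
    have "free_chain f \<xi> n q \<in> D" if "alive D f \<xi> n q"
      using that \<open>q \<in> space _\<close> by (cases n) (auto simp: space_pair_measure space_\<mu> alive_Suc simp del: free_chain.simps(2))
    then show ?thesis using d by (simp add: Y_def)
  qed
  have Y_meas [measurable]: "Y \<in> measurable (\<mu> \<Otimes>\<^sub>M M) (restrict_space borel D)"
  proof (rule measurable_restrict_space2)
    show "Y \<in> space (\<mu> \<Otimes>\<^sub>M M) \<rightarrow> D" using Y_D by auto
    show "Y \<in> borel_measurable (\<mu> \<Otimes>\<^sub>M M)" unfolding Y_def by measurable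
  qed
  have Z1: "?Z \<le> 1"
  proof -
    have "?Z \<le> (\<integral>\<^sup>+x. 1 \<partial>\<mu>)" by (intro nn_integral_mono funpow_step_1_le)
    then show ?thesis by (simp add: \<mu>.emeasure_space_1)
  qed
  then have Z_fin: "?Z \<noteq> \<infinity>" by (auto simp: top_unique)
  have joint: "(\<integral>\<^sup>+q. F (free_chain f \<xi> n q) * indicator {q. alive D f \<xi> n q} q \<partial>(\<mu> \<Otimes>\<^sub>M M)) = (\<integral>\<^sup>+x. (step ^^ n) F x \<partial>\<mu>)"
    if [measurable]: "F \<in> borel_measurable borel" for F
    by (subst nn_integral_fst[symmetric], measurable) (simp add: nn_integral_free_chain)
  define N where "N = distr (density (\<mu> \<Otimes>\<^sub>M M) (\<lambda>q. indicator {q. alive D f \<xi> n q} q / ?Z))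
     (restrict_space borel D) Y"
  have int_N: "(\<integral>\<^sup>+x. F x \<partial>N) = (\<integral>\<^sup>+x. (step ^^ n) F x \<partial>\<mu>) / ?Z"
    if [measurable]: "F \<in> borel_measurable borel" for F
  proof -
    have [measurable]: "F \<in> borel_measurable (restrict_space borel D)"
      by (rule measurable_restrict_space1) measurable
    have "(\<integral>\<^sup>+x. F x \<partial>N) = (\<integral>\<^sup>+q. indicator {q. alive D f \<xi> n q} q / ?Z * F (Y q) \<partial>(\<mu> \<Otimes>\<^sub>M M))"
      unfolding N_def by (subst nn_integral_distr) (auto simp: nn_integral_density)
    also have "\<dots> = (\<integral>\<^sup>+q. F (free_chain f \<xi> n q) * indicator {q. alive D f \<xi> n q} q / ?Z \<partial>(\<mu> \<Otimes>\<^sub>M M))"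
      by (intro nn_integral_cong) (auto simp: Y_def indicator_def divide_ennreal_def mult.commute)
    also have "\<dots> = (\<integral>\<^sup>+q. F (free_chain f \<xi> n q) * indicator {q. alive D f \<xi> n q} q \<partial>(\<mu> \<Otimes>\<^sub>M M)) / ?Z"
      by (intro nn_integral_divide) measurable
    finally show ?thesis by (simp add: joint)
  qed
  have law_N: "conditional_law D f M \<xi> \<mu> n = N"
  proof -
    have "conditional_law D f M \<xi> \<mu> n = measure_of D (sets (restrict_space borel D)) (emeasure N)"
      unfolding conditional_law_def
    proof (rule measure_of_eq)
      show "sets (restrict_space borel D) \<subseteq> Pow D"
        using sets.space_closed[of "restrict_space borel D"] by (simp add: space_restrict_space)
      fix A assume "A \<in> sigma_sets D (sets (restrict_space borel D))"
      then have A: "A \<in> sets (restrict_space borel D)"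
        using sets.sigma_sets_eq[of "restrict_space borel D"] by (simp add: space_restrict_space)
      then have A' [measurable]: "A \<in> sets borel" "A \<subseteq> D"
        by (auto simp: sets_restrict_space_iff)
      have ev: "emeasure (\<mu> \<Otimes>\<^sub>M M) {q \<in> space (\<mu> \<Otimes>\<^sub>M M). free_chain f \<xi> n q \<in> S \<and> alive D f \<xi> n q}
          = (\<integral>\<^sup>+x. (step ^^ n) (indicator S) x \<partial>\<mu>)" if [measurable]: "S \<in> sets borel" for S
      proof -
        have "emeasure (\<mu> \<Otimes>\<^sub>M M) {q \<in> space (\<mu> \<Otimes>\<^sub>M M). free_chain f \<xi> n q \<in> S \<and> alive D f \<xi> n q}
          = (\<integral>\<^sup>+q. indicator {q \<in> space (\<mu> \<Otimes>\<^sub>M M). free_chain f \<xi> n q \<in> S \<and> alive D f \<xi> n q} q \<partial>(\<mu> \<Otimes>\<^sub>M M))"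
          by (rule nn_integral_indicator[symmetric]) measurable
        also have "\<dots> = (\<integral>\<^sup>+q. indicator S (free_chain f \<xi> n q) * indicator {q. alive D f \<xi> n q} q \<partial>(\<mu> \<Otimes>\<^sub>M M))"
          by (intro nn_integral_cong) (auto simp: indicator_def)
        finally show ?thesis by (simp add: joint)
      qed
      have c1: "{q \<in> space (\<mu> \<Otimes>\<^sub>M M). chain D f \<xi> n q \<in> Some ` A \<and> enat n < absorption_time D f \<xi> q}
        = {q \<in> space (\<mu> \<Otimes>\<^sub>M M). free_chain f \<xi> n q \<in> A \<and> alive D f \<xi> n q}"
        by (auto simp: less_absorption_time_iff chain_eq_free_chain)
      have c2: "{q \<in> space (\<mu> \<Otimes>\<^sub>M M). enat n < absorption_time D f \<xi> q}
        = {q \<in> space (\<mu> \<Otimes>\<^sub>M M). free_chain f \<xi> n q \<in> UNIV \<and> alive D f \<xi> n q}"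
        by (auto simp: less_absorption_time_iff)
      have e1: "ennreal (measure (\<mu> \<Otimes>\<^sub>M M) {q \<in> space (\<mu> \<Otimes>\<^sub>M M). chain D f \<xi> n q \<in> Some ` A \<and> enat n < absorption_time D f \<xi> q})
        = (\<integral>\<^sup>+x. (step ^^ n) (indicator A) x \<partial>\<mu>)"
        unfolding c1 pair.emeasure_eq_measure[symmetric] by (rule ev) measurable
      have e2: "ennreal (measure (\<mu> \<Otimes>\<^sub>M M) {q \<in> space (\<mu> \<Otimes>\<^sub>M M). enat n < absorption_time D f \<xi> q}) = ?Z"
        using ev[of UNIV] unfolding c2 pair.emeasure_eq_measure[symmetric] by simp
      have "ennreal \<P>(p in \<mu> \<Otimes>\<^sub>M M. chain D f \<xi> n p \<in> Some ` A \<bar> enat n < absorption_time D f \<xi> p)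
        = (\<integral>\<^sup>+x. (step ^^ n) (indicator A) x \<partial>\<mu>) / ?Z"
        unfolding cond_prob_def using Z
        by (subst divide_ennreal[symmetric]) (simp_all only: e1 e2 measure_nonneg flip: ennreal_less_zero_iff)
      also have "\<dots> = emeasure N A"
        using int_N[of "indicator A"] A by (simp add: N_def)
      finally show "ennreal \<P>(p in \<mu> \<Otimes>\<^sub>M M. chain D f \<xi> n p \<in> Some ` A \<bar> enat n < absorption_time D f \<xi> p) = emeasure N A" .
    qed
    also have "\<dots> = measure_of (space N) (sets N) (emeasure N)"
      by (simp add: N_def space_restrict_space)
    finally show ?thesis by (simp add: measure_of_of_measure)
  qed
  show "sets (conditional_law D f M \<xi> \<mu> n) = sets (restrict_space borel D)"
    by (simp add: law_N N_def)
  show "(\<integral>\<^sup>+x. F x \<partial>conditional_law D f M \<xi> \<mu> n) = (\<integral>\<^sup>+x. (step ^^ n) F x \<partial>\<mu>) / ?Z"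
    if "F \<in> borel_measurable borel" using int_N[OF that] by (simp add: law_N)
qed

end

section \<open>Conditional laws through the transition operator\<close>

lemma (in lyapunov_kernel) P_funpow_diff:
  assumes u: "dominated u c" and v: "dominated v d" and x: "x \<in> space \<rho>"
  shows "(P ^^ n) (\<lambda>x. u x - v x) x = (P ^^ n) u x - (P ^^ n) v x"
  using x
proof (induction n arbitrary: x)
  case (Suc n)
  have "(P ^^ Suc n) (\<lambda>x. u x - v x) x = (\<integral>y. p x y * (P ^^ n) (\<lambda>x. u x - v x) y \<partial>\<rho>)"
    by (simp add: P_def[of "(P ^^ n) (\<lambda>x. u x - v x)"])
  also have "\<dots> = (\<integral>y. p x y * (P ^^ n) u y - p x y * (P ^^ n) v y \<partial>\<rho>)"
    by (intro Bochner_Integration.integral_cong) (simp_all add: Suc.IH right_diff_distrib)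
  also have "\<dots> = P ((P ^^ n) u) x - P ((P ^^ n) v) x"
    unfolding P_def[of "(P ^^ n) u"] P_def[of "(P ^^ n) v"]
    by (intro Bochner_Integration.integral_diff weight_integrable[OF weight_p[OF Suc.prems] dominated_funpow[OF u]]
        weight_integrable[OF weight_p[OF Suc.prems] dominated_funpow[OF v]])
  finally show ?case by simp
qed simp

lemma (in lyapunov_kernel) P_funpow_nonneg:
  assumes "\<And>y. y \<in> space \<rho> \<Longrightarrow> 0 \<le> u y" "x \<in> space \<rho>"
  shows "0 \<le> (P ^^ n) u x"
  using assms(2)
proof (induction n arbitrary: x)
  case (Suc n)
  then show ?case by (auto intro!: P_nonneg)
qed (simp add: assms(1))

locale gaussian_chain = killed_chain M D f \<xi> G + gaussian_kernel D f m A A'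
  for M :: "'w measure" and D :: "(real^'d) set" and f \<xi> and G :: "(real^'d) measure" and m A A' +
  fixes CV :: real
  assumes G_eq: "G = distr std_gaussian borel (\<lambda>z. m + A *v z)"
    and lyapunov: "lyapunov_kernel \<rho> p phi1 B 1 CV"

sublocale gaussian_chain \<subseteq> K: lyapunov_kernel \<rho> p phi1 B 1 CV
  by (rule lyapunov)

context gaussian_chain
begin

lemma step_eq:
  assumes [measurable]: "F \<in> borel_measurable borel"
  shows "step F x = (\<integral>\<^sup>+y. ennreal (p x y) * F y \<partial>\<rho>)"
  unfolding killed_step_def G_eq
  by (subst nn_integral_affine_gaussian, measurable) (simp add: nn_integral_step_D)

text \<open>Passage from extended nonnegative functions on the whole space to real functions on \<open>D\<close>.\<close>
lemma funpow_step_eq: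
  assumes u: "K.dominated u c" "\<And>y. y \<in> D \<Longrightarrow> 0 \<le> u y"
    and F: "F \<in> borel_measurable borel" "\<And>y. y \<in> D \<Longrightarrow> F y = ennreal (u y)" and x: "x \<in> D"
  shows "(step ^^ n) F x = ennreal ((K.P ^^ n) u x)"
  using x
proof (induction n arbitrary: x)
  case (Suc n)
  have nonneg: "0 \<le> (K.P ^^ n) u y" if "y \<in> D" for y
    using that u(2) by (intro K.P_funpow_nonneg) auto
  have "(step ^^ Suc n) F x = (\<integral>\<^sup>+y. ennreal (p x y) * (step ^^ n) F y \<partial>\<rho>)"
    using step_eq[OF funpow_step_measurable[OF F(1)]] by simp
  also have "\<dots> = (\<integral>\<^sup>+y. ennreal (p x y * (K.P ^^ n) u y) \<partial>\<rho>)"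
    by (intro nn_integral_cong) (simp add: Suc.IH ennreal_mult' p_nonneg)
  also have "\<dots> = ennreal (\<integral>y. p x y * (K.P ^^ n) u y \<partial>\<rho>)"
    using Suc.prems nonneg
    by (intro nn_integral_eq_integral K.weight_integrable[OF K.weight_p K.dominated_funpow[OF u(1)]] AE_I2)
       (auto simp: p_nonneg)
  finally show ?case by (simp add: K.P_def[of "(K.P ^^ n) u"])
qed (simp add: F(2))

lemma measurable_extend:
  assumes "u \<in> borel_measurable (restrict_space borel D)"
  shows "(\<lambda>x. ennreal (indicator D x * u x)) \<in> borel_measurable borel"
proof -
  have "(\<lambda>x. indicator D x *\<^sub>R u x) \<in> borel_measurable borel"
    using assms by (subst (asm) borel_measurable_restrict_space_iff) auto
  then show ?thesis by simp
qed

lemma measurable_\<rho>_iff: "u \<in> borel_measurable \<rho> \<longleftrightarrow> u \<in> borel_measurable (restrict_space borel D)"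
  by (rule measurable_cong_sets[THEN eqset_imp_iff]) (simp_all add: sets_\<rho>)

context
  fixes \<mu> :: "(real^'d) measure"
  assumes \<mu>: "prob_measure_on D \<mu>" and \<mu>_phi1: "(\<integral>\<^sup>+x. ennreal (phi1 x) \<partial>\<mu>) < \<infinity>"
begin

interpretation \<mu>: prob_space \<mu>
  using \<mu> by (simp add: prob_measure_on_def)

lemma sets_\<mu>: "sets \<mu> = sets (restrict_space borel D)" and space_\<mu>: "space \<mu> = D"
  using \<mu> sets_eq_imp_space_eq[of \<mu> "restrict_space borel D"]
  by (simp_all add: prob_measure_on_def space_restrict_space)

lemma measurable_\<mu>_iff: "u \<in> borel_measurable \<mu> \<longleftrightarrow> u \<in> borel_measurable (restrict_space borel D)"
  by (rule measurable_cong_sets[THEN eqset_imp_iff]) (simp_all add: sets_\<mu>)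

lemma integrable_dominated:
  assumes u: "K.dominated u c"
  shows "integrable \<mu> u"
proof (rule Bochner_Integration.integrable_bound)
  have "phi1 \<in> borel_measurable \<mu>" unfolding measurable_\<mu>_iff by (rule measurable_restrict_space1) simp
  then have "integrable \<mu> phi1"
    using \<mu>_phi1 by (intro integrableI_nonneg) (auto simp: phi1_def)
  then show "integrable \<mu> (\<lambda>x. c * phi1 x)" by simp
  show "u \<in> borel_measurable \<mu>" using u by (simp add: K.dominated_def measurable_\<mu>_iff measurable_\<rho>_iff)
  show "AE x in \<mu>. norm (u x) \<le> norm (c * phi1 x)"
    using u by (intro AE_I2) (auto simp: K.dominated_def space_\<mu> intro: order_trans[OF _ abs_ge_self])
qed

lemma nn_integral_funpow_step:
  assumes u: "K.dominated u c" "\<And>y. y \<in> D \<Longrightarrow> 0 \<le> u y"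
    and F: "F \<in> borel_measurable borel" "\<And>y. y \<in> D \<Longrightarrow> F y = ennreal (u y)"
  shows "(\<integral>\<^sup>+x. (step ^^ n) F x \<partial>\<mu>) = ennreal (\<integral>x. (K.P ^^ n) u x \<partial>\<mu>)"
proof -
  have "(\<integral>\<^sup>+x. (step ^^ n) F x \<partial>\<mu>) = (\<integral>\<^sup>+x. ennreal ((K.P ^^ n) u x) \<partial>\<mu>)"
    by (intro nn_integral_cong funpow_step_eq[OF u F]) (simp_all add: space_\<mu>)
  also have "\<dots> = ennreal (\<integral>x. (K.P ^^ n) u x \<partial>\<mu>)"
    using K.P_funpow_nonneg[of u] u(2)
    by (intro nn_integral_eq_integral integrable_dominated[OF K.dominated_funpow[OF u(1)]] AE_I2)
       (simp add: space_\<mu>)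
  finally show ?thesis .
qed

lemma survival_prob_pos: "0 < (\<integral>x. K.survival n x \<partial>\<mu>)"
proof -
  have int: "integrable \<mu> (K.survival n)" by (rule integrable_dominated[OF K.dominated_survival])
  have pos: "0 < K.survival n x" if "x \<in> D" for x
    using K.survival_ge_mass[of x] K.mass_pos[of n] that
    by (metis less_le_trans mult_pos_pos space_\<rho>)
  show ?thesis
  proof (rule ccontr)
    assume "\<not> ?thesis"
    moreover have nn: "AE x in \<mu>. 0 \<le> K.survival n x"
      using pos by (intro AE_I2) (auto simp: space_\<mu> intro: less_imp_le)
    ultimately have "(\<integral>x. K.survival n x \<partial>\<mu>) = 0"
      using integral_nonneg_AE[OF nn] by linarith
    then have "AE x in \<mu>. K.survival n x = 0"
      using integral_nonneg_eq_0_iff_AE[OF int nn] by simp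
    then have "AE x in \<mu>. False"
      using AE_space by eventually_elim (use pos in \<open>force simp: space_\<mu>\<close>)
    then show False by simp
  qed
qed

lemma nn_integral_step_1: "(\<integral>\<^sup>+x. (step ^^ n) (\<lambda>_. 1) x \<partial>\<mu>) = ennreal (\<integral>x. K.survival n x \<partial>\<mu>)"
  unfolding K.survival_def by (rule nn_integral_funpow_step[OF K.dominated_1]) auto

lemma sets_conditional_law': "sets (conditional_law D f M \<xi> \<mu> n) = sets (restrict_space borel D)"
  by (rule sets_conditional_law[OF \<mu>]) (simp add: nn_integral_step_1 survival_prob_pos)

text \<open>
  For nonnegative \<open>u\<close> this is the law of the killed chain divided by the probability of survival; the
  general case follows by splitting \<open>u\<close> into its positive and negative parts.
\<close>
lemma has_integral_conditional_law:
  assumes u: "K.dominated u c"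
  shows "has_bochner_integral (conditional_law D f M \<xi> \<mu> n) u
     ((\<integral>x. (K.P ^^ n) u x \<partial>\<mu>) / (\<integral>x. K.survival n x \<partial>\<mu>))"
proof -
  let ?\<kappa> = "conditional_law D f M \<xi> \<mu> n" and ?z = "\<integral>x. K.survival n x \<partial>\<mu>"
  have space_\<kappa>: "space ?\<kappa> = D"
    using sets_eq_imp_space_eq[OF sets_conditional_law'] by (simp add: space_restrict_space)
  have nonneg: "has_bochner_integral ?\<kappa> u ((\<integral>x. (K.P ^^ n) u x \<partial>\<mu>) / ?z)"
    if u: "K.dominated u c" "\<And>y. y \<in> D \<Longrightarrow> 0 \<le> u y" for u c
  proof (rule has_bochner_integral_nn_integral)
    have u_meas: "u \<in> borel_measurable (restrict_space borel D)"
      using u(1) by (simp add: K.dominated_def measurable_\<rho>_iff)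
    then show "u \<in> borel_measurable ?\<kappa>"
      by (subst measurable_cong_sets[OF sets_conditional_law' refl])
    show "AE x in ?\<kappa>. 0 \<le> u x" using u(2) by (auto simp: space_\<kappa>)
    have int_nonneg: "0 \<le> (\<integral>x. (K.P ^^ n) u x \<partial>\<mu>)"
      using K.P_funpow_nonneg[of u] u(2) by (intro Bochner_Integration.integral_nonneg) (auto simp: space_\<mu>)
    then show "0 \<le> (\<integral>x. (K.P ^^ n) u x \<partial>\<mu>) / ?z" using survival_prob_pos[of n] by simp
    let ?F = "\<lambda>x. ennreal (indicator D x * u x)"
    have F: "?F \<in> borel_measurable borel" by (rule measurable_extend[OF u_meas])
    have "(\<integral>\<^sup>+x. ennreal (u x) \<partial>?\<kappa>) = (\<integral>\<^sup>+x. ?F x \<partial>?\<kappa>)"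
      by (intro nn_integral_cong) (simp add: space_\<kappa>)
    also have "\<dots> = (\<integral>\<^sup>+x. (step ^^ n) ?F x \<partial>\<mu>) / (\<integral>\<^sup>+x. (step ^^ n) (\<lambda>_. 1) x \<partial>\<mu>)"
      by (rule nn_integral_conditional_law[OF \<mu> _ F]) (simp add: nn_integral_step_1 survival_prob_pos)
    also have "(\<integral>\<^sup>+x. (step ^^ n) ?F x \<partial>\<mu>) = ennreal (\<integral>x. (K.P ^^ n) u x \<partial>\<mu>)"
      by (rule nn_integral_funpow_step[OF u F]) auto
    finally show "(\<integral>\<^sup>+x. ennreal (u x) \<partial>?\<kappa>) = ennreal ((\<integral>x. (K.P ^^ n) u x \<partial>\<mu>) / ?z)"
      using survival_prob_pos[of n] int_nonneg by (simp add: nn_integral_step_1 divide_ennreal)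
  qed
  let ?u1 = "\<lambda>x. max 0 (u x)" and ?u2 = "\<lambda>x. max 0 (- u x)"
  have d: "K.dominated ?u1 c" "K.dominated ?u2 c"
    using u K.dominated_nonneg[OF u] K.V_nonneg by (auto simp: K.dominated_def)
  have eq: "u = (\<lambda>x. ?u1 x - ?u2 x)" by auto
  have "has_bochner_integral ?\<kappa> (\<lambda>x. ?u1 x - ?u2 x)
     ((\<integral>x. (K.P ^^ n) ?u1 x \<partial>\<mu>) / ?z - (\<integral>x. (K.P ^^ n) ?u2 x \<partial>\<mu>) / ?z)"
    by (intro has_bochner_integral_diff nonneg[OF d(1)] nonneg[OF d(2)]) auto
  moreover have "(\<integral>x. (K.P ^^ n) u x \<partial>\<mu>) = (\<integral>x. (K.P ^^ n) ?u1 x - (K.P ^^ n) ?u2 x \<partial>\<mu>)"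
    by (subst eq, intro Bochner_Integration.integral_cong refl K.P_funpow_diff[OF d]) (simp add: space_\<mu>)
  moreover have "\<dots> = (\<integral>x. (K.P ^^ n) ?u1 x \<partial>\<mu>) - (\<integral>x. (K.P ^^ n) ?u2 x \<partial>\<mu>)"
    by (intro Bochner_Integration.integral_diff integrable_dominated[OF K.dominated_funpow[OF d(1)]]
        integrable_dominated[OF K.dominated_funpow[OF d(2)]])
  ultimately show ?thesis by (simp add: eq[symmetric] diff_divide_distrib)
qed

end

end

section \<open>Quasi-stationary distribution and convergence\<close>

context gaussian_chain
begin

text \<open>
  With \<open>\<phi>2 = inf_n survival n / mass n\<close> the probability of survival under \<open>\<mu>\<close> is at least
  \<open>mass n * \<mu>(\<phi>2)\<close>, and the factor \<open>mass n\<close> cancels against the one in the error bound.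
\<close>
lemma quasi_stationary_convergence:
  "\<exists>(\<phi>2 :: real^'d \<Rightarrow> real) \<nu> C \<alpha>.
      \<phi>2 \<in> borel_measurable (restrict_space borel D) \<and> (\<forall>x\<in>D. \<phi>2 x > 0) \<and>
      quasi_stationary D f M \<xi> \<nu> \<and> C > 0 \<and> 0 < \<alpha> \<and> \<alpha> < 1 \<and>
      (\<forall>\<mu>. prob_measure_on D \<mu> \<longrightarrow>
           (\<integral>\<^sup>+x. ennreal (phi1 x) \<partial>\<mu>) < \<infinity> \<longrightarrow>
           (\<integral>\<^sup>+x. ennreal (\<phi>2 x) \<partial>\<mu>) > 0 \<longrightarrow>
           (\<forall>n. tv_dist D phi1 (conditional_law D f M \<xi> \<mu> n) \<nu>
                  \<le> ennreal (C * \<alpha> ^ n) *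
                     ((\<integral>\<^sup>+x. ennreal (phi1 x) \<partial>\<mu>) / (\<integral>\<^sup>+x. ennreal (\<phi>2 x) \<partial>\<mu>))))"
proof -
  obtain r \<eta> C \<alpha> where r: "K.weight r" "(\<integral>x. r x \<partial>\<rho>) = 1" and \<eta>: "0 < \<eta>"
    and inv_all: "\<forall>u c. K.dominated u c \<longrightarrow> (\<integral>x. r x * K.P u x \<partial>\<rho>) = \<eta> * (\<integral>x. r x * u x \<partial>\<rho>)"
    and C: "0 < C" and \<alpha>: "0 < \<alpha>" "\<alpha> < 1"
    and conv_all: "\<forall>\<phi> n. K.dominated \<phi> 1 \<longrightarrow> (\<forall>x\<in>space \<rho>.
        \<bar>(K.P ^^ n) \<phi> x - (\<integral>y. r y * \<phi> y \<partial>\<rho>) * K.survival n x\<bar> \<le> C * \<alpha> ^ n * K.mass n * phi1 x)"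
    using K.geometric_convergence by (elim exE conjE) (rule that)
  have inv: "(\<integral>x. r x * K.P u x \<partial>\<rho>) = \<eta> * (\<integral>x. r x * u x \<partial>\<rho>)" if "K.dominated u c" for u c
    using inv_all that by blast
  have conv: "\<bar>(K.P ^^ n) \<phi> x - (\<integral>y. r y * \<phi> y \<partial>\<rho>) * K.survival n x\<bar> \<le> C * \<alpha> ^ n * K.mass n * phi1 x"
    if "K.dominated \<phi> 1" "x \<in> D" for \<phi> n x
    using conv_all that unfolding space_\<rho> by blast
  have r_meas [measurable]: "r \<in> borel_measurable \<rho>" and r_nonneg: "\<And>x. x \<in> D \<Longrightarrow> 0 \<le> r x"
    using r(1) by (auto simp: K.weight_def)
  define \<nu> where "\<nu> = density \<rho> (\<lambda>x. ennreal (r x))"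
  have sets_\<nu>: "sets \<nu> = sets (restrict_space borel D)" and space_\<nu>: "space \<nu> = D"
    by (simp_all add: \<nu>_def sets_\<rho>)
  have int_\<nu>: "(\<integral>x. u x \<partial>\<nu>) = (\<integral>x. r x * u x \<partial>\<rho>)" if "K.dominated u c" for u c
    unfolding \<nu>_def using that r_nonneg by (subst integral_density) (auto simp: K.dominated_def)
  have nn_\<nu>: "(\<integral>\<^sup>+x. ennreal (u x) \<partial>\<nu>) = ennreal (\<integral>x. r x * u x \<partial>\<rho>)"
    if u: "K.dominated u c" "\<And>x. x \<in> D \<Longrightarrow> 0 \<le> u x" for u c
  proof -
    have [measurable]: "u \<in> borel_measurable \<rho>" using u(1) by (simp add: K.dominated_def)
    have "(\<integral>\<^sup>+x. ennreal (u x) \<partial>\<nu>) = (\<integral>\<^sup>+x. ennreal (r x * u x) \<partial>\<rho>)"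
      unfolding \<nu>_def by (subst nn_integral_density) (auto intro!: nn_integral_cong simp: ennreal_mult' r_nonneg)
    also have "\<dots> = ennreal (\<integral>x. r x * u x \<partial>\<rho>)"
      using r_nonneg u(2) by (intro nn_integral_eq_integral K.weight_integrable[OF r(1) u(1)] AE_I2) auto
    finally show ?thesis .
  qed
  have prob_\<nu>: "prob_measure_on D \<nu>"
  proof -
    have "emeasure \<nu> (space \<nu>) = (\<integral>\<^sup>+x. ennreal 1 \<partial>\<nu>)" by simp
    also have "\<dots> = 1" using nn_\<nu>[OF K.dominated_1] r(2) by simp
    finally show ?thesis unfolding prob_measure_on_def using sets_\<nu> by (auto intro: prob_spaceI)
  qed
  have phi1_\<nu>: "(\<integral>\<^sup>+x. ennreal (phi1 x) \<partial>\<nu>) < \<infinity>"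
    using nn_\<nu>[OF K.dominated_V K.V_nonneg] by simp
  have pow: "(\<integral>x. (K.P ^^ n) u x \<partial>\<nu>) = \<eta> ^ n * (\<integral>x. r x * u x \<partial>\<rho>)" if u: "K.dominated u c" for u c n
  proof -
    have "(\<integral>x. r x * (K.P ^^ n) u x \<partial>\<rho>) = \<eta> ^ n * (\<integral>x. r x * u x \<partial>\<rho>)"
      using inv[OF K.dominated_funpow[OF u]] by (induction n) auto
    then show ?thesis using int_\<nu>[OF K.dominated_funpow[OF u]] by simp
  qed
  \<comment> \<open>Started from \<open>\<nu>\<close>, numerator and denominator of the conditional law both carry the factor \<open>\<eta> ^ n\<close>.\<close>
  have qsd: "quasi_stationary D f M \<xi> \<nu>"
    unfolding quasi_stationary_def
  proof (intro conjI allI prob_\<nu>)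
    fix n
    let ?\<kappa> = "conditional_law D f M \<xi> \<nu> n"
    have sets_\<kappa>: "sets ?\<kappa> = sets (restrict_space borel D)"
      by (rule sets_conditional_law'[OF prob_\<nu> phi1_\<nu>])
    show "?\<kappa> = \<nu>"
    proof (rule measure_eqI)
      show "sets ?\<kappa> = sets \<nu>" by (simp add: sets_\<kappa> sets_\<nu>)
      fix S assume S: "S \<in> sets ?\<kappa>"
      then have S_D: "S \<subseteq> D" "S \<in> sets \<rho>" using sets_\<kappa> sets_\<rho> sets.sets_into_space[OF S]
        sets_eq_imp_space_eq[OF sets_\<kappa>] by (auto simp: space_restrict_space)
      have d: "K.dominated (indicator S) 1"
        using S_D(2) by (auto simp: K.dominated_def phi1_def indicator_def)
      have "(\<integral>x. (K.P ^^ n) (indicator S) x \<partial>\<nu>) / (\<integral>x. K.survival n x \<partial>\<nu>) = (\<integral>x. r x * indicator S x \<partial>\<rho>)"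
        using pow[OF d, of n] pow[OF K.dominated_1, of n] \<eta> r(2) by (simp add: K.survival_def)
      with has_integral_conditional_law[OF prob_\<nu> phi1_\<nu> d, of n]
      have *: "has_bochner_integral ?\<kappa> (indicator S) (\<integral>x. r x * indicator S x \<partial>\<rho>)" by simp
      then have "integrable ?\<kappa> (indicator S :: _ \<Rightarrow> real)" by (rule integrable.intros)
      then have fin: "emeasure ?\<kappa> S < \<infinity>" using S by (subst (asm) integrable_indicator_iff) (simp add: Int_absorb2 sets.sets_into_space)
      have "measure ?\<kappa> S = (\<integral>x. r x * indicator S x \<partial>\<rho>)"
        using has_bochner_integral_integral_eq[OF *] S by (simp add: Int_absorb2 sets.sets_into_space)
      then have "emeasure ?\<kappa> S = ennreal (\<integral>x. r x * indicator S x \<partial>\<rho>)"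
        using fin by (simp add: emeasure_eq_ennreal_measure)
      also have "\<dots> = (\<integral>\<^sup>+x. ennreal (indicator S x) \<partial>\<nu>)" by (rule nn_\<nu>[OF d, symmetric]) simp
      also have "\<dots> = emeasure \<nu> S" using S sets_\<kappa> sets_\<nu> by (simp add: ennreal_indicator)
      finally show "emeasure ?\<kappa> S = emeasure \<nu> S" .
    qed
  qed
  define \<phi>2 where "\<phi>2 x = (INF n. K.survival n x / K.mass n)" for x
  have bdd: "bdd_below (range (\<lambda>n. K.survival n x / K.mass n))" if "x \<in> D" for x
    using that K.survival_nonneg[of x] K.mass_nonneg by (intro bdd_belowI[of _ 0]) auto
  have \<phi>2_meas: "\<phi>2 \<in> borel_measurable (restrict_space borel D)"
  proof -
    have "\<phi>2 \<in> borel_measurable \<rho>"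
      unfolding \<phi>2_def
    proof (rule borel_measurable_cINF)
      show "(\<lambda>x. K.survival n x / K.mass n) \<in> borel_measurable \<rho>" for n
        using K.dominated_survival[of n] by (auto simp: K.dominated_def)
      show "bdd_below (range (\<lambda>n. K.survival n x / K.mass n))" if "x \<in> space \<rho>" for x
        using bdd that by simp
    qed auto
    then show ?thesis by (simp add: measurable_\<rho>_iff)
  qed
  have \<phi>2_pos: "0 < \<phi>2 x" if x: "x \<in> D" for x
  proof -
    obtain k where k: "k > 0" "\<And>n. k * K.mass n \<le> K.survival n x" using K.survival_ge_mass[of x] x by auto
    have "k \<le> \<phi>2 x"
      unfolding \<phi>2_def using k(2) K.mass_pos by (intro cINF_greatest) (auto simp: pos_le_divide_eq)
    then show ?thesis using k(1) by simp
  qed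
  have \<phi>2_le: "\<phi>2 x \<le> K.survival n x / K.mass n" if "x \<in> D" for x n
    unfolding \<phi>2_def by (rule cINF_lower[OF bdd[OF that]]) simp
  have \<phi>2_dom: "K.dominated \<phi>2 (1 / K.mass 0)"
    unfolding K.dominated_def
  proof (intro conjI ballI)
    show "\<phi>2 \<in> borel_measurable \<rho>" using \<phi>2_meas by (simp add: measurable_\<rho>_iff)
    fix x assume x: "x \<in> space \<rho>"
    have "\<bar>\<phi>2 x\<bar> \<le> 1 / K.mass 0" using \<phi>2_le[of x 0] \<phi>2_pos[of x] x by simp
    also have "\<dots> \<le> 1 / K.mass 0 * phi1 x"
      using K.V_ge_1[OF x] K.mass_pos[of 0] mult_left_mono[of 1 "phi1 x" "1 / K.mass 0"] by simp
    finally show "\<bar>\<phi>2 x\<bar> \<le> 1 / K.mass 0 * phi1 x" .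
  qed
  show ?thesis
  proof (intro exI conjI allI impI ballI)
    show "\<phi>2 \<in> borel_measurable (restrict_space borel D)" by (rule \<phi>2_meas)
    show "0 < \<phi>2 x" if "x \<in> D" for x by (rule \<phi>2_pos[OF that])
    show "quasi_stationary D f M \<xi> \<nu>" by (rule qsd)
    show "0 < C" "0 < \<alpha>" "\<alpha> < 1" by fact+
    fix \<mu> :: "(real^'d) measure" and n
    assume \<mu>: "prob_measure_on D \<mu>" and fin: "(\<integral>\<^sup>+x. ennreal (phi1 x) \<partial>\<mu>) < \<infinity>"
      and pos: "(\<integral>\<^sup>+x. ennreal (\<phi>2 x) \<partial>\<mu>) > 0"
    let ?\<kappa> = "conditional_law D f M \<xi> \<mu> n"
    note int = integrable_dominated[OF \<mu> fin]
    note sp = space_\<mu>[OF \<mu> fin]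
    define I where "I = (\<integral>x. phi1 x \<partial>\<mu>)"
    define b where "b = (\<integral>x. \<phi>2 x \<partial>\<mu>)"
    define z where "z = (\<integral>x. K.survival n x \<partial>\<mu>)"
    have nnI: "(\<integral>\<^sup>+x. ennreal (phi1 x) \<partial>\<mu>) = ennreal I"
      unfolding I_def by (intro nn_integral_eq_integral int[OF K.dominated_V] AE_I2) (simp add: phi1_def)
    have nnb: "(\<integral>\<^sup>+x. ennreal (\<phi>2 x) \<partial>\<mu>) = ennreal b"
      unfolding b_def using \<phi>2_pos
      by (intro nn_integral_eq_integral int[OF \<phi>2_dom] AE_I2) (auto simp: sp intro: less_imp_le)
    have b: "0 < b" using pos by (simp add: nnb)
    have I: "0 \<le> I" unfolding I_def by (intro Bochner_Integration.integral_nonneg) (simp add: phi1_def)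
    have z: "0 < z" unfolding z_def by (rule survival_prob_pos[OF \<mu> fin])
    have z_ge: "K.mass n * b \<le> z"
    proof -
      have "K.mass n * b = (\<integral>x. K.mass n * \<phi>2 x \<partial>\<mu>)" by (simp add: b_def)
      also have "\<dots> \<le> z"
        unfolding z_def using \<phi>2_le[of _ n] K.mass_pos[of n]
        by (intro integral_mono integrable_mult_right int[OF \<phi>2_dom] int[OF K.dominated_survival])
           (simp add: sp field_simps)
      finally show ?thesis .
    qed
    have bound: "\<bar>(\<integral>x. h x \<partial>?\<kappa>) - (\<integral>x. h x \<partial>\<nu>)\<bar> \<le> C * \<alpha> ^ n * (I / b)"
      if h: "h \<in> borel_measurable (restrict_space borel D)" "\<forall>x\<in>D. \<bar>h x\<bar> \<le> phi1 x" for h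
    proof -
      have d: "K.dominated h 1" using h by (simp add: K.dominated_def measurable_\<rho>_iff)
      define s where "s = (\<integral>x. r x * h x \<partial>\<rho>)"
      have "(\<integral>x. h x \<partial>?\<kappa>) - (\<integral>x. h x \<partial>\<nu>) = (\<integral>x. (K.P ^^ n) h x \<partial>\<mu>) / z - s"
        using has_bochner_integral_integral_eq[OF has_integral_conditional_law[OF \<mu> fin d, of n]]
        by (simp add: int_\<nu>[OF d] z_def s_def)
      also have "\<dots> = ((\<integral>x. (K.P ^^ n) h x \<partial>\<mu>) - s * z) / z" using z by (simp add: field_simps)
      also have "(\<integral>x. (K.P ^^ n) h x \<partial>\<mu>) - s * z = (\<integral>x. (K.P ^^ n) h x - s * K.survival n x \<partial>\<mu>)"
        using int[OF K.dominated_funpow[OF d]] int[OF K.dominated_survival] by (simp add: z_def)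
      finally have "\<bar>(\<integral>x. h x \<partial>?\<kappa>) - (\<integral>x. h x \<partial>\<nu>)\<bar>
          = \<bar>\<integral>x. (K.P ^^ n) h x - s * K.survival n x \<partial>\<mu>\<bar> / z" using z by simp
      also have "\<dots> \<le> (C * \<alpha> ^ n * K.mass n * I) / z"
      proof (intro divide_right_mono)
        have "\<bar>\<integral>x. (K.P ^^ n) h x - s * K.survival n x \<partial>\<mu>\<bar> \<le> (\<integral>x. \<bar>(K.P ^^ n) h x - s * K.survival n x\<bar> \<partial>\<mu>)"
          by (rule integral_abs_bound)
        also have "\<dots> \<le> (\<integral>x. C * \<alpha> ^ n * K.mass n * phi1 x \<partial>\<mu>)"
          using conv[OF d] int[OF K.dominated_V]
          by (intro integral_mono integrable_abs Bochner_Integration.integrable_diff integrable_mult_right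
              int[OF K.dominated_funpow[OF d]] int[OF K.dominated_survival]) (simp_all add: sp s_def)
        finally show "\<bar>\<integral>x. (K.P ^^ n) h x - s * K.survival n x \<partial>\<mu>\<bar> \<le> C * \<alpha> ^ n * K.mass n * I"
          by (simp add: I_def)
      qed (use z in simp)
      also have "\<dots> \<le> (C * \<alpha> ^ n * K.mass n * I) / (K.mass n * b)"
        using z z_ge C \<alpha> K.mass_pos[of n] b I by (intro divide_left_mono) auto
      also have "\<dots> = C * \<alpha> ^ n * (I / b)" using K.mass_pos[of n] by simp
      finally show ?thesis .
    qed
    have "tv_dist D phi1 ?\<kappa> \<nu> \<le> ennreal (C * \<alpha> ^ n * (I / b))"
      unfolding tv_dist_def by (intro SUP_least ennreal_leI) (use bound in auto)
    also have "\<dots> = ennreal (C * \<alpha> ^ n) * (ennreal I / ennreal b)"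
      unfolding divide_ennreal[OF I b] using C \<alpha> I b by (intro ennreal_mult) auto
    finally show "tv_dist D phi1 ?\<kappa> \<nu> \<le> ennreal (C * \<alpha> ^ n) *
        ((\<integral>\<^sup>+x. ennreal (phi1 x) \<partial>\<mu>) / (\<integral>\<^sup>+x. ennreal (\<phi>2 x) \<partial>\<mu>))"
      by (simp add: nnI nnb)
  qed
qed

end

theorem theorem1p2:
  fixes D :: "(real^'d) set"
    and f :: "real^'d \<Rightarrow> real^'d"
    and M :: "'w measure"
    and \<xi> :: "nat \<Rightarrow> 'w \<Rightarrow> real^'d"
    and G :: "(real^'d) measure"
  assumes D_meas: "D \<in> sets borel"
    and D_pos: "emeasure lborel D > 0"
    and f_meas: "f \<in> borel_measurable borel"
    and f_bdd: "locally_bounded f"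
    and f_lim: "filterlim (\<lambda>x. norm x - norm (f x)) at_top at_infinity"
    and M: "prob_space M"
    and xi_indep: "prob_space.indep_vars M (\<lambda>_. borel) \<xi> UNIV"
    and xi_law: "\<And>n. distr M borel (\<xi> n) = G"
    and G_gauss: "gaussian_law G"
    and G_nondeg: "nondegenerate G"
  shows "\<exists>(\<phi>2 :: real^'d \<Rightarrow> real) (\<nu> :: (real^'d) measure) (C :: real) (\<alpha> :: real).
      \<phi>2 \<in> borel_measurable (restrict_space borel D) \<and> (\<forall>x\<in>D. \<phi>2 x > 0) \<and>
      quasi_stationary D f M \<xi> \<nu> \<and> C > 0 \<and> 0 < \<alpha> \<and> \<alpha> < 1 \<and>
      (\<forall>\<mu>. prob_measure_on D \<mu> \<longrightarrow>
           (\<integral>\<^sup>+x. ennreal (phi1 x) \<partial>\<mu>) < \<infinity> \<longrightarrow>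
           (\<integral>\<^sup>+x. ennreal (\<phi>2 x) \<partial>\<mu>) > 0 \<longrightarrow>
           (\<forall>n. tv_dist D phi1 (conditional_law D f M \<xi> \<mu> n) \<nu>
                  \<le> ennreal (C * \<alpha> ^ n) *
                     ((\<integral>\<^sup>+x. ennreal (phi1 x) \<partial>\<mu>) / (\<integral>\<^sup>+x. ennreal (\<phi>2 x) \<partial>\<mu>))))"
proof -
  interpret M: prob_space M by (rule M)
  have "\<xi> 0 \<in> borel_measurable M" using xi_indep by (auto simp: M.indep_vars_def)
  then have G_prob: "prob_space G" using M.prob_space_distr[of "\<xi> 0" borel] xi_law by simp
  obtain m :: "real^'d" and A :: "real^'d^'d" where G: "G = distr std_gaussian borel (\<lambda>z. m + A *v z)"
    using G_gauss unfolding gaussian_law_def by blast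
  obtain A' where A': "A ** A' = mat 1" "A' ** A = mat 1"
    using nondegenerate_imp_invertible[OF G G_prob G_nondeg] by (auto simp: invertible_def)
  interpret gaussian_kernel D f m A A'
    by unfold_locales (use D_meas D_pos f_meas f_bdd f_lim A' in auto)
  obtain CV where CV: "lyapunov_kernel \<rho> p phi1 B 1 CV" using lyapunov_kernel_gaussian by auto
  have "D \<noteq> {}" using D_pos by auto
  interpret gaussian_chain M D f \<xi> G m A A' CV
  proof (intro gaussian_chain.intro killed_chain.intro killed_chain_axioms.intro gaussian_chain_axioms.intro)
    show "gaussian_kernel D f A A'" by (rule gaussian_kernel_axioms)
    show "prob_space M" "D \<in> sets borel" "D \<noteq> {}" "f \<in> borel_measurable borel" by fact+
    show "M.indep_vars (\<lambda>_. borel) \<xi> UNIV" "distr M borel (\<xi> n) = G" for n by fact+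
    show "G = distr std_gaussian borel (\<lambda>z. m + A *v z)" "lyapunov_kernel \<rho> p phi1 B 1 CV" by fact+
  qed
  show ?thesis by (rule quasi_stationary_convergence)
qed

end
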